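(* Let $W$ be the lower-bounded generalized $g$-twisted $V$-module obtained (as described in the context) from twisted field data $(W,\phi_W^i,\psi_W^a,L_W(0),L_W(-1),g,\mathcal L_g,\mathcal S_g,\mathcal N_g)$ satisfying Properties 1--7 of the context (for example, $W=\widehat M^{[g]}_B$). Then $W$ (in particular, $\widehat M^{[g]}_B$) is spanned by the elements $$(\phi^{i_1}_W)_{n_1,k_1}\cdots(\phi^{i_l}_W)_{n_l,k_l}L_W(-1)^k(\psi_W^a)_{-1,0}\mathbf 1$$ for $i_1,\dots,i_l\in I$, $n_1\in\alpha^{i_1}+\mathbb Z,\dots,n_l\in\alpha^{i_l}+\mathbb Z$, $0\le k_1\le K^{i_1},\dots,0\le k_l\le K^{i_l}$, $a\in A$, $k\in\mathbb N$. In particular, $W$ is generated by the elements $(\psi_W^a)_{-1,0}\mathbf 1$, $a\in A$.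
   Context: $\mathbb N=\{0,1,2,\dots\}$. $V$ is a grading-restricted vertex superalgebra: a $\frac12\mathbb Z\times\mathbb Z_2$-graded complex vector space (weight $\mathrm{wt}$, fermion number $|\cdot|$) $V=\coprod_n V_{(n)}$ with $\dim V_{(n)}<\infty$, $V_{(n)}=0$ for $n$ sufficiently negative, an even vacuum $\mathbf 1\in V_{(0)}$, an even map $Y_V:V\otimes V\to V((x))$, operators $L_V(0)$ (equal to $n$ on $V_{(n)}$) and $L_V(-1)$, satisfying the vacuum and creation properties, the super Jacobi identity, $[L_V(0),Y_V(v,x)]=x\frac{d}{dx}Y_V(v,x)+Y_V(L_V(0)v,x)$ and $\frac{d}{dx}Y_V(v,x)=Y_V(L_V(-1)v,x)=[L_V(-1),Y_V(v,x)]$. $g$ is an automorphism of $V$ (bijection preserving gradings, $\mathbf 1$, $Y_V$, commuting with $L_V(-1)$). $P_V=\{\alpha\in\mathbb C:0\le\Re\alpha<1,\ e^{2\pi i\alpha}\text{ is an eigenvalue of }g\}$, $V^{[\alpha]}$ is the generalized $e^{2\pi i\alpha}$-eigenspace, $V=\coprod_{\alpha\in P_V}V^{[\alpha]}$, $g=e^{2\pi i\mathcal L_g}$ with $\mathcal L_g=\mathcal S_g+\mathcal N_g$, $\mathcal S_g=\alpha$ on $V^{[\alpha]}$ and $\mathcal N_g$ (locally) nilpotent. A lower-bounded generalized $g$-twisted $V$-module is $W=\coprod_{n\in\mathbb C,s\in\mathbb Z_2,[\alpha]\in\mathbb C/\mathbb Z}W^{s;[\alpha]}_{[n]}$ (weight,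 fermion number, $g$-weight), $W_{[n]}=0$ for $\Re n$ sufficiently negative, with an action of $g=e^{2\pi i\mathcal L_g}$, $\mathcal L_g=\mathcal S_g+\mathcal N_g$ (semisimple and nilpotent parts), $W^{[\alpha]}$ being the generalized $e^{2\pi i\alpha}$-eigenspace of $g$; operators $L_W(0)$, $L_W(-1)$, $W_{[n]}$ being the generalized $n$-eigenspace of $L_W(0)$, $[L_W(0),L_W(-1)]=L_W(-1)$; and an even linear map $Y^g_W:V\otimes W\to W\{x\}[\log x]$, $Y_W^g(v,x)w=\sum_{n\in\mathbb C,k\in\mathbb N}(Y_W^g)_{n,k}(v)w\,x^{-n-1}(\log x)^k$, such that: $Y_W^g(\mathbf 1,x)=1_W$; $gY_W^g(v,x)w=Y_W^g(gv,x)gw$; $[L_W(0),Y_W^g(v,x)]=x\frac{d}{dx}Y_W^g(v,x)+Y_W^g(L_V(0)v,x)$; $\frac{d}{dx}Y_W^g(v,x)=Y_W^g(L_V(-1)v,x)=[L_W(-1),Y_W^g(v,x)]$; equivariance $(Y^g_W)^{p+1}(gv,z)=(Y_W^g)^p(v,z)$, where $(Y_W^g)^p(v,z)$ ($p\in\mathbb Z$, $z\in\mathbb C^\times$) is obtained by $x^n\mapsto e^{nl_p(z)}$, $\log x\mapsto l_p(z)=\log|z|+i\arg z+2\pi ip$, $0\le\arg z<2\pi$; duality: for $u,v\in V$, $w\in W$, $w'\in W'$ (graded dual) there is $f=\sum a_{ijkl}z_1^{m_i}z_2^{n_j}(\log z_1)^k(\log z_2)^l(z_1-z_2)^{-t}$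 (finite sum) such that $\langle w',(Y_W^g)^p(u,z_1)(Y_W^g)^p(v,z_2)w\rangle$, $(-1)^{|u||v|}\langle w',(Y_W^g)^p(v,z_2)(Y_W^g)^p(u,z_1)w\rangle$, $\langle w',(Y_W^g)^p(Y_V(u,z_1-z_2)v,z_2)w\rangle$ converge absolutely for $|z_1|>|z_2|>0$, $|z_2|>|z_1|>0$, $|z_2|>|z_1-z_2|>0$ respectively, to the branch of $f$ given by $\log z_j=l_p(z_j)$ (for the third, when $|\arg z_1-\arg z_2|<\pi/2$). $W$ is generated by a subset $S$ if $W$ is spanned by the coefficients of $Y_W^g(v,x)L_W(-1)^pL_W(0)^qw$, $v\in V$, $p,q\in\mathbb N$, $w\in S$ (equivalently, by products of coefficients of twisted vertex operators applied to $L_W(-1)^pL_W(0)^qw$). Generating fields of $V$: $\phi^i(x)=Y_V(\phi^i_{-1}\mathbf 1,x)=\sum_{n\in\mathbb Z}\phi^i_nx^{-n-1}$, $i\in I$, generate $V$ (i.e. the $\phi^{i_1}_{m_1}\cdots\phi^{i_l}_{m_l}\mathbf 1$ span $V$); each $\phi^i_{-1}\mathbf 1$ is homogeneous of weight $\mathrm{wt}\,\phi^i$ and fermion number $|\phi^i|$, lies in $V^{[\alpha^i]}$, $\alpha^i\in P_V$, and $\mathcal N_g\phi^i_{-1}\mathbf 1$ is $0$ or equals $\phi^{\mathcal N_g(i)}_{-1}\mathbf 1$ for some $\mathcal N_g(i)\in I$. $K^i\in\mathbb N$ satisfies $\mathcal N_g^{K^i+1}\phi^i_{-1}\mathbf 1=0$.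 A field with index $0$ or $\mathcal N_g(i)$ undefined is $0$. Expansions: $(x_1-x_2)^\beta$, $\log(x_1-x_2)$ are expanded in nonnegative powers of $x_2$; $(-x_2+x_1)^\beta$, $\log(-x_2+x_1)$ in nonnegative powers of $x_1$, with $(-x_2)^\beta=e^{\pi i\beta}x_2^\beta$, $\log(-x_2)=\log x_2+\pi i$. Twisted field data: (a) a $\mathbb C\times\mathbb Z_2\times\mathbb C/\mathbb Z$-graded space $W=\coprod W_{[n]}^{s;[\alpha]}$ with $W_{[n]}=0$ for $\Re n$ sufficiently negative; $P_W$ the set of $\alpha$, $0\le\Re\alpha<1$, occurring as $g$-weights; (b) linear maps $\phi_W^i(x):W\to x^{-\alpha^i}W((x))[\log x]$, $\phi_W^i(x)w=\sum_{k\in\mathbb N}\sum_{n\in\alpha^i+\mathbb Z}(\phi_W^i)_{n,k}w\,x^{-n-1}(\log x)^k$, $i\in I$, with branches $\phi_W^{i;p}(z)$; (c) linear maps $\psi_W^a$, $a\in A$, with $\psi_W^a(x)v=\sum_{k\in\mathbb N}\sum_{n\in\alpha+\mathbb Z}(\psi_W^a)_{n,k}v\,x^{-n-1}(\log x)^k\in x^{-\alpha}W((x))[\log x]$ for $v\in V^{[\alpha]}$; (d) operators $L_W(0),L_W(-1)$ on $W$; (e) an action of $g=e^{2\pi i\mathcal L_g}$ on $W$, $\mathcal L_g=\mathcal S_g+\mathcal N_g$. Properties: 1. $L_W(0)=L_W(0)_S+L_W(0)_N$ (semisimple, nilpotent); $[L_W(0),\phi^i_W(x)]=x\frac{d}{dx}\phi^i_W(x)+(\mathrm{wt}\,\phi^i)\phi^i_W(x)$;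 for $a\in A$ there is $\mathrm{wt}\,\psi_W^a\in\mathbb C$ and, when $L_W(0)_N\psi_W^a(x)\ne0$, $L_W(0)_N(a)\in A$ with $L_W(0)\psi_W^a(x)-\psi_W^a(x)L_V(0)=x\frac{d}{dx}\psi_W^a(x)+(\mathrm{wt}\,\psi_W^a)\psi_W^a(x)+\psi_W^{L_W(0)_N(a)}(x)$ (last term $0$ when $L_W(0)_N\psi_W^a(x)=0$). 2. $[L_W(-1),\phi_W^i(x)]=\frac{d}{dx}\phi_W^i(x)$, $L_W(-1)\psi_W^a(x)-\psi_W^a(x)L_V(-1)=\frac{d}{dx}\psi_W^a(x)$. 3. $\psi_W^a(x)\mathbf 1\in W[[x]]$ with constant term homogeneous in weight, fermion number, $g$-weight. 4. $W$ is spanned by the $(\phi_W^{i_1})_{n_1,l_1}\cdots(\phi_W^{i_k})_{n_k,l_k}(\psi_W^a)_{n,l}v$, $v\in V$. 5. (i) $g\phi_W^{i;p+1}(z)g^{-1}=\phi_W^{i;p}(z)$; (ii) $\phi_W^i(x)=x^{-\mathcal N_g}(\phi_W^i)_0(x)x^{\mathcal N_g}$, $\psi_W^a(x)=(\psi_W^a)_0(x)x^{-\mathcal N_g}$, subscript $0$ denoting the constant term in $\log x$; (iii) $e^{2\pi i\mathcal S_g}\phi_W^i(z)e^{-2\pi i\mathcal S_g}=e^{2\pi i\alpha^i}\phi_W^i(z)$, $[\mathcal N_g,\phi_W^i(z)]=\phi_W^{\mathcal N_g(i)}(z)$; (iv) for $a\in A$ there is $\alpha^a\in P_W$ with $(\psi_W^a)_{n,0}\mathbf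 1$, $n\in-\mathbb N-1$, generalized eigenvectors of $g$ with eigenvalue $e^{2\pi i\alpha^a}$. 6. For $i,j\in I$ there is $M_{ij}\in\mathbb Z_+$ with $(x_1-x_2)^{M_{ij}}\phi_W^i(x_1)\phi_W^j(x_2)=(-1)^{|\phi^i||\phi^j|}(x_1-x_2)^{M_{ij}}\phi_W^j(x_2)\phi_W^i(x_1)$. 7. For $i\in I,a\in A$ there is $M_{ia}\in\mathbb Z_+$ with $(x_1-x_2)^{\alpha^i+M_{ia}}(x_1-x_2)^{\mathcal N_g}\phi_W^i(x_1)(x_1-x_2)^{-\mathcal N_g}\psi_W^a(x_2)=(-1)^{|\phi^i||\psi^a|}(-x_2+x_1)^{\alpha^i+M_{ia}}\psi_W^a(x_2)(-x_2+x_1)^{\mathcal N_g}\phi^i(x_1)(-x_2+x_1)^{-\mathcal N_g}$. It is known that such data carry a unique structure of lower-bounded generalized $g$-twisted $V$-module generated by the $(\psi_W^a)_{n,k}v$ with $Y_W^g(\phi^i_{-1}\mathbf 1,z)=\phi_W^i(z)$; this is the module $W$ of the claim. Construction of $\widehat M^{[g]}_B$. $M$ is a $\mathbb Z_2$-graded space with an action of $g=e^{2\pi i\mathcal L_g}$ ($\mathcal L_g=\mathcal S_g+\mathcal N_g$) and an operator $L_M(0)=L_M(0)_S+L_M(0)_N$ (semisimple and nilpotent parts); $M$ is a direct sum of generalized eigenspaces of $L_M(0)$, with real parts of eigenvalues (weights) bounded below by $B\in\mathbb R$; $\{w^a\}_{a\in A}$ is a basis homogeneous in weight, fermion number, $g$-weight,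 with $L_M(0)_Nw^a=w^{L_M(0)_N(a)}$, $L_M(0)_N(a)\in A$ or $w^{L_M(0)_N(a)}:=0$. Let $\hat V=\coprod_{i,k}\mathbb C\mathcal N_g^k\phi^i_{-1}\mathbf 1\otimes t^{\alpha^i}\mathbb C[t,t^{-1}]\oplus\mathbb CL_0\oplus\mathbb CL_{-1}$, $\hat\phi^i(x)=\sum_{n\in\alpha^i+\mathbb Z}((x^{-\mathcal N_g}\phi^i_{-1}\mathbf 1)\otimes t^n)x^{-n-1}$, and let $U$ be the tensor algebra of $\hat V$ modulo the ideal generated by the coefficients of $(x_1-x_2)^{M_{ij}}(\hat\phi^i(x_1)\hat\phi^j(x_2)-(-1)^{|\phi^i||\phi^j|}\hat\phi^j(x_2)\hat\phi^i(x_1))$, $[L_0,\hat\phi^i(x)]-x\frac{d}{dx}\hat\phi^i(x)-(\mathrm{wt}\,\phi^i)\hat\phi^i(x)$, $[L_{-1},\hat\phi^i(x)]-\frac{d}{dx}\hat\phi^i(x)$, with $M_{ij}$ the smallest positive integer such that $x^{M_{ij}}Y_V(\phi^i_{-1}\mathbf 1,x)\phi^j_{-1}\mathbf 1\in V[[x]]$. Let $\widetilde M=\coprod_{\alpha\in P_V}U\otimes(M\otimes t^\alpha\mathbb C[t,t^{-1}])\otimes V^{[\alpha]}$, where $\phi^i(x),L(0),L(-1)$ act by left multiplication by $\hat\phi^i(x),L_0,L_{-1}$, and $\psi^a(x)v=\sum_{n\in\alpha+\mathbb Z}(w^a\otimes t^n)\otimes x^{-\mathcal N_g}v\,x^{-n-1}$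 for $v\in V^{[\alpha]}$; subscripts $n,k$ denote coefficients of $x^{-n-1}(\log x)^k$. $\widehat M^{[g]}_B$ is the quotient of $\widetilde M$ by the $U$-submodule generated by: (i) $\psi^a_{n,0}\mathbf 1$, $n\notin-\mathbb N-1$; (ii) $\phi^{i_1}_{n_1,k_1}\cdots\phi^{i_l}_{n_l,k_l}L(0)^pL(-1)^q\psi^a_{n,k}v$ ($v$ homogeneous) with $\Re(\sum_j(\mathrm{wt}\,\phi^{i_j}-n_j-1)+q+\mathrm{wt}\,w^a-n-1+\mathrm{wt}\,v)<B$; (iii) the coefficients of the difference of the two sides of Property 7 (for $\phi^i,\psi^a$ on $\widetilde M$, applied to $v\in V$, sign $(-1)^{|\phi^i||w^a|}$), with $M_{ia}$ the smallest positive integer greater than $\mathrm{wt}\,\phi^i-1+\Re(\mathrm{wt}\,w^a)-B-\Re(\alpha^i)$; (iv) the coefficients of $L(0)\psi^a(x)v-\psi^a(x)L_V(0)v-x\frac{d}{dx}\psi^a(x)v-(\mathrm{wt}\,w^a)\psi^a(x)v-\psi^{L_M(0)_N(a)}(x)v$ and $L(-1)\psi^a(x)v-\psi^a(x)L_V(-1)v-\frac{d}{dx}\psi^a(x)v$. The induced objects (with $g$ and fermion numbers induced from $V$ and $M$) satisfy Properties 1--7. *)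

theory Defs
  imports "HOL-Analysis.Analysis" "HOL-Computational_Algebra.Formal_Power_Series"
    "HOL-Library.Poly_Mapping"
begin

section \<open>Complex vector spaces\<close>

class complex_vector = ab_group_add +
  fixes scaleC :: "complex \<Rightarrow> 'a \<Rightarrow> 'a"  (infixr "*\<^sub>C" 75)
  assumes scaleC_add_right: "a *\<^sub>C (x + y) = a *\<^sub>C x + a *\<^sub>C y"
    and scaleC_add_left: "(a + b) *\<^sub>C x = a *\<^sub>C x + b *\<^sub>C x"
    and scaleC_scaleC: "a *\<^sub>C b *\<^sub>C x = (a * b) *\<^sub>C x"
    and scaleC_one: "1 *\<^sub>C x = x"

global_interpretation complex_vector:
  vector_space "scaleC :: complex \<Rightarrow> 'a \<Rightarrow> 'a :: complex_vector"
  by unfold_locales (rule scaleC_add_right scaleC_add_left scaleC_scaleC scaleC_one)+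

abbreviation csubspace :: "'a::complex_vector set \<Rightarrow> bool"
  where "csubspace \<equiv> module.subspace scaleC"

abbreviation cspan :: "'a::complex_vector set \<Rightarrow> 'a set"
  where "cspan \<equiv> module.span scaleC"

abbreviation cindependent :: "'a::complex_vector set \<Rightarrow> bool"
  where "cindependent S \<equiv> \<not> module.dependent scaleC S"

abbreviation clinear :: "('a::complex_vector \<Rightarrow> 'b::complex_vector) \<Rightarrow> bool"
  where "clinear \<equiv> Vector_Spaces.linear scaleC scaleC"

instantiation complex :: complex_vector
begin
definition scaleC_complex :: "complex \<Rightarrow> complex \<Rightarrow> complex"
  where "scaleC_complex a x = a * x"
instance by standard (simp_all add: scaleC_complex_def algebra_simps)
end

instantiation poly_mapping :: (type, complex_vector) complex_vector
begin
definition scaleC_poly_mapping :: "complex \<Rightarrow> ('a \<Rightarrow>\<^sub>0 'b) \<Rightarrow> ('a \<Rightarrow>\<^sub>0 'b)"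
  where "scaleC_poly_mapping a x = Poly_Mapping.map (\<lambda>y. a *\<^sub>C y) x"
instance
proof
  fix a b :: complex and x y :: "'a \<Rightarrow>\<^sub>0 'b"
  have l: "Poly_Mapping.lookup (c *\<^sub>C z) k = c *\<^sub>C Poly_Mapping.lookup z k"
    for c and z :: "'a \<Rightarrow>\<^sub>0 'b" and k
    unfolding scaleC_poly_mapping_def by (simp add: Poly_Mapping.map.rep_eq when_def)
  show "a *\<^sub>C (x + y) = a *\<^sub>C x + a *\<^sub>C y"
    by (rule poly_mapping_eqI) (simp add: l lookup_add scaleC_add_right)
  show "(a + b) *\<^sub>C x = a *\<^sub>C x + b *\<^sub>C x"
    by (rule poly_mapping_eqI) (simp add: l lookup_add scaleC_add_left)
  show "a *\<^sub>C b *\<^sub>C x = (a * b) *\<^sub>C x"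
    by (rule poly_mapping_eqI) (simp add: l scaleC_scaleC)
  show "1 *\<^sub>C x = x"
    by (rule poly_mapping_eqI) (simp add: l scaleC_one)
qed
end

definition graded :: "'k set \<Rightarrow> ('k \<Rightarrow> 'a::complex_vector set) \<Rightarrow> bool"
  where "graded K X \<longleftrightarrow> (\<forall>k\<in>K. csubspace (X k)) \<and>
    (\<forall>x. \<exists>!f. finite {k. f k \<noteq> 0} \<and> {k. f k \<noteq> 0} \<subseteq> K \<and> (\<forall>k\<in>K. f k \<in> X k) \<and>
       x = (\<Sum>k | f k \<noteq> 0. f k))"

definition gen_eigenspace :: "('a::complex_vector \<Rightarrow> 'a) \<Rightarrow> complex \<Rightarrow> 'a set"
  where "gen_eigenspace T c = {x. \<exists>k. ((\<lambda>y. T y - c *\<^sub>C y) ^^ k) x = 0}"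

definition locally_nilpotent :: "('a::complex_vector \<Rightarrow> 'a) \<Rightarrow> bool"
  where "locally_nilpotent T \<longleftrightarrow> (\<forall>x. \<exists>k. (T ^^ k) x = 0)"

definition semisimple_nilpotent_parts ::
  "('a::complex_vector \<Rightarrow> 'a) \<Rightarrow> ('a \<Rightarrow> 'a) \<Rightarrow> ('a \<Rightarrow> 'a) \<Rightarrow> bool"
  where "semisimple_nilpotent_parts T S N \<longleftrightarrow> clinear S \<and> clinear N \<and>
    (\<forall>x. T x = S x + N x) \<and>
    graded UNIV (gen_eigenspace T) \<and> (\<forall>c. \<forall>x\<in>gen_eigenspace T c. S x = c *\<^sub>C x) \<and>
    locally_nilpotent N"

text \<open>
  Infinite sums of vectors are written with \<^const>\<open>Sum_any\<close>; wherever it is used, only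
  finitely many terms are nonzero.
\<close>

text \<open>The operator $e^{cN}$ for a locally nilpotent $N$.\<close>
definition exp_nilpotent :: "complex \<Rightarrow> ('a::complex_vector \<Rightarrow> 'a) \<Rightarrow> 'a \<Rightarrow> 'a"
  where "exp_nilpotent c N x = Sum_any (\<lambda>k::nat. (c ^ k / fact k) *\<^sub>C (N ^^ k) x)"

definition e2pi :: "complex \<Rightarrow> complex"
  where "e2pi \<alpha> = exp (2 * of_real pi * \<i> * \<alpha>)"

text \<open>The operator $e^{2\pi i S}$ for a diagonalizable $S$.\<close>
definition exp_2pi_semisimple :: "('a::complex_vector \<Rightarrow> 'a) \<Rightarrow> 'a \<Rightarrow> 'a"
  where "exp_2pi_semisimple S =
    (THE E. clinear E \<and> (\<forall>\<beta> x. S x = \<beta> *\<^sub>C x \<longrightarrow> E x = e2pi \<beta> *\<^sub>C x))"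

text \<open>Representatives of $\mathbb{C}/\mathbb{Z}$.\<close>
definition strip :: "complex set"
  where "strip = {\<alpha>. 0 \<le> Re \<alpha> \<and> Re \<alpha> < 1}"

text \<open>Fermion numbers in $\mathbb{Z}_2$ are Booleans, \<^const>\<open>True\<close> meaning odd; addition is \<open>\<noteq>\<close>.\<close>
definition koszul :: "bool \<Rightarrow> bool \<Rightarrow> complex"
  where "koszul s t = (if s \<and> t then -1 else 1)"

section \<open>Actions of g\<close>

text \<open>An operator $g$ with $\mathcal{S}_g$ and $\mathcal{N}_g$, where
  $g = e^{2\pi i(\mathcal{S}_g+\mathcal{N}_g)}$.\<close>
record 'a g_act =
  gop :: "'a \<Rightarrow> 'a"
  gS :: "'a \<Rightarrow> 'a"
  gN :: "'a \<Rightarrow> 'a"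

definition gspace :: "'a::complex_vector g_act \<Rightarrow> complex \<Rightarrow> 'a set"
  where "gspace G \<alpha> = gen_eigenspace (gop G) (e2pi \<alpha>)"

definition g_action :: "'a::complex_vector g_act \<Rightarrow> bool"
  where "g_action G \<longleftrightarrow> clinear (gop G) \<and> bij (gop G) \<and> clinear (gS G) \<and> clinear (gN G) \<and>
    graded strip (gspace G) \<and> locally_nilpotent (gN G) \<and>
    (\<forall>\<alpha>\<in>strip. \<forall>x\<in>gspace G \<alpha>. gS G x = \<alpha> *\<^sub>C x \<and> gN G x \<in> gspace G \<alpha> \<and>
       gop G x = e2pi \<alpha> *\<^sub>C exp_nilpotent (2 * of_real pi * \<i>) (gN G) x)"

definition g_exponents :: "'a::complex_vector g_act \<Rightarrow> complex set"
  where "g_exponents G = {\<alpha>\<in>strip. \<exists>x. x \<noteq> 0 \<and> gop G x = e2pi \<alpha> *\<^sub>C x}"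

section \<open>Grading-restricted vertex superalgebras\<close>

text \<open>\<open>vY V u n v\<close> is the component $u_n v$ of $Y_V(u,x)v=\sum_{n}u_nv\,x^{-n-1}$.\<close>
record 'v vsa =
  vgr :: "real \<Rightarrow> bool \<Rightarrow> 'v set"
  vac :: 'v
  vY :: "'v \<Rightarrow> int \<Rightarrow> 'v \<Rightarrow> 'v"
  vL0 :: "'v \<Rightarrow> 'v"
  vLm1 :: "'v \<Rightarrow> 'v"

definition vwt :: "'v::complex_vector vsa \<Rightarrow> real \<Rightarrow> 'v set"
  where "vwt V n = cspan (\<Union>s. vgr V n s)"

definition vfer :: "'v::complex_vector vsa \<Rightarrow> bool \<Rightarrow> 'v set"
  where "vfer V s = cspan (\<Union>n\<in>{n. 2 * n \<in> \<int>}. vgr V n s)"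

text \<open>The third conjunct from the end is the coefficient of $x_0^{-l-1}x_1^{-m-1}x_2^{-n-1}$ in the
  super Jacobi identity.\<close>
definition vertex_superalgebra :: "'v::complex_vector vsa \<Rightarrow> bool"
  where "vertex_superalgebra V \<longleftrightarrow>
    graded ({n. 2 * n \<in> \<int>} \<times> UNIV) (\<lambda>(n, s). vgr V n s) \<and>
    (\<forall>n. 2 * n \<in> \<int> \<longrightarrow> (\<exists>S. finite S \<and> vwt V n \<subseteq> cspan S)) \<and>
    (\<exists>B. \<forall>n<B. 2 * n \<in> \<int> \<longrightarrow> vwt V n = {0}) \<and>
    vac V \<in> vgr V 0 False \<and>
    (\<forall>n v. clinear (vY V v n) \<and> clinear (\<lambda>u. vY V u n v)) \<and>
    (\<forall>u v. \<exists>N. \<forall>n\<ge>N. vY V u n v = 0) \<and>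
    (\<forall>s t n. \<forall>u\<in>vfer V s. \<forall>v\<in>vfer V t. vY V u n v \<in> vfer V (s \<noteq> t)) \<and>
    clinear (vL0 V) \<and> clinear (vLm1 V) \<and>
    (\<forall>n. 2 * n \<in> \<int> \<longrightarrow> (\<forall>v\<in>vwt V n. vL0 V v = of_real n *\<^sub>C v)) \<and>
    (\<forall>n v. vY V (vac V) n v = (if n = -1 then v else 0)) \<and>
    (\<forall>v. vY V v (-1) (vac V) = v \<and> (\<forall>n\<ge>0. vY V v n (vac V) = 0)) \<and>
    (\<forall>s t. \<forall>u\<in>vfer V s. \<forall>v\<in>vfer V t. \<forall>w l m n.
       Sum_any (\<lambda>j::nat. (of_int m gchoose j) *\<^sub>C vY V (vY V u (l + int j) v) (m + n - int j) w) =
       Sum_any (\<lambda>j::nat. ((-1) ^ j * (of_int l gchoose j)) *\<^sub>C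
         (vY V u (m + l - int j) (vY V v (n + int j) w)
          - (koszul s t * (-1) powi l) *\<^sub>C vY V v (n + l - int j) (vY V u (m + int j) w)))) \<and>
    (\<forall>v n w. vL0 V (vY V v n w) - vY V v n (vL0 V w) =
       of_int (- n - 1) *\<^sub>C vY V v n w + vY V (vL0 V v) n w) \<and>
    (\<forall>v n w. vY V (vLm1 V v) n w = of_int (- n) *\<^sub>C vY V v (n - 1) w \<and>
       vLm1 V (vY V v n w) - vY V v n (vLm1 V w) = of_int (- n) *\<^sub>C vY V v (n - 1) w)"

definition vsa_automorphism :: "'v::complex_vector vsa \<Rightarrow> 'v g_act \<Rightarrow> bool"
  where "vsa_automorphism V G \<longleftrightarrow> g_action G \<and>
    (\<forall>n s. 2 * n \<in> \<int> \<longrightarrow> gop G ` vgr V n s = vgr V n s) \<and>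
    gop G (vac V) = vac V \<and>
    (\<forall>u n v. gop G (vY V u n v) = vY V (gop G u) n (gop G v)) \<and>
    (\<forall>v. gop G (vLm1 V v) = vLm1 V (gop G v))"

text \<open>
  Generating fields: \<open>phi F i\<close> is the vector $\phi^i_{-1}\mathbf{1}$, and \<open>nidx F i\<close> is the index
  $\mathcal{N}_g(i)$, \<^const>\<open>None\<close> if there is none.
\<close>
record ('i, 'v) gen_fields =
  idx :: "'i set"
  phi :: "'i \<Rightarrow> 'v"
  fwt :: "'i \<Rightarrow> real"
  ffer :: "'i \<Rightarrow> bool"
  falpha :: "'i \<Rightarrow> complex"
  nidx :: "'i \<Rightarrow> 'i option"
  fK :: "'i \<Rightarrow> nat"

definition generating_fields ::
  "'v::complex_vector vsa \<Rightarrow> 'v g_act \<Rightarrow> ('i, 'v) gen_fields \<Rightarrow> bool"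
  where "generating_fields V G F \<longleftrightarrow>
    cspan {foldr (\<lambda>(i, m). vY V (phi F i) m) xs (vac V) | xs. \<forall>(i, m)\<in>set xs. i \<in> idx F} = UNIV \<and>
    (\<forall>i\<in>idx F. 2 * fwt F i \<in> \<int> \<and> phi F i \<in> vgr V (fwt F i) (ffer F i) \<and>
       falpha F i \<in> g_exponents G \<and> phi F i \<in> gspace G (falpha F i) \<and>
       (case nidx F i of
          None \<Rightarrow> gN G (phi F i) = 0
        | Some j \<Rightarrow> j \<in> idx F \<and> gN G (phi F i) \<noteq> 0 \<and> gN G (phi F i) = phi F j) \<and>
       (gN G ^^ (fK F i + 1)) (phi F i) = 0)"

section \<open>Formal series in powers and logarithms\<close>

text \<open>
  A series $\sum_{n,k}f_{n,k}x^{-n-1}(\log x)^k$ is represented by its coefficients \<open>f n k\<close>, and a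
  series in $x_1,x_2$ by \<open>f m p n q\<close>, the coefficient of
  $x_1^{-m-1}(\log x_1)^p x_2^{-n-1}(\log x_2)^q$.
\<close>
type_synonym 'a logseries = "complex \<Rightarrow> nat \<Rightarrow> 'a"
type_synonym 'a logseries2 = "complex \<Rightarrow> nat \<Rightarrow> complex \<Rightarrow> nat \<Rightarrow> 'a"

text \<open>$x^{-\alpha}W((x))[\log x]$\<close>
definition log_laurent :: "complex \<Rightarrow> 'a::complex_vector logseries \<Rightarrow> bool"
  where "log_laurent \<alpha> f \<longleftrightarrow>
    (\<exists>(B::real) K. \<forall>n k. f n k \<noteq> 0 \<longrightarrow> n - \<alpha> \<in> \<int> \<and> Re n \<le> B \<and> k \<le> K)"

text \<open>$\frac{d}{dx}$ and $x\frac{d}{dx}$\<close>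
definition ddx :: "'a::complex_vector logseries \<Rightarrow> 'a logseries"
  where "ddx f n k = (- n) *\<^sub>C f (n - 1) k + of_nat (k + 1) *\<^sub>C f (n - 1) (k + 1)"

definition xddx :: "'a::complex_vector logseries \<Rightarrow> 'a logseries"
  where "xddx f n k = (- n - 1) *\<^sub>C f n k + of_nat (k + 1) *\<^sub>C f n (k + 1)"

text \<open>$(1-t)^\beta$ and $\log(1-t)$\<close>
definition one_minus_powr :: "complex \<Rightarrow> complex fps"
  where "one_minus_powr \<beta> = fps_compose (fps_binomial \<beta>) (- fps_X)"

definition log_one_minus :: "complex fps"
  where "log_one_minus = fps_compose (fps_ln 1) (- fps_X)"

text \<open>
  Multiplication by $(x_1-x_2)^\beta(\log(x_1-x_2))^k$ expanded in nonnegative powers of $x_2$,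
  that is by $x_1^\beta(1-t)^\beta(\log x_1+\log(1-t))^k$ with $t=x_2/x_1$.
\<close>
definition mult_x1_minus_x2 ::
  "complex \<Rightarrow> nat \<Rightarrow> 'a::complex_vector logseries2 \<Rightarrow> 'a logseries2"
  where "mult_x1_minus_x2 \<beta> k f m p n q = Sum_any (\<lambda>s::nat. \<Sum>l\<le>min k p.
    (of_nat (k choose l) * fps_nth (one_minus_powr \<beta> * log_one_minus ^ (k - l)) s) *\<^sub>C
      f (m + \<beta> - of_nat s) (p - l) (n + of_nat s) q)"

text \<open>
  Multiplication by $(-x_2+x_1)^\beta(\log(-x_2+x_1))^k$ expanded in nonnegative powers of $x_1$,
  that is by $e^{\pi i\beta}x_2^\beta(1-t)^\beta(\log x_2+\pi i+\log(1-t))^k$ with $t=x_1/x_2$.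
\<close>
definition mult_minus_x2_plus_x1 ::
  "complex \<Rightarrow> nat \<Rightarrow> 'a::complex_vector logseries2 \<Rightarrow> 'a logseries2"
  where "mult_minus_x2_plus_x1 \<beta> k f m p n q = Sum_any (\<lambda>s::nat. \<Sum>l\<le>min k q.
    (exp (of_real pi * \<i> * \<beta>) * of_nat (k choose l) *
       fps_nth (one_minus_powr \<beta> * (fps_const (of_real pi * \<i>) + log_one_minus) ^ (k - l)) s) *\<^sub>C
      f (m + of_nat s) p (n + \<beta> - of_nat s) (q - l))"

text \<open>$(x_1-x_2)^{\beta}(x_1-x_2)^{N}\Phi(x_1)(x_1-x_2)^{-N}\Psi(x_2)$ for a series of operators
  $\Phi$ and a series of vectors $\Psi$\<close>
definition twisted_product_left ::
  "complex \<Rightarrow> ('a::complex_vector \<Rightarrow> 'a) \<Rightarrow> ('a \<Rightarrow> 'a) logseries \<Rightarrow> 'a logseries \<Rightarrow> 'a logseries2"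
  where "twisted_product_left \<beta> N \<Phi> \<Psi> m p n q = Sum_any (\<lambda>(j::nat, k::nat).
    ((-1) ^ k / (fact j * fact k)) *\<^sub>C
      mult_x1_minus_x2 \<beta> (j + k) (\<lambda>m p n q. (N ^^ j) (\<Phi> m p ((N ^^ k) (\<Psi> n q)))) m p n q)"

text \<open>$(-x_2+x_1)^{\beta}\Psi(x_2)(-x_2+x_1)^{N}\Phi(x_1)(-x_2+x_1)^{-N}v$ for series of operators
  $\Phi$ and $\Psi$\<close>
definition twisted_product_right ::
  "complex \<Rightarrow> ('v::complex_vector \<Rightarrow> 'v) \<Rightarrow> ('v \<Rightarrow> 'v) logseries \<Rightarrow>
    ('v \<Rightarrow> 'a::complex_vector) logseries \<Rightarrow> 'v \<Rightarrow> 'a logseries2"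
  where "twisted_product_right \<beta> N \<Phi> \<Psi> v m p n q = Sum_any (\<lambda>(j::nat, k::nat).
    ((-1) ^ k / (fact j * fact k)) *\<^sub>C
      mult_minus_x2_plus_x1 \<beta> (j + k)
        (\<lambda>m p n q. \<Psi> n q ((N ^^ j) (\<Phi> m p ((N ^^ k) v)))) m p n q)"

text \<open>$Y_V(u,x)$ as a series without logarithms\<close>
definition vfield :: "'v::complex_vector vsa \<Rightarrow> 'v \<Rightarrow> ('v \<Rightarrow> 'v) logseries"
  where "vfield V u n k v = (if n \<in> \<int> \<and> k = 0 then vY V u \<lfloor>Re n\<rfloor> v else 0)"

text \<open>$l_p(z)$\<close>
definition lp :: "int \<Rightarrow> complex \<Rightarrow> complex"
  where "lp p z = of_real (ln (cmod z)) + \<i> * of_real (Arg2pi z) + 2 * of_real pi * \<i> * of_int p"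

text \<open>
  The term with exponent $-n-1$ of the value at $z$ of the $p$-th branch. For a twisted field
  applied to homogeneous vectors, terms with different $n$ lie in different weight spaces, so that
  two such values agree as elements of the completion if and only if all these terms agree.
\<close>
definition branch :: "int \<Rightarrow> complex \<Rightarrow> 'a::complex_vector logseries \<Rightarrow> complex \<Rightarrow> 'a"
  where "branch p z f n = Sum_any (\<lambda>k. (exp ((- n - 1) * lp p z) * lp p z ^ k) *\<^sub>C f n k)"

section \<open>Lower-bounded generalized twisted modules\<close>

text \<open>The homogeneous subspace \<open>wgr W n s \<alpha>\<close> is meaningful for \<^term>\<open>\<alpha> \<in> strip\<close>.\<close>
record 'w gspace_data =
  wgr :: "complex \<Rightarrow> bool \<Rightarrow> complex \<Rightarrow> 'w set"
  wG :: "'w g_act"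
  wL0 :: "'w \<Rightarrow> 'w"
  wLm1 :: "'w \<Rightarrow> 'w"

definition wwt :: "'w::complex_vector gspace_data \<Rightarrow> complex \<Rightarrow> 'w set"
  where "wwt W n = cspan (\<Union>s. \<Union>\<alpha>\<in>strip. wgr W n s \<alpha>)"

definition wfer :: "'w::complex_vector gspace_data \<Rightarrow> bool \<Rightarrow> 'w set"
  where "wfer W s = cspan (\<Union>n. \<Union>\<alpha>\<in>strip. wgr W n s \<alpha>)"

definition wgwt :: "'w::complex_vector gspace_data \<Rightarrow> complex \<Rightarrow> 'w set"
  where "wgwt W \<alpha> = cspan (\<Union>n. \<Union>s. wgr W n s \<alpha>)"

definition lower_bounded_space :: "'w::complex_vector gspace_data \<Rightarrow> bool"
  where "lower_bounded_space W \<longleftrightarrow>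
    graded (UNIV \<times> UNIV \<times> strip) (\<lambda>(n, s, \<alpha>). wgr W n s \<alpha>) \<and>
    (\<exists>B. \<forall>n. Re n < B \<longrightarrow> wwt W n = {0}) \<and>
    g_action (wG W) \<and> (\<forall>\<alpha>\<in>strip. wgwt W \<alpha> = gspace (wG W) \<alpha>) \<and>
    clinear (wL0 W) \<and> clinear (wLm1 W) \<and> (\<forall>n. wwt W n = gen_eigenspace (wL0 W) n)"

definition graded_dual :: "'w::complex_vector gspace_data \<Rightarrow> ('w \<Rightarrow> complex) set"
  where "graded_dual W = {w'. clinear w' \<and>
    finite {(n, s, \<alpha>). \<alpha> \<in> strip \<and> (\<exists>w\<in>wgr W n s \<alpha>. w' w \<noteq> 0)}}"

text \<open>\<open>Y v n k w\<close> is the coefficient $(Y^g_W)_{n,k}(v)w$ of $x^{-n-1}(\log x)^k$.\<close>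
type_synonym ('v, 'w) twisted_vo = "'v \<Rightarrow> ('w \<Rightarrow> 'w) logseries"

definition vo_branch ::
  "('v, 'w::complex_vector) twisted_vo \<Rightarrow> int \<Rightarrow> 'v \<Rightarrow> complex \<Rightarrow> complex \<Rightarrow> 'w \<Rightarrow> 'w"
  where "vo_branch Y p v z n w = branch p z (\<lambda>n k. Y v n k w) n"

text \<open>
  The sums over $m$, $n$ are absolutely convergent sums of the terms in which the (finitely many)
  powers of logarithms belonging to given exponents are collected.
\<close>
definition duality ::
  "'v::complex_vector vsa \<Rightarrow> 'w::complex_vector gspace_data \<Rightarrow> ('v, 'w) twisted_vo \<Rightarrow> bool"
  where "duality V W Y \<longleftrightarrow>
    (\<forall>s t. \<forall>u\<in>vfer V s. \<forall>v\<in>vfer V t. \<forall>w. \<forall>w'\<in>graded_dual W.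
      \<exists>(S :: (complex \<times> complex \<times> nat \<times> nat) set) c (t' :: nat). finite S \<and>
      (\<forall>p z1 z2.
        let f = (\<Sum>(a, b, k, l)\<in>S. c (a, b, k, l) * exp (a * lp p z1) * exp (b * lp p z2) *
                   lp p z1 ^ k * lp p z2 ^ l) / (z1 - z2) ^ t'
        in
        (cmod z1 > cmod z2 \<and> cmod z2 > 0 \<longrightarrow>
          ((\<lambda>(m, n). w' (vo_branch Y p u z1 m (vo_branch Y p v z2 n w))) has_sum f) UNIV) \<and>
        (cmod z2 > cmod z1 \<and> cmod z1 > 0 \<longrightarrow>
          ((\<lambda>(m, n). koszul s t * w' (vo_branch Y p v z2 n (vo_branch Y p u z1 m w))) has_sum f)
            UNIV) \<and>
        (cmod z2 > cmod (z1 - z2) \<and> cmod (z1 - z2) > 0 \<longrightarrow>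
          (\<lambda>(m, n). (z1 - z2) powi (- m - 1) * w' (vo_branch Y p (vY V u m v) z2 n w))
            summable_on UNIV) \<and>
        (cmod z2 > cmod (z1 - z2) \<and> cmod (z1 - z2) > 0 \<and> \<bar>Arg2pi z1 - Arg2pi z2\<bar> < pi / 2 \<longrightarrow>
          ((\<lambda>(m, n). (z1 - z2) powi (- m - 1) * w' (vo_branch Y p (vY V u m v) z2 n w)) has_sum f)
            UNIV)))"

definition twisted_module ::
  "'v::complex_vector vsa \<Rightarrow> 'v g_act \<Rightarrow> 'w::complex_vector gspace_data \<Rightarrow> ('v, 'w) twisted_vo \<Rightarrow> bool"
  where "twisted_module V G W Y \<longleftrightarrow> lower_bounded_space W \<and>
    (\<forall>w. wL0 W (wLm1 W w) - wLm1 W (wL0 W w) = wLm1 W w) \<and>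
    (\<forall>v w n k. clinear (Y v n k) \<and> clinear (\<lambda>u. Y u n k w)) \<and>
    (\<forall>v w. \<exists>K. \<forall>n k. k > K \<longrightarrow> Y v n k w = 0) \<and>
    (\<forall>s t n k. \<forall>v\<in>vfer V s. \<forall>w\<in>wfer W t. Y v n k w \<in> wfer W (s \<noteq> t)) \<and>
    (\<forall>n k w. Y (vac V) n k w = (if n = -1 \<and> k = 0 then w else 0)) \<and>
    (\<forall>v n k w. gop (wG W) (Y v n k w) = Y (gop G v) n k (gop (wG W) w)) \<and>
    (\<forall>v n k w. wL0 W (Y v n k w) - Y v n k (wL0 W w) =
       xddx (\<lambda>n k. Y v n k w) n k + Y (vL0 V v) n k w) \<and>
    (\<forall>v n k w. ddx (\<lambda>n k. Y v n k w) n k = Y (vLm1 V v) n k w) \<and>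
    (\<forall>v n k w. wLm1 W (Y v n k w) - Y v n k (wLm1 W w) = ddx (\<lambda>n k. Y v n k w) n k) \<and>
    (\<forall>p z v n w. z \<noteq> 0 \<longrightarrow> vo_branch Y (p + 1) (gop G v) z n w = vo_branch Y p v z n w) \<and>
    duality V W Y"

definition generated_by ::
  "'w::complex_vector gspace_data \<Rightarrow> ('v, 'w) twisted_vo \<Rightarrow> 'w set \<Rightarrow> bool"
  where "generated_by W Y S \<longleftrightarrow>
    cspan {Y v n k ((wLm1 W ^^ p) ((wL0 W ^^ q) w)) | v n k p q w. w \<in> S} = UNIV"

section \<open>Twisted field data\<close>

text \<open>\<open>psifer\<close> is the fermion number $|\psi^a_W|$.\<close>
record ('i, 'a, 'v, 'w) twisted_fields =
  phiW :: "'i \<Rightarrow> ('w \<Rightarrow> 'w) logseries"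
  aidx :: "'a set"
  psiW :: "'a \<Rightarrow> ('v \<Rightarrow> 'w) logseries"
  psifer :: "'a \<Rightarrow> bool"

text \<open>The component $f^j$ of a family of fields, $0$ if the index $j$ is undefined.\<close>
definition at_idx :: "('j \<Rightarrow> ('b \<Rightarrow> 'w::complex_vector) logseries) \<Rightarrow> 'j option \<Rightarrow> ('b \<Rightarrow> 'w) logseries"
  where "at_idx f j n k x = (case j of None \<Rightarrow> 0 | Some j \<Rightarrow> f j n k x)"

definition field_product :: "('i \<Rightarrow> ('w \<Rightarrow> 'w) logseries) \<Rightarrow> ('i \<times> complex \<times> nat) list \<Rightarrow> 'w \<Rightarrow> 'w"
  where "field_product f xs = foldr (\<lambda>(i, n, k). f i n k) xs"

definition fields_wellformed ::
  "'v::complex_vector vsa \<Rightarrow> 'v g_act \<Rightarrow> ('i, 'v) gen_fields \<Rightarrow> 'w::complex_vector gspace_data \<Rightarrow>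
    ('i, 'a, 'v, 'w) twisted_fields \<Rightarrow> bool"
  where "fields_wellformed V G F W E \<longleftrightarrow>
    (\<forall>i\<in>idx F. (\<forall>n k. clinear (phiW E i n k)) \<and>
       (\<forall>w. log_laurent (falpha F i) (\<lambda>n k. phiW E i n k w))) \<and>
    (\<forall>a\<in>aidx E. (\<forall>n k. clinear (psiW E a n k)) \<and>
       (\<forall>\<alpha>\<in>g_exponents G. \<forall>v\<in>gspace G \<alpha>. log_laurent \<alpha> (\<lambda>n k. psiW E a n k v)))"

definition L0_property ::
  "'v::complex_vector vsa \<Rightarrow> ('i, 'v) gen_fields \<Rightarrow> 'w::complex_vector gspace_data \<Rightarrow>
    ('i, 'a, 'v, 'w) twisted_fields \<Rightarrow> bool"
  where "L0_property V F W E \<longleftrightarrow> (\<exists>LS LN. semisimple_nilpotent_parts (wL0 W) LS LN \<and>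
    (\<forall>i\<in>idx F. \<forall>n k w. wL0 W (phiW E i n k w) - phiW E i n k (wL0 W w) =
       xddx (\<lambda>n k. phiW E i n k w) n k + of_real (fwt F i) *\<^sub>C phiW E i n k w) \<and>
    (\<forall>a\<in>aidx E. \<exists>(c::complex) b.
       (case b of None \<Rightarrow> \<forall>n k v. LN (psiW E a n k v) = 0
        | Some b' \<Rightarrow> b' \<in> aidx E \<and> (\<exists>n k v. LN (psiW E a n k v) \<noteq> 0)) \<and>
       (\<forall>n k v. wL0 W (psiW E a n k v) - psiW E a n k (vL0 V v) =
          xddx (\<lambda>n k. psiW E a n k v) n k + c *\<^sub>C psiW E a n k v + at_idx (psiW E) b n k v)))"

definition Lm1_property ::
  "'v::complex_vector vsa \<Rightarrow> ('i, 'v) gen_fields \<Rightarrow> 'w::complex_vector gspace_data \<Rightarrow>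
    ('i, 'a, 'v, 'w) twisted_fields \<Rightarrow> bool"
  where "Lm1_property V F W E \<longleftrightarrow>
    (\<forall>i\<in>idx F. \<forall>n k w. wLm1 W (phiW E i n k w) - phiW E i n k (wLm1 W w) =
       ddx (\<lambda>n k. phiW E i n k w) n k) \<and>
    (\<forall>a\<in>aidx E. \<forall>n k v. wLm1 W (psiW E a n k v) - psiW E a n k (vLm1 V v) =
       ddx (\<lambda>n k. psiW E a n k v) n k)"

definition creation_property ::
  "'v::complex_vector vsa \<Rightarrow> 'w::complex_vector gspace_data \<Rightarrow> ('i, 'a, 'v, 'w) twisted_fields \<Rightarrow> bool"
  where "creation_property V W E \<longleftrightarrow> (\<forall>a\<in>aidx E.
    (\<forall>n k. psiW E a n k (vac V) \<noteq> 0 \<longrightarrow> k = 0 \<and> (\<exists>m::nat. n = - of_nat m - 1)) \<and>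
    (\<exists>n. \<exists>\<alpha>\<in>strip. psiW E a (-1) 0 (vac V) \<in> wgr W n (psifer E a) \<alpha>))"

definition spanning_property ::
  "('i, 'v) gen_fields \<Rightarrow> ('i, 'a, 'v, 'w::complex_vector) twisted_fields \<Rightarrow> bool"
  where "spanning_property F E \<longleftrightarrow>
    cspan {field_product (phiW E) xs (psiW E a n l v) | xs a n l v.
      (\<forall>(i, n, k)\<in>set xs. i \<in> idx F) \<and> a \<in> aidx E} = UNIV"

definition g_property ::
  "'v::complex_vector vsa \<Rightarrow> 'v g_act \<Rightarrow> ('i, 'v) gen_fields \<Rightarrow> 'w::complex_vector gspace_data \<Rightarrow>
    ('i, 'a, 'v, 'w) twisted_fields \<Rightarrow> bool"
  where "g_property V G F W E \<longleftrightarrow>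
    (\<forall>i\<in>idx F. \<forall>p z n w. z \<noteq> 0 \<longrightarrow>
       gop (wG W) (branch (p + 1) z (\<lambda>n k. phiW E i n k (inv (gop (wG W)) w)) n) =
       branch p z (\<lambda>n k. phiW E i n k w) n) \<and>
    (\<forall>i\<in>idx F. \<forall>n k w. phiW E i n k w =
       (\<Sum>j\<le>k. ((-1) ^ j / (fact j * fact (k - j))) *\<^sub>C
          (gN (wG W) ^^ j) (phiW E i n 0 ((gN (wG W) ^^ (k - j)) w)))) \<and>
    (\<forall>a\<in>aidx E. \<forall>n k v. psiW E a n k v =
       ((-1) ^ k / fact k) *\<^sub>C psiW E a n 0 ((gN G ^^ k) v)) \<and>
    (\<forall>i\<in>idx F. \<forall>n k w. exp_2pi_semisimple (gS (wG W)) (phiW E i n k w) =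
       e2pi (falpha F i) *\<^sub>C phiW E i n k (exp_2pi_semisimple (gS (wG W)) w)) \<and>
    (\<forall>i\<in>idx F. \<forall>n k w. gN (wG W) (phiW E i n k w) - phiW E i n k (gN (wG W) w) =
       at_idx (phiW E) (nidx F i) n k w) \<and>
    (\<forall>a\<in>aidx E. \<exists>\<alpha>\<in>strip. wgwt W \<alpha> \<noteq> {0} \<and>
       (\<forall>m::nat. psiW E a (- of_nat m - 1) 0 (vac V) \<in> gspace (wG W) \<alpha>))"

definition phi_phi_locality ::
  "('i, 'v) gen_fields \<Rightarrow> ('i, 'a, 'v, 'w::complex_vector) twisted_fields \<Rightarrow> bool"
  where "phi_phi_locality F E \<longleftrightarrow> (\<forall>i\<in>idx F. \<forall>j\<in>idx F. \<exists>M>0. \<forall>w m p n q.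
    mult_x1_minus_x2 (of_nat M) 0 (\<lambda>m p n q. phiW E i m p (phiW E j n q w)) m p n q =
    koszul (ffer F i) (ffer F j) *\<^sub>C
      mult_x1_minus_x2 (of_nat M) 0 (\<lambda>m p n q. phiW E j n q (phiW E i m p w)) m p n q)"

definition phi_psi_locality ::
  "'v::complex_vector vsa \<Rightarrow> 'v g_act \<Rightarrow> ('i, 'v) gen_fields \<Rightarrow> 'w::complex_vector gspace_data \<Rightarrow>
    ('i, 'a, 'v, 'w) twisted_fields \<Rightarrow> bool"
  where "phi_psi_locality V G F W E \<longleftrightarrow> (\<forall>i\<in>idx F. \<forall>a\<in>aidx E. \<exists>M>0. \<forall>v m p n q.
    twisted_product_left (falpha F i + of_nat M) (gN (wG W)) (phiW E i)
      (\<lambda>n q. psiW E a n q v) m p n q =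
    koszul (ffer F i) (psifer E a) *\<^sub>C
      twisted_product_right (falpha F i + of_nat M) (gN G) (vfield V (phi F i))
        (psiW E a) v m p n q)"

definition twisted_field_data ::
  "'v::complex_vector vsa \<Rightarrow> 'v g_act \<Rightarrow> ('i, 'v) gen_fields \<Rightarrow> 'w::complex_vector gspace_data \<Rightarrow>
    ('i, 'a, 'v, 'w) twisted_fields \<Rightarrow> bool"
  where "twisted_field_data V G F W E \<longleftrightarrow>
    lower_bounded_space W \<and> fields_wellformed V G F W E \<and>
    L0_property V F W E \<and> Lm1_property V F W E \<and> creation_property V W E \<and>
    spanning_property F E \<and> g_property V G F W E \<and>
    phi_phi_locality F E \<and> phi_psi_locality V G F W E"

section \<open>The universal construction\<close>

text \<open>
  The graded space $M$ with its operators, basis $w^a$ (\<open>mw\<close>, of weight \<open>mwt\<close> and fermion number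
  \<open>mwfer\<close>), index map $L_M(0)_N(a)$ (\<open>mnidx\<close>) and lower bound $B$.
\<close>
record ('a, 'm) mdata =
  mfer :: "bool \<Rightarrow> 'm set"
  mG :: "'m g_act"
  mL0 :: "'m \<Rightarrow> 'm"
  mL0N :: "'m \<Rightarrow> 'm"
  midx :: "'a set"
  mw :: "'a \<Rightarrow> 'm"
  mwt :: "'a \<Rightarrow> complex"
  mwfer :: "'a \<Rightarrow> bool"
  mnidx :: "'a \<Rightarrow> 'a option"
  mB :: real

definition inducing_space :: "('a, 'm::complex_vector) mdata \<Rightarrow> bool"
  where "inducing_space M \<longleftrightarrow>
    graded UNIV (mfer M) \<and> g_action (mG M) \<and> clinear (mL0 M) \<and>
    (\<exists>LS. semisimple_nilpotent_parts (mL0 M) LS (mL0N M)) \<and>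
    (\<forall>n. gen_eigenspace (mL0 M) n \<noteq> {0} \<longrightarrow> mB M \<le> Re n) \<and>
    inj_on (mw M) (midx M) \<and> cindependent (mw M ` midx M) \<and> cspan (mw M ` midx M) = UNIV \<and>
    (\<forall>a\<in>midx M. mw M a \<in> gen_eigenspace (mL0 M) (mwt M a) \<and> mw M a \<in> mfer M (mwfer M a) \<and>
       (\<exists>\<alpha>\<in>strip. mw M a \<in> gspace (mG M) \<alpha>) \<and>
       (case mnidx M a of
          None \<Rightarrow> mL0N M (mw M a) = 0
        | Some b \<Rightarrow> b \<in> midx M \<and> mL0N M (mw M a) = mw M b))"

text \<open>
  \<open>Fld u n\<close> stands for $u\otimes t^n$, and \<open>UL0\<close>, \<open>ULm1\<close> for $L_0$, $L_{-1}$. A tensor algebra is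
  a free algebra modulo the linearity of its letters, and a tensor product is a free vector space
  modulo multilinearity. Accordingly $\widetilde{M}$ is presented as the span \<open>pre_space\<close> of the
  symbols \<open>(ws, m, n, v)\<close>, standing for
  $w_1\otimes\cdots\otimes w_r\otimes(m\otimes t^n)\otimes v$, in a free vector space; the relations
  defining $U$ and the tensor products are divided out together with those defining
  $\widehat{M}^{[g]}_B$.
\<close>
datatype 'v letter = Fld 'v complex | UL0 | ULm1

type_synonym ('v, 'm) symbol = "'v letter list \<times> 'm \<times> complex \<times> 'v"
type_synonym ('v, 'm) free_space = "('v, 'm) symbol \<Rightarrow>\<^sub>0 complex"

definition sym :: "('v, 'm) symbol \<Rightarrow> ('v, 'm) free_space"
  where "sym b = Poly_Mapping.single b 1"

definition lin_ext :: "(('v, 'm) symbol \<Rightarrow> ('v, 'm) free_space) \<Rightarrow> ('v, 'm) free_space \<Rightarrow> ('v, 'm) free_space"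
  where "lin_ext f x = (\<Sum>b\<in>Poly_Mapping.keys x. Poly_Mapping.lookup x b *\<^sub>C f b)"

definition lmul :: "'v letter \<Rightarrow> ('v, 'm) free_space \<Rightarrow> ('v, 'm) free_space"
  where "lmul y = lin_ext (\<lambda>(ws, m, n, v). sym (y # ws, m, n, v))"

text \<open>
  The component of $t$-degree $n$ of
  $\sum_{i,k}\mathbb{C}\mathcal{N}_g^k\phi^i_{-1}\mathbf{1}\otimes t^{\alpha^i}\mathbb{C}[t,t^{-1}]$,
  as a subspace of $V$.
\<close>
definition Vhat :: "'v::complex_vector g_act \<Rightarrow> ('i, 'v) gen_fields \<Rightarrow> complex \<Rightarrow> 'v set"
  where "Vhat G F n = cspan {(gN G ^^ k) (phi F i) | k i. i \<in> idx F \<and> n - falpha F i \<in> \<int>}"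

definition letters :: "'v::complex_vector g_act \<Rightarrow> ('i, 'v) gen_fields \<Rightarrow> 'v letter set"
  where "letters G F = {UL0, ULm1} \<union> {Fld u n | u n. u \<in> Vhat G F n}"

text \<open>$v\in V^{[\alpha]}$ and $n\in\alpha+\mathbb{Z}$ for some
  $\alpha\in P_V$\<close>
definition twist_compatible :: "'v::complex_vector g_act \<Rightarrow> complex \<Rightarrow> 'v \<Rightarrow> bool"
  where "twist_compatible G n v \<longleftrightarrow> (\<exists>\<alpha>\<in>g_exponents G. v \<in> gspace G \<alpha> \<and> n - \<alpha> \<in> \<int>)"

definition pre_space :: "'v::complex_vector g_act \<Rightarrow> ('i, 'v) gen_fields \<Rightarrow> ('v, 'm) free_space set"
  where "pre_space G F = cspan {sym (ws, m, n, v) | ws m n v.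
    set ws \<subseteq> letters G F \<and> twist_compatible G n v}"

text \<open>
  Coefficients of $\hat\phi^i(x)$, acting by left multiplication, and of $\psi^a(x)v$. Symbols with
  a zero vector, which vanish in $\widetilde{M}$, are replaced by $0$ to keep all sums finite.
\<close>
definition phi_hat ::
  "'v::complex_vector g_act \<Rightarrow> ('i, 'v) gen_fields \<Rightarrow> 'i \<Rightarrow> (('v, 'm) free_space \<Rightarrow> ('v, 'm) free_space) logseries"
  where "phi_hat G F i n k x =
    (if n - falpha F i \<in> \<int> \<and> (gN G ^^ k) (phi F i) \<noteq> 0
     then lmul (Fld (((-1) ^ k / fact k) *\<^sub>C (gN G ^^ k) (phi F i)) n) x else 0)"

definition psi_hat ::
  "'v::complex_vector g_act \<Rightarrow> ('a, 'm) mdata \<Rightarrow> 'a \<Rightarrow> ('v \<Rightarrow> ('v, 'm) free_space) logseries"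
  where "psi_hat G M a n k v =
    (if twist_compatible G n v \<and> (gN G ^^ k) v \<noteq> 0
     then sym ([], mw M a, n, ((-1) ^ k / fact k) *\<^sub>C (gN G ^^ k) v) else 0)"

text \<open>The induced $g$ (multiplicative) and $\mathcal{N}_g$ (a derivation); both fix, respectively
  annihilate, $L_0$ and $L_{-1}$.\<close>
definition g_hat :: "'v::complex_vector g_act \<Rightarrow> ('a, 'm) mdata \<Rightarrow> ('v, 'm) free_space \<Rightarrow> ('v, 'm) free_space"
  where "g_hat G M = lin_ext (\<lambda>(ws, m, n, v).
    sym (map (map_letter (gop G)) ws, gop (mG M) m, n, gop G v))"

definition N_hat ::
  "'v::complex_vector g_act \<Rightarrow> ('a, 'm::complex_vector) mdata \<Rightarrow> ('v, 'm) free_space \<Rightarrow> ('v, 'm) free_space"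
  where "N_hat G M = lin_ext (\<lambda>(ws, m, n, v).
    (\<Sum>j<length ws. case ws ! j of
        Fld u r \<Rightarrow> if gN G u = 0 then 0 else sym (ws[j := Fld (gN G u) r], m, n, v)
      | _ \<Rightarrow> 0) +
    (if gN (mG M) m = 0 then 0 else sym (ws, gN (mG M) m, n, v)) +
    (if gN G v = 0 then 0 else sym (ws, m, n, gN G v)))"

fun letter_fer :: "'v::complex_vector vsa \<Rightarrow> bool \<Rightarrow> 'v letter \<Rightarrow> bool" where
  "letter_fer V s (Fld u n) \<longleftrightarrow> u \<in> vfer V s"
| "letter_fer V s UL0 \<longleftrightarrow> \<not> s"
| "letter_fer V s ULm1 \<longleftrightarrow> \<not> s"

definition pre_fer ::
  "'v::complex_vector vsa \<Rightarrow> 'v g_act \<Rightarrow> ('i, 'v) gen_fields \<Rightarrow> ('a, 'm) mdata \<Rightarrow> bool \<Rightarrow> ('v, 'm) free_space set"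
  where "pre_fer V G F M s = cspan {sym (ws, m, n, v) | ws m n v ss t r.
    set ws \<subseteq> letters G F \<and> twist_compatible G n v \<and> list_all2 (letter_fer V) ss ws \<and>
    m \<in> mfer M t \<and> v \<in> vfer V r \<and> s = odd (length (filter id (ss @ [t, r])))}"

definition linearity_relations ::
  "'v::complex_vector g_act \<Rightarrow> ('i, 'v) gen_fields \<Rightarrow> ('v, 'm::complex_vector) free_space set"
  where "linearity_relations G F =
    {lmul (Fld (a *\<^sub>C u + b *\<^sub>C u') n) x - a *\<^sub>C lmul (Fld u n) x - b *\<^sub>C lmul (Fld u' n) x |
       a b u u' n x. u \<in> Vhat G F n \<and> u' \<in> Vhat G F n \<and> x \<in> pre_space G F} \<union>
    {sym ([], a *\<^sub>C m + b *\<^sub>C m', n, v) - a *\<^sub>C sym ([], m, n, v) - b *\<^sub>C sym ([], m', n, v) |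
       a b m m' n v. twist_compatible G n v} \<union>
    {sym ([], m, n, a *\<^sub>C v + b *\<^sub>C v') - a *\<^sub>C sym ([], m, n, v) - b *\<^sub>C sym ([], m, n, v') |
       a b m n v v'. twist_compatible G n v \<and> twist_compatible G n v'}"

definition M_phi_phi :: "'v::complex_vector vsa \<Rightarrow> ('i, 'v) gen_fields \<Rightarrow> 'i \<Rightarrow> 'i \<Rightarrow> nat"
  where "M_phi_phi V F i j = (LEAST M. M > 0 \<and> (\<forall>n\<ge>int M. vY V (phi F i) n (phi F j) = 0))"

text \<open>The relations of $U$, applied to arbitrary elements: the two-sided ideal generated by them
  becomes the $U$-submodule generated by these elements.\<close>
definition U_relations ::
  "'v::complex_vector vsa \<Rightarrow> 'v g_act \<Rightarrow> ('i, 'v) gen_fields \<Rightarrow> ('v, 'm) free_space set"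
  where "U_relations V G F =
    {mult_x1_minus_x2 (of_nat (M_phi_phi V F i j)) 0
       (\<lambda>m p n q. phi_hat G F i m p (phi_hat G F j n q x) -
          koszul (ffer F i) (ffer F j) *\<^sub>C phi_hat G F j n q (phi_hat G F i m p x)) m p n q |
       i j x m p n q. i \<in> idx F \<and> j \<in> idx F \<and> x \<in> pre_space G F} \<union>
    {lmul UL0 (phi_hat G F i n k x) - phi_hat G F i n k (lmul UL0 x) -
       xddx (\<lambda>n k. phi_hat G F i n k x) n k - of_real (fwt F i) *\<^sub>C phi_hat G F i n k x |
       i n k x. i \<in> idx F \<and> x \<in> pre_space G F} \<union>
    {lmul ULm1 (phi_hat G F i n k x) - phi_hat G F i n k (lmul ULm1 x) -
       ddx (\<lambda>n k. phi_hat G F i n k x) n k |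
       i n k x. i \<in> idx F \<and> x \<in> pre_space G F}"

definition vacuum_relations ::
  "'v::complex_vector vsa \<Rightarrow> 'v g_act \<Rightarrow> ('a, 'm) mdata \<Rightarrow> ('v, 'm) free_space set"
  where "vacuum_relations V G M =
    {psi_hat G M a n 0 (vac V) | a n. a \<in> midx M \<and> \<not> (\<exists>m::nat. n = - of_nat m - 1)}"

definition low_weight_relations ::
  "'v::complex_vector vsa \<Rightarrow> 'v g_act \<Rightarrow> ('i, 'v) gen_fields \<Rightarrow> ('a, 'm) mdata \<Rightarrow> ('v, 'm) free_space set"
  where "low_weight_relations V G F M =
    {field_product (phi_hat G F) xs ((lmul UL0 ^^ p) ((lmul ULm1 ^^ q) (psi_hat G M a n k v))) |
       xs p q a n k v h s \<alpha>. (\<forall>(i, n, k)\<in>set xs. i \<in> idx F) \<and> a \<in> midx M \<and>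
         2 * h \<in> \<int> \<and> v \<in> vgr V h s \<and> \<alpha> \<in> g_exponents G \<and> v \<in> gspace G \<alpha> \<and>
         Re (sum_list (map (\<lambda>(i, n, k). of_real (fwt F i) - n - 1) xs) + of_nat q + mwt M a - n - 1
             + of_real h) < mB M}"

definition M_phi_psi :: "('i, 'v) gen_fields \<Rightarrow> ('a, 'm) mdata \<Rightarrow> 'i \<Rightarrow> 'a \<Rightarrow> nat"
  where "M_phi_psi F M i a =
    (LEAST K. K > 0 \<and> real K > fwt F i - 1 + Re (mwt M a) - mB M - Re (falpha F i))"

text \<open>
  The coefficients of the left-hand side are infinite sums in $\widetilde{M}$, all but finitely
  many terms of which are low weight relations; those terms, the ones with
  $\psi^a_{n,k}v$ of weight below $B$, are omitted.
\<close>
definition phi_psi_relations ::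
  "'v::complex_vector vsa \<Rightarrow> 'v g_act \<Rightarrow> ('i, 'v) gen_fields \<Rightarrow> ('a, 'm::complex_vector) mdata \<Rightarrow>
    ('v, 'm) free_space set"
  where "phi_psi_relations V G F M =
    {twisted_product_left (falpha F i + of_nat (M_phi_psi F M i a)) (N_hat G M) (phi_hat G F i)
       (\<lambda>n k. if Re (mwt M a - n - 1 + of_real h) < mB M then 0 else psi_hat G M a n k v) m p n q -
     koszul (ffer F i) (mwfer M a) *\<^sub>C
       twisted_product_right (falpha F i + of_nat (M_phi_psi F M i a)) (gN G)
         (vfield V (phi F i)) (psi_hat G M a) v m p n q |
       i a v h s \<alpha> m p n q. i \<in> idx F \<and> a \<in> midx M \<and>
         2 * h \<in> \<int> \<and> v \<in> vgr V h s \<and> \<alpha> \<in> g_exponents G \<and> v \<in> gspace G \<alpha>}"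

definition L_psi_relations ::
  "'v::complex_vector vsa \<Rightarrow> 'v g_act \<Rightarrow> ('a, 'm) mdata \<Rightarrow> ('v, 'm) free_space set"
  where "L_psi_relations V G M =
    {lmul UL0 (psi_hat G M a n k v) - psi_hat G M a n k (vL0 V v) -
       xddx (\<lambda>n k. psi_hat G M a n k v) n k - mwt M a *\<^sub>C psi_hat G M a n k v -
       at_idx (psi_hat G M) (mnidx M a) n k v |
       a n k v \<alpha>. a \<in> midx M \<and> \<alpha> \<in> g_exponents G \<and> v \<in> gspace G \<alpha>} \<union>
    {lmul ULm1 (psi_hat G M a n k v) - psi_hat G M a n k (vLm1 V v) -
       ddx (\<lambda>n k. psi_hat G M a n k v) n k |
       a n k v \<alpha>. a \<in> midx M \<and> \<alpha> \<in> g_exponents G \<and> v \<in> gspace G \<alpha>}"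

inductive_set U_submodule ::
  "'v letter set \<Rightarrow> ('v, 'm) free_space set \<Rightarrow> ('v, 'm) free_space set"
  for L :: "'v letter set" and R :: "('v, 'm) free_space set"
  where
    zero: "0 \<in> U_submodule L R"
  | base: "x \<in> R \<Longrightarrow> x \<in> U_submodule L R"
  | add: "x \<in> U_submodule L R \<Longrightarrow> y \<in> U_submodule L R \<Longrightarrow> x + y \<in> U_submodule L R"
  | scale: "x \<in> U_submodule L R \<Longrightarrow> c *\<^sub>C x \<in> U_submodule L R"
  | act: "x \<in> U_submodule L R \<Longrightarrow> y \<in> L \<Longrightarrow> lmul y x \<in> U_submodule L R"

definition Mhat_relations ::
  "'v::complex_vector vsa \<Rightarrow> 'v g_act \<Rightarrow> ('i, 'v) gen_fields \<Rightarrow> ('a, 'm::complex_vector) mdata \<Rightarrow>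
    ('v, 'm) free_space set"
  where "Mhat_relations V G F M = U_submodule (letters G F)
    (linearity_relations G F \<union> U_relations V G F \<union> vacuum_relations V G M \<union>
     low_weight_relations V G F M \<union> phi_psi_relations V G F M \<union> L_psi_relations V G M)"

text \<open>
  \<open>W\<close> with the fields \<open>E\<close> is the quotient $\widehat{M}^{[g]}_B$ with its induced structure. As a
  vector space the quotient is given by its projection $\pi$, a surjective linear map from
  \<open>pre_space\<close> with kernel \<open>Mhat_relations\<close> (values of $\pi$ outside \<open>pre_space\<close> are immaterial).
\<close>
definition is_Mhat ::
  "'v::complex_vector vsa \<Rightarrow> 'v g_act \<Rightarrow> ('i, 'v) gen_fields \<Rightarrow> ('a, 'm::complex_vector) mdata \<Rightarrow>
    'w::complex_vector gspace_data \<Rightarrow> ('i, 'a, 'v, 'w) twisted_fields \<Rightarrow> bool"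
  where "is_Mhat V G F M W E \<longleftrightarrow>
    (\<exists>\<pi> :: ('v, 'm) free_space \<Rightarrow> 'w.
      clinear \<pi> \<and> \<pi> ` pre_space G F = UNIV \<and>
      (\<forall>x\<in>pre_space G F. \<pi> x = 0 \<longleftrightarrow> x \<in> Mhat_relations V G F M) \<and>
      (\<forall>x\<in>pre_space G F.
         wL0 W (\<pi> x) = \<pi> (lmul UL0 x) \<and> wLm1 W (\<pi> x) = \<pi> (lmul ULm1 x) \<and>
         gop (wG W) (\<pi> x) = \<pi> (g_hat G M x) \<and> gN (wG W) (\<pi> x) = \<pi> (N_hat G M x) \<and>
         (\<forall>i\<in>idx F. \<forall>n k. phiW E i n k (\<pi> x) = \<pi> (phi_hat G F i n k x))) \<and>
      (\<forall>\<alpha>\<in>strip. \<forall>w\<in>gspace (wG W) \<alpha>. gS (wG W) w = \<alpha> *\<^sub>C w) \<and>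
      (\<forall>n s. \<forall>\<alpha>\<in>strip. wgr W n s \<alpha> =
         gen_eigenspace (wL0 W) n \<inter> \<pi> ` pre_fer V G F M s \<inter> gspace (wG W) \<alpha>) \<and>
      aidx E = midx M \<and> psifer E = mwfer M \<and>
      (\<forall>a\<in>midx M. \<forall>n k. clinear (psiW E a n k) \<and>
         (\<forall>\<alpha>\<in>g_exponents G. \<forall>v\<in>gspace G \<alpha>. psiW E a n k v = \<pi> (psi_hat G M a n k v))))"

end

theory Submission
  imports Defs "HOL-Complex_Analysis.Complex_Analysis"
begin

text \<open>
  Let \<open>T\<close> be the span of the products in the claim; it is stable under the coefficients of the
  \<open>\<phi>\<^sup>i\<^sub>W\<close>. As \<open>L\<^sub>W(-1)\<close> produces \<open>\<psi>\<^sup>a(x)\<one>\<close> from its constant term, the coefficients of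
  \<open>\<psi>\<^sup>a(x)\<one>\<close> lie in \<open>T\<close>, and those of \<open>\<psi>\<^sup>a(x)v\<close> follow by induction on the number of generating
  fields in \<open>v\<close>. Indeed, conjugating \<open>\<phi>\<^sup>i\<close> by \<open>(x\<^sub>1 - x\<^sub>2)\<close> to the power \<open>\<N>\<^sub>g\<close> gives a polynomial in
  \<open>log (x\<^sub>1 - x\<^sub>2)\<close> with coefficients \<open>(ad \<N>\<^sub>g)\<^sup>r \<phi>\<^sup>i / r!\<close>, which are again generating fields.
  So Property 7 equates an element of \<open>T\<close> with \<open>\<psi>\<^sup>a\<close> applied to \<open>\<phi>\<^sup>i\<^sub>m v\<close>, up to terms with a larger
  index \<open>m\<close> or with \<open>r \<ge> 1\<close>. On \<open>V\<close> this uses that \<open>\<N>\<^sub>g\<close>, being the logarithm of an automorphism, is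
  a derivation.

  For the generation statement, let \<open>X\<close> be the span of the coefficients of \<open>Y(v, x)\<close> on the vectors
  \<open>L(-1)\<^sup>p L(0)\<^sup>q w\<close>, and suppose that a coefficient of \<open>Y(u, z\<^sub>1) Y(v, z\<^sub>2) w\<close> is not in \<open>X\<close>. An
  element of the graded dual that separates it from \<open>X\<close> annihilates the iterate, hence by duality
  also the product for \<open>1 < z\<^sub>1 / z\<^sub>2 < 2\<close>. The logarithms are removed by induction on the order of nilpotency
  of \<open>\<N>\<^sub>g\<close> on \<open>u\<close>, so that the product becomes a power series in \<open>z\<^sub>2 / z\<^sub>1\<close>, all of whose coefficients
  must vanish.
\<close>

section \<open>Linear algebra over the complex numbers\<close>

text \<open>Since \<open>g\<close> is given and \<open>\<N>\<^sub>g\<close> is only its logarithm,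
  statements about \<open>\<N>\<^sub>g\<close> and about logarithms are reached through natural
  powers or branch numbers: what is known then becomes polynomial in a natural number, and
  coefficients are compared. The twisted products of Property 7 run over all powers of
  \<open>\<N>\<^sub>g\<close> on both sides of the field and over a whole binomial expansion. Their
  finiteness comes from local nilpotency and truncation, whose bounds depend on the vector, so the
  relation is used as an equality of finite forms for all large cutoffs. This form makes sense for
  given data and for the quotient alike; the spanning argument is run once, over hypotheses that the
  quotient has to supply from its defining relations. In the generation part,
  \<open>z\<^sub>2 = 1\<close> on branch 0 gives \<open>lp 0 1 = 0\<close>, so only logarithms of
  \<open>z\<^sub>1\<close> enter the duality argument; the logarithmic coefficients of the second
  operator are recovered afterwards by another induction.\<close>

lemma clinearI:
  assumes "\<And>x y. f (x + y) = f x + f y" "\<And>c x. f (c *\<^sub>C x) = c *\<^sub>C f x"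
  shows "clinear f"
  using assms by unfold_locales (auto simp: scaleC_add_right scaleC_add_left)

lemma clinear_add: "clinear f \<Longrightarrow> f (x + y) = f x + f y"
  by (rule module_hom.add) (simp add: linear_iff_module_hom)

lemma clinear_scale: "clinear f \<Longrightarrow> f (c *\<^sub>C x) = c *\<^sub>C f x"
  by (rule module_hom.scale) (simp add: linear_iff_module_hom)

lemma clinear_0: "clinear f \<Longrightarrow> f 0 = 0"
  by (rule module_hom.zero) (simp add: linear_iff_module_hom)

lemma clinear_diff: "clinear f \<Longrightarrow> f (x - y) = f x - f y"
  by (rule module_hom.diff) (simp add: linear_iff_module_hom)

lemma clinear_sum: "clinear f \<Longrightarrow> f (\<Sum>i\<in>A. g i) = (\<Sum>i\<in>A. f (g i))"
  by (rule module_hom.sum) (simp add: linear_iff_module_hom)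

lemmas scaleC_zero [simp] = complex_vector.scale_zero_left complex_vector.scale_zero_right
lemmas scaleC_eq_0_iff [simp] = complex_vector.scale_eq_0_iff

lemma clinear_funpow:
  fixes f :: "'a::complex_vector \<Rightarrow> 'a"
  shows "clinear f \<Longrightarrow> clinear (f ^^ n)"
  by (induction n) (auto intro!: clinearI simp: clinear_add clinear_scale)

lemma clinear_diff_scale: "clinear T \<Longrightarrow> clinear (\<lambda>y. T y - c *\<^sub>C y)"
  by (auto intro!: clinearI simp: clinear_add clinear_scale scaleC_add_right scaleC_scaleC
      complex_vector.scale_right_diff_distrib mult.commute)

lemma clinear_span_image:
  assumes "clinear f" "x \<in> cspan S" "csubspace X" "\<And>y. y \<in> S \<Longrightarrow> f y \<in> X"
  shows "f x \<in> X"
  using assms(2)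
  by (induction rule: complex_vector.span_induct_alt)
    (auto simp: clinear_add[OF assms(1)] clinear_scale[OF assms(1)] clinear_0[OF assms(1)]
      intro!: assms(4) complex_vector.subspace_add[OF assms(3)] complex_vector.subspace_scale[OF assms(3)]
      complex_vector.subspace_0[OF assms(3)])

lemma funpow_zero_mono:
  fixes f :: "'a::complex_vector \<Rightarrow> 'a"
  assumes "clinear f" "(f ^^ k) x = 0" "k \<le> n"
  shows "(f ^^ n) x = 0"
proof -
  have "(f ^^ n) x = (f ^^ (n - k)) ((f ^^ k) x)"
    using assms(3) by (metis comp_apply funpow_add le_add_diff_inverse2)
  then show ?thesis
    by (simp add: assms(2) clinear_0[OF clinear_funpow[OF assms(1)]])
qed

text \<open>Replaces Vandermonde inversion. With \<open>p k\<close> the given sum,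
  \<open>p (2 * k) - 2 ^ Suc d *\<^sub>C p k\<close> loses its top coefficient and multiplies the
  others by the nonzero scalars \<open>2 ^ j - 2 ^ Suc d\<close>. Induction on the degree gives
  these, and \<open>p 1\<close> then gives the top one.\<close>

lemma poly_coeffs_in_subspace:
  assumes X: "csubspace X"
    and "\<And>k::nat. (\<Sum>j\<le>d. (of_nat k) ^ j *\<^sub>C x j) \<in> X" and "j \<le> d"
  shows "x j \<in> X"
  using assms(2,3)
proof (induction d arbitrary: x j)
  case 0
  from 0(1)[of 0] 0(2) show ?case by (simp add: scaleC_one)
next
  case (Suc d)
  define p where "p k = (\<Sum>j\<le>Suc d. (of_nat k) ^ j *\<^sub>C x j)" for k :: nat
  define y where "y j = ((2::complex) ^ j - 2 ^ Suc d) *\<^sub>C x j" for j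
  have "(\<Sum>j\<le>d. (of_nat k) ^ j *\<^sub>C y j) = p (2 * k) - 2 ^ Suc d *\<^sub>C p k" for k
  proof -
    have "p (2 * k) - 2 ^ Suc d *\<^sub>C p k = (\<Sum>j\<le>Suc d. (of_nat k) ^ j *\<^sub>C y j)"
      unfolding p_def y_def complex_vector.scale_sum_right sum_subtractf[symmetric]
      by (rule sum.cong[OF refl])
        (simp add: complex_vector.scale_right_diff_distrib complex_vector.scale_left_diff_distrib
          right_diff_distrib power_mult_distrib mult.commute)
    also have "\<dots> = (\<Sum>j\<le>d. (of_nat k) ^ j *\<^sub>C y j)"
      by (simp add: y_def)
    finally show ?thesis ..
  qed
  moreover have "p k \<in> X" for k
    using Suc.prems(1) by (simp add: p_def)
  ultimately have "(\<Sum>j\<le>d. (of_nat k) ^ j *\<^sub>C y j) \<in> X" for k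
    by (simp only: complex_vector.subspace_diff[OF X] complex_vector.subspace_scale[OF X])
  then have y: "y j \<in> X" if "j \<le> d" for j
    using Suc.IH that by blast
  have x: "x j \<in> X" if "j \<le> d" for j
  proof -
    have ne: "(2::complex) ^ j - 2 ^ Suc d \<noteq> 0"
    proof
      assume "(2::complex) ^ j - 2 ^ Suc d = 0"
      then have "norm ((2::complex) ^ j) = norm ((2::complex) ^ Suc d)" by simp
      then have "(2::real) ^ j = 2 ^ Suc d" by (simp only: norm_power norm_numeral)
      then have "j = Suc d" by (subst (asm) power_inject_exp) auto
      with that show False by simp
    qed
    have "(1 / ((2::complex) ^ j - 2 ^ Suc d)) *\<^sub>C y j \<in> X"
      using y[OF that] by (rule complex_vector.subspace_scale[OF X])
    then show ?thesis
      using ne by (simp add: y_def scaleC_scaleC scaleC_one)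
  qed
  show ?case
  proof (cases "j \<le> d")
    case False
    with Suc.prems have "j = Suc d" by simp
    moreover have "x (Suc d) = p 1 - (\<Sum>j\<le>d. x j)"
      by (simp add: p_def scaleC_one)
    moreover have "p 1 \<in> X" using Suc.prems(1)[of 1] by (simp add: p_def)
    ultimately show ?thesis
      using x by (auto intro!: complex_vector.subspace_diff[OF X] complex_vector.subspace_sum[OF X])
  qed (rule x)
qed

lemma functional_separating:
  assumes "csubspace X" "y \<notin> X"
  obtains f :: "'a::complex_vector \<Rightarrow> complex" where "clinear f" "\<And>x. x \<in> X \<Longrightarrow> f x = 0" "f y = 1"
proof -
  interpret vector_space_pair "scaleC :: complex \<Rightarrow> 'a \<Rightarrow> 'a" "scaleC :: complex \<Rightarrow> complex \<Rightarrow> complex" ..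
  obtain B where B: "B \<subseteq> X" "cindependent B" "X \<subseteq> cspan B"
    using complex_vector.basis_exists by metis
  have "y \<notin> cspan B"
    using assms B(1) by (metis complex_vector.span_minimal subsetD)
  then have "cindependent (insert y B)"
    using B(2) by (metis complex_vector.independent_insertI)
  then have "\<exists>g. clinear g \<and> (\<forall>x\<in>insert y B. g x = (if x = y then 1 else 0::complex))"
    by (rule linear_independent_extend)
  then obtain g where g: "clinear g" "\<forall>x\<in>insert y B. g x = (if x = y then 1 else 0::complex)"
    by blast
  have "g x = 0" if "x \<in> X" for x
  proof -
    have "x \<in> cspan B" using that B by auto
    then have "g x \<in> {0}"
      using g \<open>y \<notin> cspan B\<close> complex_vector.span_base
      by (intro clinear_span_image[OF g(1), of x B]) (auto simp: complex_vector.subspace_def)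
    then show ?thesis by simp
  qed
  with g show ?thesis by (intro that[of g]) auto
qed

section \<open>Nilpotent exponentials\<close>

lemma exp_nilpotent_eq:
  assumes "clinear N" "(N ^^ K) x = 0"
  shows "exp_nilpotent c N x = (\<Sum>k<K. (c ^ k / fact k) *\<^sub>C (N ^^ k) x)"
  unfolding exp_nilpotent_def
proof (rule Sum_any.expand_superset)
  show "{a. (c ^ a / fact a) *\<^sub>C (N ^^ a) x \<noteq> 0} \<subseteq> {..<K}"
    using funpow_zero_mono[OF assms] by (force simp: not_less[symmetric])
qed auto

lemma locally_nilpotentE:
  assumes "locally_nilpotent N"
  obtains k where "(N ^^ k) x = 0"
  using assms by (auto simp: locally_nilpotent_def)

lemma exp_nilpotent_add:
  assumes N: "clinear N" "locally_nilpotent N"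
  shows "exp_nilpotent (c + d) N x = exp_nilpotent c N (exp_nilpotent d N x)"
proof -
  obtain K where K: "(N ^^ K) x = 0" using N(2) by (rule locally_nilpotentE)
  have z: "(N ^^ k) x = 0" if "K \<le> k" for k
    using funpow_zero_mono[OF N(1) K that] .
  note lin = clinear_funpow[OF N(1)]
  define g where "g i j = (c ^ i / fact i * (d ^ j / fact j)) *\<^sub>C (N ^^ (i + j)) x" for i j
  have "(N ^^ i) (exp_nilpotent d N x) = (\<Sum>j<K. (d ^ j / fact j) *\<^sub>C (N ^^ (i + j)) x)" for i
    by (simp add: exp_nilpotent_eq[OF N(1) K] clinear_sum[OF lin] clinear_scale[OF lin] funpow_add)
  note e = this
  have "(N ^^ K) (exp_nilpotent d N x) = 0"
    unfolding e by (rule sum.neutral) (simp add: z)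
  then have "exp_nilpotent c N (exp_nilpotent d N x) = (\<Sum>i<K. \<Sum>j<K. g i j)"
    by (simp add: exp_nilpotent_eq[OF N(1)] e g_def complex_vector.scale_sum_right scaleC_scaleC)
  also have "\<dots> = (\<Sum>(i,j)\<in>{..<K}\<times>{..<K}. g i j)"
    by (simp add: sum.cartesian_product)
  also have "\<dots> = (\<Sum>(i,j)\<in>{(i,j). i + j < K}. g i j)"
    by (rule sum.mono_neutral_right) (auto simp: g_def, metis z leI)
  also have "\<dots> = (\<Sum>k<K. \<Sum>i\<le>k. g i (k - i))"
    by (rule sum.triangle_reindex)
  also have "\<dots> = (\<Sum>k<K. ((c + d) ^ k / fact k) *\<^sub>C (N ^^ k) x)"
  proof (rule sum.cong[OF refl])
    fix k
    have "(\<Sum>i\<le>k. g i (k - i)) = (\<Sum>i\<le>k. c ^ i / fact i * (d ^ (k - i) / fact (k - i))) *\<^sub>C (N ^^ k) x"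
      by (simp add: g_def complex_vector.scale_sum_left)
    also have "(\<Sum>i\<le>k. c ^ i / fact i * (d ^ (k - i) / fact (k - i))) = (c + d) ^ k / fact k"
      unfolding binomial_ring sum_divide_distrib
      by (rule sum.cong[OF refl]) (simp add: binomial_fact)
    finally show "(\<Sum>i\<le>k. g i (k - i)) = ((c + d) ^ k / fact k) *\<^sub>C (N ^^ k) x" .
  qed
  finally show ?thesis
    by (simp add: exp_nilpotent_eq[OF N(1) K])
qed

lemma exp_nilpotent_0:
  assumes N: "clinear N" "locally_nilpotent N"
  shows "exp_nilpotent 0 N x = x"
proof -
  obtain K where K: "(N ^^ K) x = 0" using N(2) by (rule locally_nilpotentE)
  have "(N ^^ Suc K) x = 0"
    by (rule funpow_zero_mono[OF N(1) K]) simp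
  from exp_nilpotent_eq[OF N(1) this, of 0] show ?thesis
    by (simp only: sum.lessThan_Suc_shift) (simp add: scaleC_one)
qed

lemma exp_nilpotent_of_nat:
  assumes N: "clinear N" "locally_nilpotent N"
  shows "exp_nilpotent (of_nat k * c) N x = ((exp_nilpotent c N) ^^ k) x"
  by (induction k) (simp_all add: exp_nilpotent_0[OF N] exp_nilpotent_add[OF N] algebra_simps)

lemma clinear_exp_nilpotent:
  assumes N: "clinear N" "locally_nilpotent N"
  shows "clinear (exp_nilpotent c N)"
proof (rule clinearI)
  note lin = clinear_funpow[OF N(1)]
  fix x y
  obtain K1 K2 where K: "(N ^^ K1) x = 0" "(N ^^ K2) y = 0"
    using N(2) by (metis locally_nilpotentE)
  define K where "K = max K1 K2"
  have *: "(N ^^ K) x = 0" "(N ^^ K) y = 0" "(N ^^ K) (x + y) = 0"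
    using funpow_zero_mono[OF N(1) K(1), of K] funpow_zero_mono[OF N(1) K(2), of K]
    by (auto simp: K_def clinear_add[OF lin])
  show "exp_nilpotent c N (x + y) = exp_nilpotent c N x + exp_nilpotent c N y"
    by (simp add: exp_nilpotent_eq[OF N(1) *(1)] exp_nilpotent_eq[OF N(1) *(2)]
        exp_nilpotent_eq[OF N(1) *(3)] clinear_add[OF lin] scaleC_add_right sum.distrib)
next
  note lin = clinear_funpow[OF N(1)]
  fix d x
  obtain K where K: "(N ^^ K) x = 0" using N(2) by (rule locally_nilpotentE)
  then have K': "(N ^^ K) (d *\<^sub>C x) = 0" by (simp add: clinear_scale[OF lin])
  show "exp_nilpotent c N (d *\<^sub>C x) = d *\<^sub>C exp_nilpotent c N x"
    by (simp add: exp_nilpotent_eq[OF N(1) K] exp_nilpotent_eq[OF N(1) K']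
        clinear_scale[OF lin] complex_vector.scale_sum_right scaleC_scaleC mult.commute)
qed

text \<open>The difference in \<open>pw\<close> is a polynomial in \<open>k\<close> without constant
  term whose linear coefficient is \<open>c *\<^sub>C N x\<close>.\<close>

lemma exp_nilpotent_powers_imp_mem:
  assumes N: "clinear N" "locally_nilpotent N" and X: "csubspace X" and c: "c \<noteq> 0"
    and pw: "\<And>k. (exp_nilpotent c N ^^ k) x - x \<in> X"
  shows "N x \<in> X"
proof -
  obtain K where K: "(N ^^ K) x = 0" using N(2) by (rule locally_nilpotentE)
  then have K': "(N ^^ Suc (Suc K)) x = 0" by (rule funpow_zero_mono[OF N(1)]) simp
  have "(\<Sum>j\<le>Suc K. of_nat k ^ j *\<^sub>C (if j = 0 then 0 else (c ^ j / fact j) *\<^sub>C (N ^^ j) x)) \<in> X" for k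
  proof -
    have "(\<Sum>j\<le>Suc K. of_nat k ^ j *\<^sub>C ((c ^ j / fact j) *\<^sub>C (N ^^ j) x)) = (exp_nilpotent c N ^^ k) x"
      by (simp only: exp_nilpotent_of_nat[OF N, symmetric] exp_nilpotent_eq[OF N(1) K'] power_mult_distrib
          scaleC_scaleC times_divide_eq_right lessThan_Suc_atMost)
    moreover have "(\<Sum>j\<le>Suc K. of_nat k ^ j *\<^sub>C (if j = 0 then 0 else (c ^ j / fact j) *\<^sub>C (N ^^ j) x)) =
      (\<Sum>j\<le>Suc K. of_nat k ^ j *\<^sub>C ((c ^ j / fact j) *\<^sub>C (N ^^ j) x)) - x"
      by (simp only: sum.atMost_Suc_shift) (simp add: scaleC_one)
    ultimately show ?thesis using pw[of k] by (simp only:)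
  qed
  then have "(if (1::nat) = 0 then 0 else (c ^ 1 / fact 1) *\<^sub>C (N ^^ 1) x) \<in> X"
    by (rule poly_coeffs_in_subspace[OF X]) simp
  from complex_vector.subspace_scale[OF X this, of "1 / c"] show ?thesis
    using c by (simp add: scaleC_scaleC scaleC_one)
qed

text \<open>What is known of \<open>g\<close>, such as preserving weights and fermion numbers,
  concerns only the exponential; iterating it brings the previous lemma into play.\<close>

lemma exp_nilpotent_stable_imp_stable:
  assumes N: "clinear N" "locally_nilpotent N" and X: "csubspace X" and c: "c \<noteq> 0"
    and st: "\<And>x. x \<in> X \<Longrightarrow> exp_nilpotent c N x \<in> X" and x: "x \<in> X"
  shows "N x \<in> X"
proof (rule exp_nilpotent_powers_imp_mem[OF N X c])
  fix k
  have "(exp_nilpotent c N ^^ k) x \<in> X" by (induction k) (auto intro: st x)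
  then show "(exp_nilpotent c N ^^ k) x - x \<in> X" using x by (rule complex_vector.subspace_diff[OF X])
qed

lemma exp_nilpotent_eq_self_imp_0:
  assumes N: "clinear N" "locally_nilpotent N" and c: "c \<noteq> 0" and fx: "exp_nilpotent c N x = x"
  shows "N x = 0"
proof -
  have "(exp_nilpotent c N ^^ k) x = x" for k by (induction k) (auto simp: fx)
  then have "N x \<in> {0}"
    by (intro exp_nilpotent_powers_imp_mem[OF N _ c]) (simp_all add: complex_vector.subspace_def)
  then show ?thesis by simp
qed

text \<open>Both sides of \<open>e\<^sup>k\<^sup>c\<^sup>N B(u, v) = B(e\<^sup>k\<^sup>c\<^sup>N u, e\<^sup>k\<^sup>c\<^sup>N v)\<close> are polynomials in
  \<open>k\<close>; the claim compares their linear coefficients.\<close>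

lemma exp_nilpotent_hom_imp_derivation:
  assumes N1: "clinear N1" "locally_nilpotent N1" and N2: "clinear N2" "locally_nilpotent N2"
    and N3: "clinear N3" "locally_nilpotent N3" and c: "c \<noteq> 0"
    and B1: "\<And>v. clinear (\<lambda>u. B u v)" and B2: "\<And>u. clinear (B u)"
    and hom: "\<And>u v. exp_nilpotent c N3 (B u v) = B (exp_nilpotent c N1 u) (exp_nilpotent c N2 v)"
  shows "N3 (B u v) = B (N1 u) v + B u (N2 v)"
proof -
  obtain K1 K2 K3 where K: "(N1 ^^ K1) u = 0" "(N2 ^^ K2) v = 0" "(N3 ^^ K3) (B u v) = 0"
    using N1(2) N2(2) N3(2) by (metis locally_nilpotentE)
  \<comment> \<open>Large enough for \<open>N3 ^^ d\<close> to kill \<open>B u v\<close> and for all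
    \<open>i < K1\<close>, \<open>j < K2\<close> to satisfy \<open>i + j < d\<close>; the two extra
    units make the linear coefficient available.\<close>
  define d where "d = Suc (Suc (max (K1 + K2) K3))"
  have z: "(N1 ^^ K1) u = 0" "(N2 ^^ K2) v = 0" "(N3 ^^ d) (B u v) = 0"
    using funpow_zero_mono[OF N3(1) K(3), of d] K by (auto simp: d_def)
  have z': "(N1 ^^ k) u = 0" if "K1 \<le> k" for k
    using funpow_zero_mono[OF N1(1) K(1) that] .
  have z'': "(N2 ^^ k) v = 0" if "K2 \<le> k" for k
    using funpow_zero_mono[OF N2(1) K(2) that] .
  define b where "b i j = (1 / (fact i * fact j)) *\<^sub>C B ((N1 ^^ i) u) ((N2 ^^ j) v)" for i j
  have b0: "b i j = 0" if "K1 \<le> i \<or> K2 \<le> j" for i j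
    using that z' z'' clinear_0[OF B1] clinear_0[OF B2] by (auto simp: b_def)
  have pw: "((exp_nilpotent c N3) ^^ k) (B u v) =
      B (((exp_nilpotent c N1) ^^ k) u) (((exp_nilpotent c N2) ^^ k) v)" for k
    by (induction k) (simp_all add: hom)
  \<comment> \<open>The coefficient of \<open>k ^ r\<close> in the difference of the two sides; for
    \<open>r = 1\<close> it is \<open>c\<close> times the failure of the derivation rule.\<close>
  define x where "x r = c ^ r *\<^sub>C ((1 / fact r) *\<^sub>C (N3 ^^ r) (B u v) - (\<Sum>i\<le>r. b i (r - i)))" for r
  have "(\<Sum>r<d. of_nat k ^ r *\<^sub>C x r) = 0" for k
  proof -
    let ?c = "of_nat k * c"
    have "(\<Sum>r<d. (?c ^ r / fact r) *\<^sub>C (N3 ^^ r) (B u v)) = exp_nilpotent ?c N3 (B u v)"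
      by (simp add: exp_nilpotent_eq[OF N3(1) z(3)])
    also have "\<dots> = B (exp_nilpotent ?c N1 u) (exp_nilpotent ?c N2 v)"
      by (simp add: exp_nilpotent_of_nat N1 N2 N3 pw)
    also have "\<dots> = (\<Sum>i<K1. \<Sum>j<K2. ?c ^ (i + j) *\<^sub>C b i j)"
      by (simp add: exp_nilpotent_eq[OF N1(1) z(1)] exp_nilpotent_eq[OF N2(1) z(2)]
          clinear_sum[OF B1] clinear_scale[OF B1] clinear_sum[OF B2] clinear_scale[OF B2]
          b_def scaleC_scaleC power_add complex_vector.scale_sum_right mult.commute)
        (subst sum.swap, simp add: mult.commute)
    also have "\<dots> = (\<Sum>(i,j)\<in>{..<K1}\<times>{..<K2}. ?c ^ (i + j) *\<^sub>C b i j)"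
      by (simp add: sum.cartesian_product)
    also have "\<dots> = (\<Sum>(i,j)\<in>{(i,j). i + j < d}. ?c ^ (i + j) *\<^sub>C b i j)"
    proof (rule sum.mono_neutral_left)
      show "finite {(i, j). i + j < d}"
        by (rule finite_subset[of _ "{..<d} \<times> {..<d}"]) auto
      have "i < K1 \<and> j < K2" if "b i j \<noteq> 0" for i j
        using b0 that leI by blast
      then show "\<forall>x\<in>{(i, j). i + j < d} - {..<K1} \<times> {..<K2}. (case x of (i, j) \<Rightarrow> ?c ^ (i + j) *\<^sub>C b i j) = 0"
        by auto
    qed (auto simp: d_def)
    also have "\<dots> = (\<Sum>r<d. \<Sum>i\<le>r. ?c ^ (i + (r - i)) *\<^sub>C b i (r - i))"
      by (rule sum.triangle_reindex)
    finally have *: "(\<Sum>r<d. (?c ^ r / fact r) *\<^sub>C (N3 ^^ r) (B u v)) =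
        (\<Sum>r<d. ?c ^ r *\<^sub>C (\<Sum>i\<le>r. b i (r - i)))"
      by (simp add: complex_vector.scale_sum_right)
    have "(\<Sum>r<d. of_nat k ^ r *\<^sub>C x r) =
      (\<Sum>r<d. (?c ^ r / fact r) *\<^sub>C (N3 ^^ r) (B u v)) - (\<Sum>r<d. ?c ^ r *\<^sub>C (\<Sum>i\<le>r. b i (r - i)))"
      unfolding sum_subtractf[symmetric]
      by (rule sum.cong[OF refl])
        (simp add: x_def scaleC_scaleC power_mult_distrib complex_vector.scale_right_diff_distrib)
    then show ?thesis by (simp add: *)
  qed
  then have "(\<Sum>r\<le>d - 1. of_nat k ^ r *\<^sub>C x r) \<in> {0}" for k
    by (simp add: d_def lessThan_Suc_atMost)
  then have "x 1 \<in> {0}"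
    by (rule poly_coeffs_in_subspace[rotated]) (auto simp: complex_vector.subspace_def d_def)
  then have "c *\<^sub>C (N3 (B u v) - (B (N1 u) v + B u (N2 v))) = 0"
    by (simp add: x_def b_def scaleC_one add.commute)
  then show ?thesis
    using c by simp
qed

section \<open>Generalized eigenspaces and gradings\<close>

lemma gen_eigenspaceI:
  assumes "((\<lambda>y. T y - c *\<^sub>C y) ^^ k) x = 0"
  shows "x \<in> gen_eigenspace T c"
  using assms by (auto simp: gen_eigenspace_def)

lemma gen_eigenspace_0:
  assumes "clinear T"
  shows "0 \<in> gen_eigenspace T c"
  by (rule gen_eigenspaceI[where k=0]) simp

lemma subspace_gen_eigenspace:
  assumes T: "clinear T"
  shows "csubspace (gen_eigenspace T c)"
  unfolding complex_vector.subspace_def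
proof (intro conjI ballI allI)
  note lin = clinear_diff_scale[OF T, of c]
  show "0 \<in> gen_eigenspace T c" by (rule gen_eigenspace_0[OF T])
  fix x assume "x \<in> gen_eigenspace T c"
  then obtain k where k: "((\<lambda>y. T y - c *\<^sub>C y) ^^ k) x = 0" by (auto simp: gen_eigenspace_def)
  show "a *\<^sub>C x \<in> gen_eigenspace T c" for a
    by (rule gen_eigenspaceI[where k=k]) (simp add: clinear_scale[OF clinear_funpow[OF lin]] k)
  fix y assume "y \<in> gen_eigenspace T c"
  then obtain l where l: "((\<lambda>y. T y - c *\<^sub>C y) ^^ l) y = 0" by (auto simp: gen_eigenspace_def)
  show "x + y \<in> gen_eigenspace T c"
    by (rule gen_eigenspaceI[where k="max k l"])
      (simp add: clinear_add[OF clinear_funpow[OF lin]] funpow_zero_mono[OF lin k] funpow_zero_mono[OF lin l])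
qed

lemma gen_eigenspace_step:
  assumes "T y - c *\<^sub>C y \<in> gen_eigenspace T c"
  shows "y \<in> gen_eigenspace T c"
proof -
  obtain k where "((\<lambda>y. T y - c *\<^sub>C y) ^^ k) (T y - c *\<^sub>C y) = 0"
    using assms by (auto simp: gen_eigenspace_def)
  then show ?thesis
    by (intro gen_eigenspaceI[where k="Suc k"]) (simp only: funpow_Suc_right o_apply)
qed

text \<open>Writing \<open>T1 = a + D1\<close> and \<open>T2 = b + D2\<close>, the operator
  \<open>T3 - a * b\<close> sends \<open>B u v\<close> to three terms of the same kind in which
  \<open>D1\<close> or \<open>D2\<close> has been applied, so the sum of the two orders can be
  lowered.\<close>

lemma gen_eigenspace_bilinear:
  assumes T1: "clinear T1" and T2: "clinear T2" and T3: "clinear T3"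
    and B1: "\<And>v. clinear (\<lambda>u. B u v)" and B2: "\<And>u. clinear (B u)"
    and hom: "\<And>u v. T3 (B u v) = B (T1 u) (T2 v)"
    and u: "u \<in> gen_eigenspace T1 a" and v: "v \<in> gen_eigenspace T2 b"
  shows "B u v \<in> gen_eigenspace T3 (a * b)"
proof -
  let ?D1 = "\<lambda>y. T1 y - a *\<^sub>C y" and ?D2 = "\<lambda>y. T2 y - b *\<^sub>C y"
  have "B u v \<in> gen_eigenspace T3 (a * b)"
    if "(?D1 ^^ i) u = 0" "(?D2 ^^ j) v = 0" for i j u v
    using that
  proof (induction "i + j" arbitrary: i j u v)
    case 0
    then show ?case by (simp add: clinear_0[OF B1] gen_eigenspace_0[OF T3])
  next
    case (Suc n)
    note sub = subspace_gen_eigenspace[OF T3]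
    note l = clinear_diff_scale[OF T1, of a] clinear_diff_scale[OF T2, of b]
    have e: "T3 (B u v) - (a * b) *\<^sub>C B u v = B (?D1 u) (?D2 v) + b *\<^sub>C B (?D1 u) v + a *\<^sub>C B u (?D2 v)"
      by (simp add: hom clinear_diff[OF B1] clinear_diff[OF B2] clinear_scale[OF B1] clinear_scale[OF B2]
          complex_vector.scale_right_diff_distrib scaleC_scaleC algebra_simps)
    show ?case
    proof (cases "i = 0 \<or> j = 0")
      case True
      then have "u = 0 \<or> v = 0" using Suc.prems by auto
      then show ?thesis by (auto simp: clinear_0[OF B1] clinear_0[OF B2] gen_eigenspace_0[OF T3])
    next
      case False
      then obtain i' j' where ij: "i = Suc i'" "j = Suc j'" by (metis nat.exhaust)
      have u': "(?D1 ^^ i') (?D1 u) = 0" and v': "(?D2 ^^ j') (?D2 v) = 0"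
        using Suc.prems unfolding ij by (simp_all only: funpow_Suc_right o_apply)
      \<comment> \<open>Deliberately not the sharp order: \<open>i' + j\<close> is exactly the
        \<open>n\<close> that the induction hypothesis requires.\<close>
      have v'': "(?D2 ^^ j) (?D2 v) = 0"
        by (rule funpow_zero_mono[OF l(2) v']) (simp add: ij)
      have "B (?D1 u) (?D2 v) \<in> gen_eigenspace T3 (a * b)"
        "B (?D1 u) v \<in> gen_eigenspace T3 (a * b)" "B u (?D2 v) \<in> gen_eigenspace T3 (a * b)"
        using Suc.hyps(1)[OF _ u' v''] Suc.hyps(1)[OF _ u' Suc.prems(2)] Suc.hyps(1)[OF _ Suc.prems(1) v']
          Suc.hyps(2) by (auto simp: ij)
      then have "T3 (B u v) - (a * b) *\<^sub>C B u v \<in> gen_eigenspace T3 (a * b)"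
        unfolding e by (intro complex_vector.subspace_add[OF sub] complex_vector.subspace_scale[OF sub])
      then show ?thesis by (rule gen_eigenspace_step)
    qed
  qed
  then show ?thesis using u v by (auto simp: gen_eigenspace_def)
qed

lemma gen_eigenspace_eigenvector:
  assumes "x \<in> gen_eigenspace T c" "x \<noteq> 0"
  obtains y where "y \<noteq> 0" "T y = c *\<^sub>C y"
proof -
  define D where "D y = T y - c *\<^sub>C y" for y
  define k where "k = (LEAST k. (D ^^ k) x = 0)"
  have "\<exists>k. (D ^^ k) x = 0"
    using assms(1) by (auto simp: gen_eigenspace_def D_def[abs_def])
  then have k: "(D ^^ k) x = 0" unfolding k_def by (rule LeastI_ex)
  then obtain k' where k': "k = Suc k'" using assms(2) by (cases k) auto
  then have "(D ^^ k') x \<noteq> 0"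
    using not_less_Least[of k' "\<lambda>k. (D ^^ k) x = 0"] by (auto simp: k_def)
  then show ?thesis using k by (intro that[of "(D ^^ k') x"]) (auto simp: k' D_def)
qed

lemma gradedD_subspace: "graded K X \<Longrightarrow> k \<in> K \<Longrightarrow> csubspace (X k)"
  by (auto simp: graded_def)

lemma graded_decompose:
  assumes "graded K X"
  obtains A f where "finite A" "A \<subseteq> K" "\<And>k. k \<in> A \<Longrightarrow> f k \<in> X k" "x = (\<Sum>k\<in>A. f k)"
proof -
  obtain f where "finite {k. f k \<noteq> 0}" "{k. f k \<noteq> 0} \<subseteq> K" "\<forall>k\<in>K. f k \<in> X k" "x = (\<Sum>k | f k \<noteq> 0. f k)"
    using assms unfolding graded_def by blast
  then show ?thesis
    by (intro that[of "{k. f k \<noteq> 0}" f]) auto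
qed

text \<open>The uniqueness clause of \<open>graded\<close>, applied to \<open>f\<close> extended by
  zero and to the zero family.\<close>

lemma graded_zero_sum:
  assumes g: "graded K X" and A: "finite A" "A \<subseteq> K" "\<And>k. k \<in> A \<Longrightarrow> f k \<in> X k" "(\<Sum>k\<in>A. f k) = 0"
    and k: "k \<in> A"
  shows "f k = 0"
proof -
  let ?P = "\<lambda>f. finite {k. f k \<noteq> 0} \<and> {k. f k \<noteq> 0} \<subseteq> K \<and> (\<forall>k\<in>K. f k \<in> X k) \<and> (\<Sum>k | f k \<noteq> 0. f k) = 0"
  have ex1: "\<exists>!f. ?P f"
    using g unfolding graded_def eq_commute[of _ "sum _ _"] by (elim conjE allE)
  define h where "h k = (if k \<in> A then f k else 0)" for k
  have sub: "{k. h k \<noteq> 0} \<subseteq> A" by (auto simp: h_def)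
  have "(\<Sum>k | h k \<noteq> 0. h k) = (\<Sum>k\<in>A. h k)"
    by (rule sum.mono_neutral_left) (use A(1) sub in auto)
  also have "\<dots> = 0" using A(4) by (simp add: h_def)
  finally have s0: "(\<Sum>k | h k \<noteq> 0. h k) = 0" .
  have X0: "0 \<in> X k" if "k \<in> K" for k
    using complex_vector.subspace_0[OF gradedD_subspace[OF g that]] .
  have hX: "h k \<in> X k" if "k \<in> K" for k
    unfolding h_def using A(3)[of k] X0[OF that] by (cases "k \<in> A") simp_all
  have fin: "finite {k. h k \<noteq> 0}"
    using finite_subset[OF sub A(1)] .
  have subK: "{k. h k \<noteq> 0} \<subseteq> K" using sub A(2) by blast
  have P1: "?P h"
    using fin subK s0 hX by simp
  have P2: "?P (\<lambda>_. 0)"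
    using X0 by simp
  from ex1 have "h = (\<lambda>_. 0)"
  proof (rule ex1E)
    fix e assume e: "\<forall>f. ?P f \<longrightarrow> f = e"
    have "h = e" by (rule mp[OF spec[OF e] P1])
    moreover have "(\<lambda>_. 0) = e" by (rule mp[OF spec[OF e] P2])
    ultimately show ?thesis by simp
  qed
  then show ?thesis using k by (metis h_def)
qed

lemma span_UN_sum:
  assumes sub: "\<And>k. k \<in> L \<Longrightarrow> csubspace (X k)" and x: "x \<in> cspan (\<Union>k\<in>L. X k)"
  obtains A f where "finite A" "A \<subseteq> L" "\<And>k. k \<in> A \<Longrightarrow> f k \<in> X k" "x = (\<Sum>k\<in>A. f k)"
proof -
  have "\<exists>A f. finite A \<and> A \<subseteq> L \<and> (\<forall>k\<in>A. f k \<in> X k) \<and> x = (\<Sum>k\<in>A. f k)"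
    using x
  proof (induction rule: complex_vector.span_induct_alt)
    case base
    show ?case by (rule exI[of _ "{}"]) auto
  next
    case (step c y z)
    then obtain A f where A: "finite A" "A \<subseteq> L" "\<forall>k\<in>A. f k \<in> X k" "z = (\<Sum>k\<in>A. f k)" by blast
    obtain l where l: "l \<in> L" "y \<in> X l" using step(1) by blast
    define f' where "f' k = (if k = l then c *\<^sub>C y else 0) + (if k \<in> A then f k else 0)" for k
    have "(\<Sum>k\<in>insert l A. f' k) = (\<Sum>k\<in>insert l A. if k = l then c *\<^sub>C y else 0) + (\<Sum>k\<in>insert l A. if k \<in> A then f k else 0)"
      by (simp only: f'_def sum.distrib)
    also have "(\<Sum>k\<in>insert l A. if k = l then c *\<^sub>C y else 0) = c *\<^sub>C y"
      using A(1) by simp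
    also have "(\<Sum>k\<in>insert l A. if k \<in> A then f k else 0) = (\<Sum>k\<in>A. if k \<in> A then f k else 0)"
      by (rule sum.mono_neutral_right) (use A in auto)
    also have "\<dots> = z" by (simp add: A(4))
    finally have "c *\<^sub>C y + z = (\<Sum>k\<in>insert l A. f' k)" ..
    moreover have "f' k \<in> X k" if "k \<in> insert l A" for k
    proof -
      have kL: "k \<in> L" using that l A by auto
      show ?thesis
        unfolding f'_def using A(3) l complex_vector.subspace_0[OF sub[OF kL]]
        by (intro complex_vector.subspace_add[OF sub[OF kL]])
          (auto intro: complex_vector.subspace_scale[OF sub])
    qed
    ultimately show ?case using A l by (intro exI[of _ "insert l A"] exI[of _ f']) auto
  qed
  then show ?thesis using that by blast
qed

text \<open>Two homogeneous decompositions of \<open>x\<close> agree componentwise, so components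
  outside either index set vanish. This gives the independence of generalized eigenspaces and allows
  weight and \<open>g\<close>-weight to be prescribed at the same time.\<close>

lemma graded_span_Int:
  assumes g: "graded K X" and L: "L1 \<subseteq> K" "L2 \<subseteq> K"
    and x: "x \<in> cspan (\<Union>k\<in>L1. X k)" "x \<in> cspan (\<Union>k\<in>L2. X k)"
  shows "x \<in> cspan (\<Union>k\<in>L1 \<inter> L2. X k)"
proof -
  have s1: "\<And>k. k \<in> L1 \<Longrightarrow> csubspace (X k)" and s2: "\<And>k. k \<in> L2 \<Longrightarrow> csubspace (X k)"
    using gradedD_subspace[OF g] L by auto
  obtain A f where A: "finite A" "A \<subseteq> L1" "\<And>k. k \<in> A \<Longrightarrow> f k \<in> X k" "x = (\<Sum>k\<in>A. f k)"
    using span_UN_sum[OF s1 x(1)] by metis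
  obtain B h where B: "finite B" "B \<subseteq> L2" "\<And>k. k \<in> B \<Longrightarrow> h k \<in> X k" "x = (\<Sum>k\<in>B. h k)"
    using span_UN_sum[OF s2 x(2)] by metis
  define d where "d k = (if k \<in> A then f k else 0) - (if k \<in> B then h k else 0)" for k
  have "(\<Sum>k\<in>A \<union> B. if k \<in> A then f k else 0) = x"
    unfolding A(4) using A(1) B(1) by (simp add: sum.If_cases Int_absorb1)
  moreover have "(\<Sum>k\<in>A \<union> B. if k \<in> B then h k else 0) = x"
    unfolding B(4) using A(1) B(1) by (simp add: sum.If_cases Int_absorb1)
  ultimately have s0: "(\<Sum>k\<in>A \<union> B. d k) = 0"
    by (simp add: d_def sum_subtractf)
  have d0: "d k = 0" if "k \<in> A \<union> B" for k
  proof (rule graded_zero_sum[OF g _ _ _ s0 that])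
    fix k assume "k \<in> A \<union> B"
    then have "k \<in> K" using A(2) B(2) L by auto
    then show "d k \<in> X k"
      unfolding d_def using A(3) B(3) gradedD_subspace[OF g]
      by (intro complex_vector.subspace_diff) (auto intro: complex_vector.subspace_0)
  qed (use A B L in auto)
  have "f k = 0" if "k \<in> A - A \<inter> B" for k
    using d0[of k] that by (simp add: d_def)
  then have "x = (\<Sum>k\<in>A \<inter> B. f k)"
    unfolding A(4) by (intro sum.mono_neutral_right) (use A(1) in auto)
  also have "\<dots> \<in> cspan (\<Union>k\<in>L1 \<inter> L2. X k)"
  proof (intro complex_vector.span_sum complex_vector.span_base)
    fix k assume "k \<in> A \<inter> B"
    then show "f k \<in> (\<Union>k\<in>L1 \<inter> L2. X k)" using A(2,3) B(2) by auto
  qed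
  finally show ?thesis .
qed

lemma graded_span_UNIV:
  assumes "graded K X"
  shows "x \<in> cspan (\<Union>k\<in>K. X k)"
proof -
  obtain A f where "finite A" "A \<subseteq> K" "\<And>k. k \<in> A \<Longrightarrow> f k \<in> X k" "x = (\<Sum>k\<in>A. f k)"
    using graded_decompose[OF assms] by metis
  then have "f k \<in> cspan (\<Union>k\<in>K. X k)" if "k \<in> A" for k
    using that by (intro complex_vector.span_base) auto
  then show ?thesis
    unfolding \<open>x = _\<close> by (rule complex_vector.span_sum)
qed

text \<open>A power of \<open>T - c\<close> that kills \<open>x\<close> acts on each homogeneous
  component separately, hence kills them all. With \<open>T\<close> the automorphism this yields
  vectors homogeneous for the grading and for \<open>g\<close> together.\<close>

lemma graded_gen_eigenspace_span:
  assumes g: "graded K X" and T: "clinear T" and TX: "\<And>k x. k \<in> K \<Longrightarrow> x \<in> X k \<Longrightarrow> T x \<in> X k"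
    and x: "x \<in> gen_eigenspace T c"
  shows "x \<in> cspan (\<Union>k\<in>K. X k \<inter> gen_eigenspace T c)"
proof -
  obtain A f where A: "finite A" "A \<subseteq> K" "\<And>k. k \<in> A \<Longrightarrow> f k \<in> X k" "x = (\<Sum>k\<in>A. f k)"
    using graded_decompose[OF g] by metis
  let ?D = "\<lambda>y. T y - c *\<^sub>C y"
  obtain n where n: "(?D ^^ n) x = 0" using x by (auto simp: gen_eigenspace_def)
  note lin = clinear_funpow[OF clinear_diff_scale[OF T], of n c]
  have DX: "(?D ^^ n) y \<in> X k" if "k \<in> K" "y \<in> X k" for n k y
    by (induction n) (auto simp: that TX intro!: complex_vector.subspace_diff[OF gradedD_subspace[OF g that(1)]]
        complex_vector.subspace_scale[OF gradedD_subspace[OF g that(1)]])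
  have s0: "(\<Sum>k\<in>A. (?D ^^ n) (f k)) = 0"
    using n by (simp only: A(4) clinear_sum[OF lin])
  have f: "f k \<in> X k \<inter> gen_eigenspace T c" if "k \<in> A" for k
  proof -
    have "(?D ^^ n) (f k) = 0"
      by (rule graded_zero_sum[OF g A(1,2) _ s0 that]) (use DX A in auto)
    then show ?thesis using A(3)[OF that] gen_eigenspaceI by blast
  qed
  show ?thesis
    unfolding A(4)
  proof (intro complex_vector.span_sum complex_vector.span_base)
    fix k assume "k \<in> A"
    then show "f k \<in> (\<Union>k\<in>K. X k \<inter> gen_eigenspace T c)" using f A(2) by auto
  qed
qed

section \<open>Regrouping the twisted products\<close>

lemma locally_nilpotent_finite:
  assumes N: "clinear N" "locally_nilpotent N" and A: "finite A"
  obtains J where "\<And>x j. x \<in> A \<Longrightarrow> J \<le> j \<Longrightarrow> (N ^^ j) x = 0"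
proof -
  have "\<exists>k. (N ^^ k) x = 0" for x using N(2) by (auto simp: locally_nilpotent_def)
  then obtain k where k: "\<And>x. (N ^^ k x) x = 0" by metis
  show ?thesis
  proof (rule that[of "Max (insert 0 (k ` A))"])
    fix x j assume "x \<in> A" "Max (insert 0 (k ` A)) \<le> j"
    then have "k x \<le> j" using A by simp
    then show "(N ^^ j) x = 0" by (rule funpow_zero_mono[OF N(1) k])
  qed
qed

text \<open>The binomial formula for \<open>(ad N)^r / r!\<close>. By \<open>ad\<close>,
  \<open>\<Phi> r\<close> is the \<open>r\<close>-fold commutator of \<open>N\<close> with
  \<open>\<Phi> 0\<close>, and the coefficients are those obtained by expanding the two exponentials
  around a field.\<close>

lemma iterated_commutator:
  assumes N: "clinear N"
    and ad: "\<And>r x. N (\<Phi> r x) - \<Phi> r (N x) = \<Phi> (Suc r) x"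
  shows "(\<Sum>k\<le>r. ((-1) ^ k / (fact (r - k) * fact k)) *\<^sub>C (N ^^ (r - k)) (\<Phi> 0 ((N ^^ k) x))) =
    (1 / fact r) *\<^sub>C \<Phi> r x"
proof -
  define S where "S r x = (\<Sum>k\<le>r. ((-1) ^ k * of_nat (r choose k)) *\<^sub>C (N ^^ (r - k)) (\<Phi> 0 ((N ^^ k) x)))" for r x
  have S: "S r x = \<Phi> r x" for r x
  proof (induction r arbitrary: x)
    case 0
    show ?case by (simp add: S_def)
  next
    case (Suc r)
    define t where "t k = (N ^^ (Suc r - k)) (\<Phi> 0 ((N ^^ k) x))" for k
    have "N (S r x) = (\<Sum>k\<le>r. ((-1) ^ k * of_nat (r choose k)) *\<^sub>C t k)"
      unfolding S_def clinear_sum[OF N] clinear_scale[OF N] t_def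
      by (rule sum.cong[OF refl]) (simp add: Suc_diff_le)
    also have "\<dots> = (\<Sum>k\<le>Suc r. ((-1) ^ k * of_nat (r choose k)) *\<^sub>C t k)"
      by simp
    finally have 1: "N (S r x) = t 0 + (\<Sum>k\<le>r. ((-1) ^ Suc k * of_nat (r choose Suc k)) *\<^sub>C t (Suc k))"
      by (simp only: sum.atMost_Suc_shift) simp
    have 2: "S r (N x) = (\<Sum>k\<le>r. ((-1) ^ k * of_nat (r choose k)) *\<^sub>C t (Suc k))"
      unfolding S_def t_def by (rule sum.cong[OF refl]) (simp add: funpow_swap1)
    have "S (Suc r) x = t 0 + (\<Sum>k\<le>r. ((-1) ^ Suc k * of_nat (Suc r choose Suc k)) *\<^sub>C t (Suc k))"
      unfolding S_def t_def by (simp only: sum.atMost_Suc_shift) simp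
    also have "(\<Sum>k\<le>r. ((-1) ^ Suc k * of_nat (Suc r choose Suc k)) *\<^sub>C t (Suc k)) =
      (\<Sum>k\<le>r. ((-1) ^ Suc k * of_nat (r choose Suc k)) *\<^sub>C t (Suc k)) -
      (\<Sum>k\<le>r. ((-1) ^ k * of_nat (r choose k)) *\<^sub>C t (Suc k))"
      unfolding sum_subtractf[symmetric] complex_vector.scale_left_diff_distrib[symmetric]
      by (rule sum.cong[OF refl]) (simp add: algebra_simps)
    finally have "S (Suc r) x = N (S r x) - S r (N x)"
      unfolding 1 2 by simp
    also have "\<dots> = \<Phi> (Suc r) x" by (simp add: Suc.IH ad)
    finally show ?case .
  qed
  have "(\<Sum>k\<le>r. ((-1) ^ k / (fact (r - k) * fact k)) *\<^sub>C (N ^^ (r - k)) (\<Phi> 0 ((N ^^ k) x))) =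
    (1 / fact r) *\<^sub>C S r x"
    unfolding S_def complex_vector.scale_sum_right
    by (rule sum.cong[OF refl]) (simp add: scaleC_scaleC binomial_fact)
  then show ?thesis by (simp add: S)
qed

text \<open>The power of the logarithm attached to the term with \<open>N ^^ j\<close> on the left
  and \<open>N ^^ k\<close> on the right depends on \<open>j + k\<close> only. Summing along
  \<open>j + k = r\<close> therefore produces iterated commutators, recorded in \<open>H\<close>,
  which vanish beyond order \<open>K\<close>. Here \<open>d\<close> holds the expansion coefficients
  and \<open>t\<close> is the requested power of the logarithm.\<close>

lemma twisted_sum_regroup:
  fixes F :: "nat \<Rightarrow> nat \<Rightarrow> nat \<Rightarrow> nat \<Rightarrow> 'a::complex_vector"
  assumes F0: "\<And>j k l s. l \<le> t \<Longrightarrow> S \<le> s \<or> J \<le> j \<or> J \<le> k \<Longrightarrow> F j k l s = 0"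
    and reg: "\<And>r l s. l \<le> t \<Longrightarrow>
      (\<Sum>k\<le>r. ((-1) ^ k / (fact (r - k) * fact k)) *\<^sub>C F (r - k) k l s) = (1 / fact r) *\<^sub>C H r l s"
    and H0: "\<And>r l s. r > K \<Longrightarrow> H r l s = 0"
  shows "Sum_any (\<lambda>(j::nat, k::nat). ((-1) ^ k / (fact j * fact k)) *\<^sub>C
      Sum_any (\<lambda>s::nat. \<Sum>l\<le>min (j + k) t. d (j + k) l s *\<^sub>C F j k l s)) =
    (\<Sum>s<S. \<Sum>r\<le>K. \<Sum>l\<le>min r t. (d r l s / fact r) *\<^sub>C H r l s)"
proof -
  define g where "g j k = ((-1) ^ k / (fact j * fact k)) *\<^sub>C (\<Sum>s<S. \<Sum>l\<le>min (j + k) t. d (j + k) l s *\<^sub>C F j k l s)" for j k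
  have inner: "Sum_any (\<lambda>s::nat. \<Sum>l\<le>min (j + k) t. d (j + k) l s *\<^sub>C F j k l s) =
    (\<Sum>s<S. \<Sum>l\<le>min (j + k) t. d (j + k) l s *\<^sub>C F j k l s)" for j k
  proof (rule Sum_any.expand_superset)
    have "(\<Sum>l\<le>min (j + k) t. d (j + k) l s *\<^sub>C F j k l s) = 0" if "S \<le> s" for s
      by (rule sum.neutral) (use F0 that in auto)
    then show "{s. (\<Sum>l\<le>min (j + k) t. d (j + k) l s *\<^sub>C F j k l s) \<noteq> 0} \<subseteq> {..<S}"
      using leI by auto
  qed simp
  have g0: "g j k = 0" if "J \<le> j \<or> J \<le> k" for j k
  proof -
    have "(\<Sum>s<S. \<Sum>l\<le>min (j + k) t. d (j + k) l s *\<^sub>C F j k l s) = 0"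
      by (intro sum.neutral ballI) (use F0 that in auto)
    then show ?thesis unfolding g_def by (rule arg_cong[where f = "scaleC _", THEN trans]) simp
  qed
  \<comment> \<open>Covers the support \<open>j, k < J\<close> as well as all orders
    \<open>r \<le> K\<close>.\<close>
  define R where "R = 2 * J + Suc K"
  have "Sum_any (\<lambda>(j::nat, k::nat). ((-1) ^ k / (fact j * fact k)) *\<^sub>C
      Sum_any (\<lambda>s::nat. \<Sum>l\<le>min (j + k) t. d (j + k) l s *\<^sub>C F j k l s)) = Sum_any (\<lambda>(j, k). g j k)"
    by (simp only: inner g_def)
  also have "\<dots> = (\<Sum>(j,k)\<in>{(j,k). j + k < R}. g j k)"
  proof (rule Sum_any.expand_superset)
    show "finite {(j, k). j + k < R}"
      by (rule finite_subset[of _ "{..<R} \<times> {..<R}"]) auto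
    have "j < J \<and> k < J" if "g j k \<noteq> 0" for j k
      using g0 that leI by blast
    then show "{a. (case a of (j, k) \<Rightarrow> g j k) \<noteq> 0} \<subseteq> {(j, k). j + k < R}"
      by (force simp: R_def)
  qed
  also have "\<dots> = (\<Sum>r<R. \<Sum>i\<le>r. g i (r - i))"
    by (rule sum.triangle_reindex)
  also have "\<dots> = (\<Sum>r<R. \<Sum>k\<le>r. g (r - k) k)"
  proof (rule sum.cong[OF refl])
    fix r
    show "(\<Sum>i\<le>r. g i (r - i)) = (\<Sum>k\<le>r. g (r - k) k)"
      by (rule sum.reindex_bij_witness[of _ "\<lambda>k. r - k" "\<lambda>k. r - k"]) auto
  qed
  also have "\<dots> = (\<Sum>r<R. \<Sum>s<S. \<Sum>l\<le>min r t. (d r l s / fact r) *\<^sub>C H r l s)"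
  proof (rule sum.cong[OF refl])
    fix r
    have "(\<Sum>k\<le>r. g (r - k) k) = (\<Sum>k\<le>r. \<Sum>s<S. \<Sum>l\<le>min r t. d r l s *\<^sub>C
        (((-1) ^ k / (fact (r - k) * fact k)) *\<^sub>C F (r - k) k l s))"
      unfolding g_def complex_vector.scale_sum_right
      by (intro sum.cong refl) (auto simp: scaleC_scaleC mult.commute)
    also have "\<dots> = (\<Sum>s<S. \<Sum>l\<le>min r t. \<Sum>k\<le>r. d r l s *\<^sub>C
        (((-1) ^ k / (fact (r - k) * fact k)) *\<^sub>C F (r - k) k l s))"
      by (subst sum.swap) (intro sum.cong refl sum.swap)
    also have "\<dots> = (\<Sum>s<S. \<Sum>l\<le>min r t. d r l s *\<^sub>C ((1 / fact r) *\<^sub>C H r l s))"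
    proof (intro sum.cong refl)
      fix s l assume "l \<in> {..min r t}"
      then have "(\<Sum>k\<le>r. ((-1) ^ k / (fact (r - k) * fact k)) *\<^sub>C F (r - k) k l s) = (1 / fact r) *\<^sub>C H r l s"
        by (intro reg) simp
      then show "(\<Sum>k\<le>r. d r l s *\<^sub>C (((-1) ^ k / (fact (r - k) * fact k)) *\<^sub>C F (r - k) k l s)) =
          d r l s *\<^sub>C ((1 / fact r) *\<^sub>C H r l s)"
        by (simp only: complex_vector.scale_sum_right[symmetric])
    qed
    finally show "(\<Sum>k\<le>r. g (r - k) k) = (\<Sum>s<S. \<Sum>l\<le>min r t. (d r l s / fact r) *\<^sub>C H r l s)"
      by (simp add: scaleC_scaleC)
  qed
  also have "\<dots> = (\<Sum>r\<le>K. \<Sum>s<S. \<Sum>l\<le>min r t. (d r l s / fact r) *\<^sub>C H r l s)"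
  proof (rule sum.mono_neutral_right)
    show "\<forall>r\<in>{..<R} - {..K}. (\<Sum>s<S. \<Sum>l\<le>min r t. (d r l s / fact r) *\<^sub>C H r l s) = 0"
    proof
      fix r assume "r \<in> {..<R} - {..K}"
      then have "K < r" by simp
      then have "H r l s = 0" for l s by (rule H0)
      then show "(\<Sum>s<S. \<Sum>l\<le>min r t. (d r l s / fact r) *\<^sub>C H r l s) = 0"
        by (simp only: scaleC_zero sum.neutral_const)
    qed
    show "finite {..<R}" by (rule finite_lessThan)
    show "{..K} \<subseteq> {..<R}" unfolding R_def by (rule subsetI) simp
  qed
  also have "\<dots> = (\<Sum>s<S. \<Sum>r\<le>K. \<Sum>l\<le>min r t. (d r l s / fact r) *\<^sub>C H r l s)"
    by (rule sum.swap)
  finally show ?thesis .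
qed

text \<open>Truncation of \<open>\<Psi>\<close> leaves finitely many vectors, on which the inner
  powers of \<open>N\<close> are bounded by \<open>J1\<close>; applying the field gives again
  finitely many vectors, on which the outer powers are bounded by \<open>J2\<close>.\<close>

lemma twisted_product_left_eq:
  assumes N: "clinear N" "locally_nilpotent N"
    and \<Phi>: "\<And>r m p. clinear (\<Phi> r m p)"
    and ad: "\<And>r m p x. N (\<Phi> r m p x) - \<Phi> r m p (N x) = \<Phi> (Suc r) m p x"
    and \<Phi>0: "\<And>r m p x. r > K \<Longrightarrow> \<Phi> r m p x = 0"
    and \<Psi>0: "\<And>s. S \<le> s \<Longrightarrow> \<Psi> (n + of_nat s) q = 0"
  shows "twisted_product_left \<beta> N (\<Phi> 0) \<Psi> m p n q =
    (\<Sum>s<S. \<Sum>r\<le>K. \<Sum>l\<le>min r p.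
      (of_nat (r choose l) * fps_nth (one_minus_powr \<beta> * log_one_minus ^ (r - l)) s / fact r) *\<^sub>C
        \<Phi> r (m + \<beta> - of_nat s) (p - l) (\<Psi> (n + of_nat s) q))"
proof -
  have "finite ((\<lambda>s. \<Psi> (n + of_nat s) q) ` {..<S})" by simp
  then obtain J1 where "\<And>x k. x \<in> (\<lambda>s. \<Psi> (n + of_nat s) q) ` {..<S} \<Longrightarrow> J1 \<le> k \<Longrightarrow> (N ^^ k) x = 0"
    by (rule locally_nilpotent_finite[OF N]) blast
  then have J1: "(N ^^ k) (\<Psi> (n + of_nat s) q) = 0" if "s < S" "J1 \<le> k" for s k
    using that by simp
  have J1': "(N ^^ k) (\<Psi> (n + of_nat s) q) = 0" if "S \<le> s \<or> J1 \<le> k" for s k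
    using that J1[of s k] by (cases "S \<le> s") (auto simp: \<Psi>0 clinear_0[OF clinear_funpow[OF N(1)]])
  let ?x = "\<lambda>k l s. \<Phi> 0 (m + \<beta> - of_nat s) (p - l) ((N ^^ k) (\<Psi> (n + of_nat s) q))"
  let ?A = "(\<lambda>(k, l, s). ?x k l s) ` ({..<J1} \<times> {..p} \<times> {..<S})"
  have "finite ?A" by simp
  then obtain J2 where J2: "\<And>x j. x \<in> ?A \<Longrightarrow> J2 \<le> j \<Longrightarrow> (N ^^ j) x = 0"
    by (rule locally_nilpotent_finite[OF N]) blast
  have J2: "(N ^^ j) (?x k l s) = 0" if "s < S" "k < J1" "l \<le> p" "J2 \<le> j" for s k l j
    by (rule J2) (use that in \<open>auto intro!: image_eqI[where x = "(k, l, s)"]\<close>)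
  have F0: "(N ^^ j) (?x k l s) = 0" if "l \<le> p" "S \<le> s \<or> max J1 J2 \<le> j \<or> max J1 J2 \<le> k" for j k l s
  proof (cases "S \<le> s \<or> J1 \<le> k")
    case True
    then show ?thesis using J1' by (simp add: clinear_0[OF \<Phi>] clinear_0[OF clinear_funpow[OF N(1)]])
  next
    case False
    then show ?thesis using that J2 by auto
  qed
  show ?thesis
    unfolding twisted_product_left_def mult_x1_minus_x2_def
  proof (rule twisted_sum_regroup[where J = "max J1 J2"])
    fix r l s
    show "(\<Sum>k\<le>r. ((-1) ^ k / (fact (r - k) * fact k)) *\<^sub>C (N ^^ (r - k)) (?x k l s)) =
      (1 / fact r) *\<^sub>C \<Phi> r (m + \<beta> - of_nat s) (p - l) (\<Psi> (n + of_nat s) q)"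
      by (rule iterated_commutator[where \<Phi> = "\<lambda>r. \<Phi> r (m + \<beta> - of_nat s) (p - l)", OF N(1) ad])
  qed (use F0 \<Phi>0 in auto)
qed

text \<open>Truncation now comes from the field acting on \<open>v\<close>, so the powers of
  \<open>N\<close> on \<open>v\<close> are bounded first; only then is there one bound for
  \<open>s\<close>, and after it one for the outer powers.\<close>

lemma twisted_right_support:
  assumes N: "clinear N" "locally_nilpotent N"
    and \<Phi>: "\<And>m p. clinear (\<Phi> m p)"
    and trunc: "\<And>x. \<exists>S. \<forall>s\<ge>S. \<Phi> (m + of_nat s) p x = 0"
  obtains S J where "\<And>j k s. S \<le> s \<or> J \<le> j \<or> J \<le> k \<Longrightarrow> (N ^^ j) (\<Phi> (m + of_nat s) p ((N ^^ k) v)) = 0"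
proof -
  obtain J1 where J1: "\<And>k. J1 \<le> k \<Longrightarrow> (N ^^ k) v = 0"
    using locally_nilpotent_finite[OF N, of "{v}"] by (metis finite.emptyI finite_insert singletonI)
  obtain S' where S': "\<And>x s. S' x \<le> s \<Longrightarrow> \<Phi> (m + of_nat s) p x = 0"
    using trunc by metis
  define S where "S = Max (insert 0 ((\<lambda>k. S' ((N ^^ k) v)) ` {..<J1}))"
  have S: "\<Phi> (m + of_nat s) p ((N ^^ k) v) = 0" if "S \<le> s" for s k
  proof (cases "k < J1")
    case True
    then have "S' ((N ^^ k) v) \<le> S" unfolding S_def by (intro Max_ge) auto
    then show ?thesis using S' that by simp
  qed (simp add: J1 clinear_0[OF \<Phi>])
  let ?A = "(\<lambda>(k, s). \<Phi> (m + of_nat s) p ((N ^^ k) v)) ` ({..<J1} \<times> {..<S})"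
  have "finite ?A" by simp
  then obtain J2 where J2: "\<And>x j. x \<in> ?A \<Longrightarrow> J2 \<le> j \<Longrightarrow> (N ^^ j) x = 0"
    by (rule locally_nilpotent_finite[OF N]) blast
  have J2: "(N ^^ j) (\<Phi> (m + of_nat s) p ((N ^^ k) v)) = 0" if "s < S" "k < J1" "J2 \<le> j" for s k j
    by (rule J2) (use that in \<open>auto intro!: image_eqI[where x = "(k, s)"]\<close>)
  show ?thesis
  proof (rule that[of S "max J1 J2"])
    fix j k s assume *: "S \<le> s \<or> max J1 J2 \<le> j \<or> max J1 J2 \<le> k"
    show "(N ^^ j) (\<Phi> (m + of_nat s) p ((N ^^ k) v)) = 0"
    proof (cases "S \<le> s \<or> J1 \<le> k")
      case True
      then show ?thesis using S J1 by (auto simp: clinear_0[OF \<Phi>] clinear_0[OF clinear_funpow[OF N(1)]])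
    next
      case False
      then show ?thesis using * J2 by auto
    qed
  qed
qed

lemma twisted_product_right_eq:
  assumes N: "clinear N" "locally_nilpotent N"
    and \<Phi>: "\<And>r m p. clinear (\<Phi> r m p)" and \<Psi>: "\<And>n q. clinear (\<Psi> n q)"
    and ad: "\<And>r m p x. N (\<Phi> r m p x) - \<Phi> r m p (N x) = \<Phi> (Suc r) m p x"
    and \<Phi>0: "\<And>r m p x. r > K \<Longrightarrow> \<Phi> r m p x = 0"
    and trunc: "\<And>x. \<exists>S. \<forall>s\<ge>S. \<Phi> 0 (m + of_nat s) p x = 0"
  obtains S0 where "\<And>S. S0 \<le> S \<Longrightarrow> twisted_product_right \<beta> N (\<Phi> 0) \<Psi> v m p n q =
    (\<Sum>s<S. \<Sum>r\<le>K. \<Sum>l\<le>min r q.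
      (exp (of_real pi * \<i> * \<beta>) * of_nat (r choose l) *
        fps_nth (one_minus_powr \<beta> * (fps_const (of_real pi * \<i>) + log_one_minus) ^ (r - l)) s / fact r) *\<^sub>C
        \<Psi> (n + \<beta> - of_nat s) (q - l) (\<Phi> r (m + of_nat s) p v))"
proof -
  obtain S0 J where *: "\<And>j k s. S0 \<le> s \<or> J \<le> j \<or> J \<le> k \<Longrightarrow> (N ^^ j) (\<Phi> 0 (m + of_nat s) p ((N ^^ k) v)) = 0"
    using twisted_right_support[where \<Phi> = "\<Phi> 0" and m = m and p = p and v = v, OF N \<Phi> trunc] by blast
  show ?thesis
  proof (rule that[of S0])
    fix S assume "S0 \<le> S"
    with * have *: "\<And>j k s. S \<le> s \<or> J \<le> j \<or> J \<le> k \<Longrightarrow> (N ^^ j) (\<Phi> 0 (m + of_nat s) p ((N ^^ k) v)) = 0"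
      by force
    show "twisted_product_right \<beta> N (\<Phi> 0) \<Psi> v m p n q =
    (\<Sum>s<S. \<Sum>r\<le>K. \<Sum>l\<le>min r q.
      (exp (of_real pi * \<i> * \<beta>) * of_nat (r choose l) *
        fps_nth (one_minus_powr \<beta> * (fps_const (of_real pi * \<i>) + log_one_minus) ^ (r - l)) s / fact r) *\<^sub>C
        \<Psi> (n + \<beta> - of_nat s) (q - l) (\<Phi> r (m + of_nat s) p v))"
      unfolding twisted_product_right_def mult_minus_x2_plus_x1_def
    proof (rule twisted_sum_regroup[where J = J])
      fix r l s
      have "(\<Sum>k\<le>r. ((-1) ^ k / (fact (r - k) * fact k)) *\<^sub>C \<Psi> (n + \<beta> - of_nat s) (q - l)
          ((N ^^ (r - k)) (\<Phi> 0 (m + of_nat s) p ((N ^^ k) v)))) =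
        \<Psi> (n + \<beta> - of_nat s) (q - l) (\<Sum>k\<le>r. ((-1) ^ k / (fact (r - k) * fact k)) *\<^sub>C
          (N ^^ (r - k)) (\<Phi> 0 (m + of_nat s) p ((N ^^ k) v)))"
        by (simp only: clinear_sum[OF \<Psi>] clinear_scale[OF \<Psi>])
      also have "\<dots> = (1 / fact r) *\<^sub>C \<Psi> (n + \<beta> - of_nat s) (q - l) (\<Phi> r (m + of_nat s) p v)"
        by (subst iterated_commutator[where \<Phi> = "\<lambda>r. \<Phi> r (m + of_nat s) p", OF N(1) ad]) (rule clinear_scale[OF \<Psi>])
      finally show "(\<Sum>k\<le>r. ((-1) ^ k / (fact (r - k) * fact k)) *\<^sub>C \<Psi> (n + \<beta> - of_nat s) (q - l)
          ((N ^^ (r - k)) (\<Phi> 0 (m + of_nat s) p ((N ^^ k) v)))) =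
        (1 / fact r) *\<^sub>C \<Psi> (n + \<beta> - of_nat s) (q - l) (\<Phi> r (m + of_nat s) p v)" .
    qed (auto simp: * clinear_0[OF \<Psi>] \<Phi>0)
  qed
qed

lemma clinear_Sum_any:
  assumes "clinear f" "finite {x. g x \<noteq> 0}"
  shows "f (Sum_any g) = Sum_any (\<lambda>x. f (g x))"
proof -
  have "Sum_any (\<lambda>x. f (g x)) = (\<Sum>x | g x \<noteq> 0. f (g x))"
    by (rule Sum_any.expand_superset) (use assms in \<open>auto simp: clinear_0\<close>)
  then show ?thesis
    by (simp add: Sum_any.expand_set clinear_sum[OF assms(1)])
qed

text \<open>Serves to push the projection onto the quotient through the sum. \<open>\<Psi>\<close>
  is only required to kill zero, since in the free space \<open>psi_hat\<close> is not linear in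
  \<open>v\<close>.\<close>

lemma twisted_product_right_image:
  assumes N: "clinear N" "locally_nilpotent N"
    and \<Phi>: "\<And>m p. clinear (\<Phi> m p)"
    and trunc: "\<And>x. \<exists>S. \<forall>s\<ge>S. \<Phi> (m + of_nat s) p x = 0"
    and \<Psi>: "\<And>n q. \<Psi> n q 0 = 0" and f: "clinear f"
  shows "f (twisted_product_right \<beta> N \<Phi> \<Psi> v m p n q) =
    twisted_product_right \<beta> N \<Phi> (\<lambda>n q x. f (\<Psi> n q x)) v m p n q"
proof -
  obtain S J where *: "\<And>j k s. S \<le> s \<or> J \<le> j \<or> J \<le> k \<Longrightarrow> (N ^^ j) (\<Phi> (m + of_nat s) p ((N ^^ k) v)) = 0"
    using twisted_right_support[where \<Phi> = \<Phi> and m = m and p = p and v = v, OF N \<Phi> trunc] by blast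
  define d where "d j k l s = exp (of_real pi * \<i> * \<beta>) * of_nat (j + k choose l) *
        fps_nth (one_minus_powr \<beta> * (fps_const (of_real pi * \<i>) + log_one_minus) ^ (j + k - l)) s" for j k l s
  define h where "h j k s = (\<Sum>l\<le>min (j + k) q. d j k l s *\<^sub>C
      \<Psi> (n + \<beta> - of_nat s) (q - l) ((N ^^ j) (\<Phi> (m + of_nat s) p ((N ^^ k) v))))" for j k s
  have h0: "h j k s = 0" if "S \<le> s \<or> J \<le> j \<or> J \<le> k" for j k s
    by (simp add: h_def *[OF that] \<Psi>)
  have fin1: "finite {s. h j k s \<noteq> 0}" for j k
    by (rule finite_subset[of _ "{..<S}"]) (use h0 in \<open>force simp: not_less[symmetric]\<close>, simp)
  have fin2: "finite {x. (case x of (j, k) \<Rightarrow> ((-1) ^ k / (fact j * fact k)) *\<^sub>C Sum_any (h j k)) \<noteq> 0}"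
  proof (rule finite_subset)
    have "Sum_any (h j k) = 0" if "J \<le> j \<or> J \<le> k" for j k
      using h0 that by (simp add: Sum_any.neutral)
    then show "{x. (case x of (j, k) \<Rightarrow> ((-1) ^ k / (fact j * fact k)) *\<^sub>C Sum_any (h j k)) \<noteq> 0} \<subseteq> {..<J} \<times> {..<J}"
      by (force simp: not_less[symmetric])
  qed simp
  have "twisted_product_right \<beta> N \<Phi> \<Psi> v m p n q =
      Sum_any (\<lambda>(j, k). ((-1) ^ k / (fact j * fact k)) *\<^sub>C Sum_any (h j k))"
    by (simp add: twisted_product_right_def mult_minus_x2_plus_x1_def h_def[abs_def] d_def)
  then have "f (twisted_product_right \<beta> N \<Phi> \<Psi> v m p n q) =
      Sum_any (\<lambda>x. f (case x of (j, k) \<Rightarrow> ((-1) ^ k / (fact j * fact k)) *\<^sub>C Sum_any (h j k)))"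
    by (simp only: clinear_Sum_any[OF f fin2])
  also have "\<dots> = Sum_any (\<lambda>(j, k). ((-1) ^ k / (fact j * fact k)) *\<^sub>C Sum_any (\<lambda>s. f (h j k s)))"
    by (simp add: case_prod_unfold clinear_scale[OF f] clinear_Sum_any[OF f fin1])
  also have "\<dots> = twisted_product_right \<beta> N \<Phi> (\<lambda>n q x. f (\<Psi> n q x)) v m p n q"
    by (simp add: twisted_product_right_def mult_minus_x2_plus_x1_def h_def d_def
        clinear_sum[OF f] clinear_scale[OF f])
  finally show ?thesis .
qed

section \<open>The automorphism and its nilpotent part\<close>

lemma e2pi_add: "e2pi (a + b) = e2pi a * e2pi b"
  by (simp add: e2pi_def distrib_left exp_add)

lemma e2pi_nonzero [simp]: "e2pi a \<noteq> 0"
  by (simp add: e2pi_def)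

lemma e2pi_of_int [simp]: "e2pi (of_int n) = 1"
  using exp_integer_2pi[of "of_int n"] by (simp add: e2pi_def mult_ac)

lemma e2pi_eq_iff: "e2pi a = e2pi b \<longleftrightarrow> a - b \<in> \<int>"
proof
  assume "e2pi a = e2pi b"
  then obtain n :: int where "2 * of_real pi * \<i> * a = 2 * of_real pi * \<i> * b + (of_int (2 * n) * pi) * \<i>"
    unfolding e2pi_def exp_eq by blast
  then have "(2 * of_real pi * \<i>) * (a - b - of_int n) = 0"
    by (simp add: algebra_simps)
  then have "a - b = of_int n" by simp
  then show "a - b \<in> \<int>" by simp
next
  assume "a - b \<in> \<int>"
  then obtain n where "a = b + of_int n" by (elim Ints_cases) (simp add: algebra_simps)
  then show "e2pi a = e2pi b" by (simp add: e2pi_add)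
qed

lemma strip_representative:
  assumes "c \<noteq> 0"
  obtains \<alpha> where "\<alpha> \<in> strip" "e2pi \<alpha> = c"
proof -
  obtain w where w: "exp w = c" using assms exp_Ln by metis
  define a where "a = w / (2 * of_real pi * \<i>)"
  have a: "e2pi a = c" by (simp add: e2pi_def a_def w)
  have "e2pi (a - of_int \<lfloor>Re a\<rfloor>) = e2pi a"
    unfolding e2pi_eq_iff by simp
  with a show ?thesis
    by (intro that[of "a - of_int \<lfloor>Re a\<rfloor>"]) (auto simp: strip_def, linarith)
qed

lemma g_actionD:
  assumes "g_action G"
  shows "clinear (gop G)" "clinear (gS G)" "clinear (gN G)" "graded strip (gspace G)"
    "locally_nilpotent (gN G)"
  using assms by (simp_all add: g_action_def)

lemma gop_eq_exp:
  assumes "g_action G" "\<alpha> \<in> strip" "x \<in> gspace G \<alpha>"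
  shows "gop G x = e2pi \<alpha> *\<^sub>C exp_nilpotent (2 * of_real pi * \<i>) (gN G) x"
    and "gN G x \<in> gspace G \<alpha>"
  using assms by (simp_all add: g_action_def)

text \<open>On generalized eigenspaces \<open>g\<close> is a scalar times the unipotent part, and
  the scalars cancel because \<open>B u v\<close> belongs to the product of the two eigenvalues. The
  exponent \<open>\<gamma>\<close> is chosen in the strip and need not be the sum of the given ones,
  but only \<open>e2pi \<gamma>\<close> enters. Linearity in each argument does the rest.\<close>

lemma exp_nilpotent_gN_bilinear:
  fixes B :: "'a::complex_vector \<Rightarrow> 'b::complex_vector \<Rightarrow> 'c::complex_vector"
  assumes G1: "g_action G1" and G2: "g_action G2" and G3: "g_action G3"
    and B1: "\<And>v. clinear (\<lambda>u. B u v)" and B2: "\<And>u. clinear (B u)"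
    and hom: "\<And>u v. gop G3 (B u v) = B (gop G1 u) (gop G2 v)"
  shows "exp_nilpotent (2 * of_real pi * \<i>) (gN G3) (B u v) =
    B (exp_nilpotent (2 * of_real pi * \<i>) (gN G1) u) (exp_nilpotent (2 * of_real pi * \<i>) (gN G2) v)"
proof -
  let ?c = "2 * of_real pi * \<i>"
  define E1 E2 E3 where "E1 = exp_nilpotent ?c (gN G1)" and "E2 = exp_nilpotent ?c (gN G2)"
    and "E3 = exp_nilpotent ?c (gN G3)"
  have lE: "clinear E1" "clinear E2" "clinear E3"
    unfolding E1_def E2_def E3_def by (intro clinear_exp_nilpotent g_actionD G1 G2 G3)+
  have *: "E3 (B u v) = B (E1 u) (E2 v)" if a: "\<alpha> \<in> strip" "u \<in> gspace G1 \<alpha>"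
    and b: "\<beta> \<in> strip" "v \<in> gspace G2 \<beta>" for u v \<alpha> \<beta>
  proof -
    have "e2pi \<alpha> * e2pi \<beta> \<noteq> 0" by simp
    then obtain \<gamma> where g: "\<gamma> \<in> strip" "e2pi \<gamma> = e2pi \<alpha> * e2pi \<beta>" by (rule strip_representative)
    have "B u v \<in> gspace G3 \<gamma>"
      unfolding gspace_def g(2)
      by (rule gen_eigenspace_bilinear[where B = B, OF g_actionD(1)[OF G1] g_actionD(1)[OF G2] g_actionD(1)[OF G3] B1 B2 hom])
        (use a b in \<open>simp_all add: gspace_def\<close>)
    then have "e2pi \<gamma> *\<^sub>C E3 (B u v) = gop G3 (B u v)"
      by (simp add: gop_eq_exp[OF G3 g(1)] E3_def)
    also have "\<dots> = e2pi \<gamma> *\<^sub>C B (E1 u) (E2 v)"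
      by (simp add: hom gop_eq_exp[OF G1 a] gop_eq_exp[OF G2 b] E1_def E2_def clinear_scale[OF B1]
          clinear_scale[OF B2] scaleC_scaleC g(2))
    finally show ?thesis by simp
  qed
  have **: "E3 (B u v) = B (E1 u) (E2 v)" if a: "\<alpha> \<in> strip" "u \<in> gspace G1 \<alpha>" for u v \<alpha>
  proof -
    have "v \<in> cspan (\<Union>\<beta>\<in>strip. gspace G2 \<beta>)" by (rule graded_span_UNIV[OF g_actionD(4)[OF G2]])
    then have "E3 (B u v) - B (E1 u) (E2 v) \<in> {0}"
      by (rule clinear_span_image[where f = "\<lambda>v. E3 (B u v) - B (E1 u) (E2 v)", rotated])
        (use *[OF a] in \<open>auto intro!: clinearI simp: complex_vector.subspace_def clinear_add[OF lE(3)]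
          clinear_add[OF lE(2)] clinear_add[OF B2] clinear_scale[OF lE(3)]
          clinear_scale[OF lE(2)] clinear_scale[OF B2] complex_vector.scale_right_diff_distrib\<close>)
    then show ?thesis by simp
  qed
  have "u \<in> cspan (\<Union>\<alpha>\<in>strip. gspace G1 \<alpha>)" by (rule graded_span_UNIV[OF g_actionD(4)[OF G1]])
  then have "E3 (B u v) - B (E1 u) (E2 v) \<in> {0}"
    by (rule clinear_span_image[where f = "\<lambda>u. E3 (B u v) - B (E1 u) (E2 v)", rotated])
      (use ** in \<open>auto intro!: clinearI simp: complex_vector.subspace_def clinear_add[OF lE(3)]
          clinear_add[OF lE(1)] clinear_add[OF B1] clinear_scale[OF lE(3)]
          clinear_scale[OF lE(1)] clinear_scale[OF B1] complex_vector.scale_right_diff_distrib\<close>)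
  then show ?thesis by (simp add: E1_def E2_def E3_def)
qed

lemma gN_bilinear_derivation:
  fixes B :: "'a::complex_vector \<Rightarrow> 'b::complex_vector \<Rightarrow> 'c::complex_vector"
  assumes G: "g_action G1" "g_action G2" "g_action G3"
    and B: "\<And>v. clinear (\<lambda>u. B u v)" "\<And>u. clinear (B u)"
    and hom: "\<And>u v. gop G3 (B u v) = B (gop G1 u) (gop G2 v)"
  shows "gN G3 (B u v) = B (gN G1 u) v + B u (gN G2 v)"
  by (rule exp_nilpotent_hom_imp_derivation[where B = B, OF _ _ _ _ _ _ _ B exp_nilpotent_gN_bilinear[OF G B hom]])
    (simp_all add: g_actionD G)

lemma vertex_superalgebraD:
  assumes "vertex_superalgebra V"
  shows "graded ({n. 2 * n \<in> \<int>} \<times> UNIV) (\<lambda>(n, s). vgr V n s)"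
    and "vac V \<in> vgr V 0 False"
    and "\<forall>n v. clinear (vY V v n) \<and> clinear (\<lambda>u. vY V u n v)"
    and "\<forall>u v. \<exists>N. \<forall>n\<ge>N. vY V u n v = 0"
    and "clinear (vL0 V)" and "clinear (vLm1 V)"
    and "\<forall>n. 2 * n \<in> \<int> \<longrightarrow> (\<forall>v\<in>vwt V n. vL0 V v = of_real n *\<^sub>C v)"
    and "\<forall>n v. vY V (vac V) n v = (if n = -1 then v else 0)"
    and "\<forall>v. vY V v (-1) (vac V) = v \<and> (\<forall>n\<ge>0. vY V v n (vac V) = 0)"
    and "\<forall>v n w. vL0 V (vY V v n w) - vY V v n (vL0 V w) =
       of_int (- n - 1) *\<^sub>C vY V v n w + vY V (vL0 V v) n w"
    and "\<forall>v n w. vY V (vLm1 V v) n w = of_int (- n) *\<^sub>C vY V v (n - 1) w \<and>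
       vLm1 V (vY V v n w) - vY V v n (vLm1 V w) = of_int (- n) *\<^sub>C vY V v (n - 1) w"
    and "\<forall>s t n. \<forall>u\<in>vfer V s. \<forall>v\<in>vfer V t. vY V u n v \<in> vfer V (s \<noteq> t)"
  using assms unfolding vertex_superalgebra_def by - (elim conjE, assumption)+

lemma vsa_automorphismD:
  assumes "vsa_automorphism V G"
  shows "g_action G" and "\<And>n s. 2 * n \<in> \<int> \<Longrightarrow> gop G ` vgr V n s = vgr V n s"
    and "gop G (vac V) = vac V" and "\<And>u n v. gop G (vY V u n v) = vY V (gop G u) n (gop G v)"
  using assms by (simp_all add: vsa_automorphism_def)

lemma vsa_Lm1_vac:
  assumes V: "vertex_superalgebra V"
  shows "vLm1 V (vac V) = 0"
proof -
  have "vLm1 V (vac V) = vY V (vLm1 V (vac V)) (-1) (vac V)"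
    using vertex_superalgebraD(9)[OF V] by simp
  also have "\<dots> = vY V (vac V) (-2) (vac V)"
    using vertex_superalgebraD(11)[OF V] by (simp add: scaleC_one)
  also have "\<dots> = 0"
    using vertex_superalgebraD(8)[OF V] by simp
  finally show ?thesis .
qed

lemma gN_vac:
  assumes A: "vsa_automorphism V G"
  shows "gN G (vac V) = 0"
proof -
  note g = vsa_automorphismD(1)[OF A]
  have e: "e2pi 0 = 1" using e2pi_of_int[of 0] by simp
  have "vac V \<in> gspace G 0"
    unfolding gspace_def
    by (rule gen_eigenspaceI[where k = 1]) (simp add: vsa_automorphismD(3)[OF A] e scaleC_one)
  then have "exp_nilpotent (2 * of_real pi * \<i>) (gN G) (vac V) = vac V"
    using gop_eq_exp(1)[OF g, of 0 "vac V"] by (simp add: strip_def e scaleC_one vsa_automorphismD(3)[OF A])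
  then show ?thesis
    by (rule exp_nilpotent_eq_self_imp_0[OF g_actionD(3,5)[OF g], rotated]) simp
qed

lemma gN_vY:
  assumes V: "vertex_superalgebra V" and A: "vsa_automorphism V G"
  shows "gN G (vY V u n v) = vY V (gN G u) n v + vY V u n (gN G v)"
  using vertex_superalgebraD(3)[OF V]
  by (intro gN_bilinear_derivation vsa_automorphismD[OF A]) auto

lemma gspace_vY:
  assumes V: "vertex_superalgebra V" and A: "vsa_automorphism V G"
    and u: "u \<in> gen_eigenspace (gop G) a" and v: "v \<in> gen_eigenspace (gop G) b"
  shows "vY V u n v \<in> gen_eigenspace (gop G) (a * b)"
proof -
  note g = g_actionD(1)[OF vsa_automorphismD(1)[OF A]]
  show ?thesis
    by (rule gen_eigenspace_bilinear[where B = "\<lambda>u v. vY V u n v", OF g g g _ _ vsa_automorphismD(4)[OF A] u v])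
      (use vertex_superalgebraD(3)[OF V] in auto)
qed

text \<open>The index of the field \<open>(ad \<N>\<^sub>g)^r \<phi>^i\<close>, undefined as soon as
  one step is.\<close>

definition nidx_pow :: "('i, 'v) gen_fields \<Rightarrow> nat \<Rightarrow> 'i \<Rightarrow> 'i option"
  where "nidx_pow F r i = ((\<lambda>j. Option.bind j (nidx F)) ^^ r) (Some i)"

lemma nidx_pow_0 [simp]: "nidx_pow F 0 i = Some i"
  and nidx_pow_Suc [simp]: "nidx_pow F (Suc r) i = Option.bind (nidx_pow F r i) (nidx F)"
  by (simp_all add: nidx_pow_def)

lemma generating_fieldsD:
  assumes "generating_fields V G F"
  shows "cspan {foldr (\<lambda>(i, m). vY V (phi F i) m) xs (vac V) | xs. \<forall>(i, m)\<in>set xs. i \<in> idx F} = UNIV"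
    and "\<And>i. i \<in> idx F \<Longrightarrow> 2 * fwt F i \<in> \<int> \<and> phi F i \<in> vgr V (fwt F i) (ffer F i)"
    and "\<And>i. i \<in> idx F \<Longrightarrow> falpha F i \<in> g_exponents G \<and> phi F i \<in> gspace G (falpha F i)"
    and "\<And>i. i \<in> idx F \<Longrightarrow> nidx F i = None \<Longrightarrow> gN G (phi F i) = 0"
    and "\<And>i j. i \<in> idx F \<Longrightarrow> nidx F i = Some j \<Longrightarrow> j \<in> idx F \<and> gN G (phi F i) \<noteq> 0 \<and> gN G (phi F i) = phi F j"
    and "\<And>i. i \<in> idx F \<Longrightarrow> (gN G ^^ (fK F i + 1)) (phi F i) = 0"
  using assms unfolding generating_fields_def by (auto split: option.splits)

text \<open>The clause for \<open>r > 0\<close> reflects that an index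
  \<open>\<N>\<^sub>g(i)\<close> is given only when the vector it names is nonzero; so the chain of
  indices ends when the vectors do, which bounds its length by \<open>fK F i\<close>.\<close>

lemma nidx_pow_cases:
  assumes gen: "generating_fields V G F" and A: "g_action G" and i: "i \<in> idx F"
  shows "case nidx_pow F r i of None \<Rightarrow> (gN G ^^ r) (phi F i) = 0
    | Some j \<Rightarrow> j \<in> idx F \<and> phi F j = (gN G ^^ r) (phi F i) \<and> (r > 0 \<longrightarrow> phi F j \<noteq> 0)"
proof (induction r)
  case 0
  show ?case using i by simp
next
  case (Suc r)
  show ?case
  proof (cases "nidx_pow F r i")
    case None
    then show ?thesis using Suc by (simp add: clinear_0[OF g_actionD(3)[OF A]])
  next
    case (Some j)
    then have j: "j \<in> idx F" "phi F j = (gN G ^^ r) (phi F i)" using Suc by auto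
    show ?thesis
      using generating_fieldsD(4)[OF gen j(1)] generating_fieldsD(5)[OF gen j(1)]
      by (cases "nidx F j") (auto simp: Some simp flip: j(2))
  qed
qed

lemma nidx_pow_eq_None:
  assumes gen: "generating_fields V G F" and A: "g_action G" and i: "i \<in> idx F" and r: "r > fK F i"
  shows "nidx_pow F r i = None"
proof -
  have "(gN G ^^ r) (phi F i) = 0"
    by (rule funpow_zero_mono[OF g_actionD(3)[OF A] generating_fieldsD(6)[OF gen i]]) (use r in simp)
  then show ?thesis
    using nidx_pow_cases[OF gen A i, of r] r by (auto split: option.splits)
qed

section \<open>Spanning by products of generating fields\<close>

text \<open>
  Finite forms of the two sides of Property 7 applied to \<open>v\<close>. They involve
  \<open>(ad \<N>\<^sub>g)\<^sup>r \<phi>\<^sup>i\<close> instead of products with powers of \<open>\<N>\<^sub>g\<close> on both sides of \<open>\<phi>\<^sup>i\<close>, and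
  the exponent of the binomial expansion is cut off at \<open>S\<close>.
\<close>
definition phi_psi_left ::
  "('i, 'v) gen_fields \<Rightarrow> ('i \<Rightarrow> ('w::complex_vector \<Rightarrow> 'w) logseries) \<Rightarrow> 'i \<Rightarrow> complex \<Rightarrow> nat \<Rightarrow>
    'w logseries \<Rightarrow> 'w logseries2"
  where "phi_psi_left F \<phi> i \<beta> S \<Psi> m p n q = (\<Sum>s<S. \<Sum>r\<le>fK F i. \<Sum>l\<le>min r p.
      (of_nat (r choose l) * fps_nth (one_minus_powr \<beta> * log_one_minus ^ (r - l)) s / fact r) *\<^sub>C
        at_idx \<phi> (nidx_pow F r i) (m + \<beta> - of_nat s) (p - l) (\<Psi> (n + of_nat s) q))"

definition phi_psi_right ::
  "'v::complex_vector vsa \<Rightarrow> 'v g_act \<Rightarrow> ('i, 'v) gen_fields \<Rightarrow> 'i \<Rightarrow> complex \<Rightarrow> nat \<Rightarrow>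
    ('v \<Rightarrow> 'w::complex_vector) logseries \<Rightarrow> 'v \<Rightarrow> 'w logseries2"
  where "phi_psi_right V G F i \<beta> S \<psi> v m p n q = (\<Sum>s<S. \<Sum>r\<le>fK F i. \<Sum>l\<le>min r q.
      (exp (of_real pi * \<i> * \<beta>) * of_nat (r choose l) *
        fps_nth (one_minus_powr \<beta> * (fps_const (of_real pi * \<i>) + log_one_minus) ^ (r - l)) s / fact r) *\<^sub>C
        \<psi> (n + \<beta> - of_nat s) (q - l) (vfield V ((gN G ^^ r) (phi F i)) (m + of_nat s) p v))"

lemma one_minus_powr_nth_0 [simp]: "fps_nth (one_minus_powr \<beta>) 0 = 1"
  by (simp add: one_minus_powr_def)

lemma vfield_int [simp]: "vfield V u (of_int m + of_nat s) 0 v = vY V u (m + int s) v"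
proof -
  have "(of_int m + of_nat s :: complex) = of_int (m + int s)" by simp
  then show ?thesis unfolding vfield_def by (simp only:) simp
qed

lemma sum_in_subspace_cancel:
  assumes X: "csubspace X" and t: "x + y \<in> X" "y \<in> X"
  shows "x \<in> X"
  using complex_vector.subspace_diff[OF X t] by simp

text \<open>Two nested inductions remove the unwanted terms of the right side: the outer one, on the
  nilpotency order \<open>d\<close> of the field vector, those with \<open>r \<ge> 1\<close>; the
  inner one, downwards in the mode \<open>m\<close> from the truncation bound \<open>M\<close>,
  those with \<open>s \<ge> 1\<close>. The left side is in \<open>T\<close> since it applies fields
  to coefficients of \<open>\<psi>\<close> on \<open>v\<close> itself.\<close>

lemma psi_vY_mem:
  assumes V: "vertex_superalgebra V" and A: "g_action G" and gen: "generating_fields V G F"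
    and T: "csubspace T"
    and \<phi>: "\<And>j n k x. j \<in> idx F \<Longrightarrow> x \<in> T \<Longrightarrow> \<phi> j n k x \<in> T"
    and \<psi>: "\<And>n q. clinear (\<psi> n q)"
    and loc: "\<And>i. i \<in> idx F \<Longrightarrow> \<exists>\<beta> \<kappa>. \<kappa> \<noteq> 0 \<and> (\<forall>m p n q. \<exists>S0. \<forall>S\<ge>S0.
      phi_psi_left F \<phi> i \<beta> S (\<lambda>n q. \<psi> n q v) m p n q = \<kappa> *\<^sub>C phi_psi_right V G F i \<beta> S \<psi> v m p n q)"
    and v: "\<And>n q. \<psi> n q v \<in> T"
    and i: "i \<in> idx F"
  shows "\<psi> n q (vY V (phi F i) m v) \<in> T"
proof -
  note N = g_actionD(3)[OF A]
  have Y1: "clinear (\<lambda>u. vY V u m v)" for m v using vertex_superalgebraD(3)[OF V] by blast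
  have "\<forall>m n q. \<psi> n q (vY V (phi F i) m v) \<in> T" if "(gN G ^^ d) (phi F i) = 0" "i \<in> idx F" for d i
    using that
  proof (induction d arbitrary: i)
    case 0
    then show ?case
      by (simp add: clinear_0[OF Y1] clinear_0[OF \<psi>] complex_vector.subspace_0[OF T])
  next
    case (Suc d)
    \<comment> \<open>The vectors \<open>\<N>\<^sub>g^(r+1) \<phi>^i\<close> are zero or again
      generating vectors, of smaller nilpotency order.\<close>
    have higher: "\<psi> n q (vY V ((gN G ^^ Suc r) (phi F i)) m v) \<in> T" for r m n q
    proof (cases "nidx_pow F (Suc r) i")
      case None
      then have "(gN G ^^ Suc r) (phi F i) = 0"
        using nidx_pow_cases[OF gen A Suc.prems(2), of "Suc r"] by simp
      then show ?thesis
        by (simp only: clinear_0[OF Y1] clinear_0[OF \<psi>] complex_vector.subspace_0[OF T])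
    next
      case (Some j)
      then have j: "j \<in> idx F" "phi F j = (gN G ^^ Suc r) (phi F i)"
        using nidx_pow_cases[OF gen A Suc.prems(2), of "Suc r"] by simp_all
      have "(gN G ^^ d) (phi F j) = (gN G ^^ (d + Suc r)) (phi F i)"
        by (simp only: j(2) funpow_add o_apply)
      also have "\<dots> = 0"
        by (rule funpow_zero_mono[OF N Suc.prems(1)]) simp
      finally show ?thesis using Suc.IH j by metis
    qed
    obtain \<beta> \<kappa> where \<kappa>: "\<kappa> \<noteq> 0" and rel: "\<And>m p n q. \<exists>S0. \<forall>S\<ge>S0.
      phi_psi_left F \<phi> i \<beta> S (\<lambda>n q. \<psi> n q v) m p n q = \<kappa> *\<^sub>C phi_psi_right V G F i \<beta> S \<psi> v m p n q"
      using loc[OF Suc.prems(2)] by blast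
    obtain M where M: "\<And>m. m \<ge> M \<Longrightarrow> vY V (phi F i) m v = 0"
      using vertex_superalgebraD(4)[OF V] by blast
    have "\<forall>n q. \<psi> n q (vY V (phi F i) m v) \<in> T" for m
    proof (induction "nat (M - m)" arbitrary: m rule: less_induct)
      case less
      have IH: "\<psi> n q (vY V (phi F i) (m + int (Suc s)) v) \<in> T" for n q s
      proof (cases "m < M")
        case True
        then show ?thesis using less[of "m + int (Suc s)"] by simp
      next
        case False
        then show ?thesis
          using M[of "m + int (Suc s)"] by (simp add: clinear_0[OF \<psi>] complex_vector.subspace_0[OF T])
      qed
      show ?case
      proof (intro allI)
        fix n q
        \<comment> \<open>These indices make the term with \<open>s = r = 0\<close> a multiple of
          the wanted vector: no logarithm of the first variable, as \<open>vfield\<close> has none,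
          and \<open>n - \<beta>\<close> to offset the shift by \<open>\<beta>\<close> in
          \<open>phi_psi_right\<close>.\<close>
        obtain S0 where "\<forall>S\<ge>S0. phi_psi_left F \<phi> i \<beta> S (\<lambda>n q. \<psi> n q v) (of_int m) 0 (n - \<beta>) q =
            \<kappa> *\<^sub>C phi_psi_right V G F i \<beta> S \<psi> v (of_int m) 0 (n - \<beta>) q"
          using rel by blast
        \<comment> \<open>The cutoff \<open>Suc S0\<close> guarantees that a term with
          \<open>s = 0\<close> is present.\<close>
        then have eq: "phi_psi_left F \<phi> i \<beta> (Suc S0) (\<lambda>n q. \<psi> n q v) (of_int m) 0 (n - \<beta>) q =
            \<kappa> *\<^sub>C phi_psi_right V G F i \<beta> (Suc S0) \<psi> v (of_int m) 0 (n - \<beta>) q"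
          by simp
        have at: "at_idx \<phi> (nidx_pow F r i) n' k x \<in> T" if "x \<in> T" for r n' k x
          using nidx_pow_cases[OF gen A Suc.prems(2), of r] \<phi> that complex_vector.subspace_0[OF T]
          by (auto simp: at_idx_def split: option.splits)
        have "phi_psi_left F \<phi> i \<beta> (Suc S0) (\<lambda>n q. \<psi> n q v) (of_int m) 0 (n - \<beta>) q \<in> T"
          unfolding phi_psi_left_def
          by (intro complex_vector.subspace_sum[OF T] complex_vector.subspace_scale[OF T] at v)
        then have "(1 / \<kappa>) *\<^sub>C (\<kappa> *\<^sub>C phi_psi_right V G F i \<beta> (Suc S0) \<psi> v (of_int m) 0 (n - \<beta>) q) \<in> T"
          unfolding eq by (rule complex_vector.subspace_scale[OF T])
        then have R: "phi_psi_right V G F i \<beta> (Suc S0) \<psi> v (of_int m) 0 (n - \<beta>) q \<in> T"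
          using \<kappa> by (simp add: scaleC_scaleC scaleC_one)
        define t where "t s r = (\<Sum>l\<le>min r q.
          (exp (of_real pi * \<i> * \<beta>) * of_nat (r choose l) *
            fps_nth (one_minus_powr \<beta> * (fps_const (of_real pi * \<i>) + log_one_minus) ^ (r - l)) s / fact r) *\<^sub>C
          \<psi> (n - of_nat s) (q - l) (vY V ((gN G ^^ r) (phi F i)) (m + int s) v))" for s r
        have "phi_psi_right V G F i \<beta> (Suc S0) \<psi> v (of_int m) 0 (n - \<beta>) q = (\<Sum>s<Suc S0. \<Sum>r\<le>fK F i. t s r)"
          by (simp add: phi_psi_right_def t_def)
        also have "\<dots> = (t 0 0 + (\<Sum>r<fK F i. t 0 (Suc r))) + (\<Sum>s<S0. \<Sum>r\<le>fK F i. t (Suc s) r)"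
          by (simp only: sum.lessThan_Suc_shift sum.atMost_shift)
        finally have tot: "t 0 0 + ((\<Sum>r<fK F i. t 0 (Suc r)) + (\<Sum>s<S0. \<Sum>r\<le>fK F i. t (Suc s) r)) \<in> T"
          using R by (simp only: add.assoc)
        have t1: "t s (Suc r) \<in> T" for s r
          unfolding t_def
          by (intro complex_vector.subspace_sum[OF T] complex_vector.subspace_scale[OF T] higher)
        have t2: "t (Suc s) r \<in> T" for s r
        proof (cases r)
          case 0
          show ?thesis
            unfolding t_def 0 using IH
            by (intro complex_vector.subspace_sum[OF T] complex_vector.subspace_scale[OF T]) simp
        qed (simp add: t1)
        have "t 0 0 \<in> T"
          by (rule sum_in_subspace_cancel[OF T tot])
            (intro complex_vector.subspace_add[OF T] complex_vector.subspace_sum[OF T] t1 t2)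
        then have "exp (of_real pi * \<i> * \<beta>) *\<^sub>C \<psi> n q (vY V (phi F i) m v) \<in> T"
          by (simp add: t_def)
        from complex_vector.subspace_scale[OF T this, of "1 / exp (of_real pi * \<i> * \<beta>)"]
        show "\<psi> n q (vY V (phi F i) m v) \<in> T"
          by (simp add: scaleC_scaleC scaleC_one)
      qed
    qed
    then show ?case by blast
  qed
  from this[OF generating_fieldsD(6)[OF gen i] i] show ?thesis by blast
qed

text \<open>Equality is asked for eventually in \<open>S\<close>, since the cutoff that makes both
  finite forms exact varies with \<open>v\<close> and with the coefficient; in this form the
  relation is closed under linear combinations of \<open>v\<close>.\<close>

definition phi_psi_relation ::
  "'v::complex_vector vsa \<Rightarrow> 'v g_act \<Rightarrow> ('i, 'v) gen_fields \<Rightarrow> ('i \<Rightarrow> ('w::complex_vector \<Rightarrow> 'w) logseries) \<Rightarrow>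
    ('v \<Rightarrow> 'w) logseries \<Rightarrow> 'i \<Rightarrow> complex \<Rightarrow> complex \<Rightarrow> 'v \<Rightarrow> bool"
  where "phi_psi_relation V G F \<phi> \<psi> i \<beta> \<kappa> v \<longleftrightarrow> (\<forall>m p n q. \<exists>S0. \<forall>S\<ge>S0.
    phi_psi_left F \<phi> i \<beta> S (\<lambda>n q. \<psi> n q v) m p n q = \<kappa> *\<^sub>C phi_psi_right V G F i \<beta> S \<psi> v m p n q)"

lemma field_product_Nil [simp]: "field_product f [] x = x"
  and field_product_Cons [simp]: "field_product f ((i, n, k) # xs) x = f i n k (field_product f xs x)"
  by (simp_all add: field_product_def)

text \<open>Stated over \<open>\<phi>\<close>, \<open>\<psi>\<close> and \<open>D\<close> (in the
  role of \<open>L\<^sub>W(-1)\<close>) so as to serve both given field data and the quotient. The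
  hypothesis \<open>span\<close> is Property 4; the gain is that \<open>v\<close> is reduced to the
  vacuum and the modes of \<open>\<psi>\<close> to powers of \<open>D\<close>.\<close>

theorem cspan_field_products_eq_UNIV:
  fixes V :: "'v::complex_vector vsa" and \<phi> :: "'i \<Rightarrow> ('w::complex_vector \<Rightarrow> 'w) logseries"
  assumes V: "vertex_superalgebra V" and A: "g_action G" and gen: "generating_fields V G F"
    and \<phi>: "\<And>i n k. i \<in> idx F \<Longrightarrow> clinear (\<phi> i n k)"
    and supp: "\<And>i n k x. i \<in> idx F \<Longrightarrow> \<phi> i n k x \<noteq> 0 \<Longrightarrow> n - falpha F i \<in> \<int> \<and> k \<le> fK F i"
    and \<psi>: "\<And>a n k. a \<in> I \<Longrightarrow> clinear (\<psi> a n k)"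
    and D: "clinear D"
    and vac: "\<And>a n k. a \<in> I \<Longrightarrow> \<psi> a n k (vac V) \<noteq> 0 \<Longrightarrow> k = 0 \<and> (\<exists>m::nat. n = - of_nat m - 1)"
    and D\<psi>: "\<And>a n k. a \<in> I \<Longrightarrow> D (\<psi> a n k (vac V)) = ddx (\<lambda>n k. \<psi> a n k (vac V)) n k"
    and rel: "\<And>i a. i \<in> idx F \<Longrightarrow> a \<in> I \<Longrightarrow> \<exists>\<beta> \<kappa>. \<kappa> \<noteq> 0 \<and> (\<forall>v. phi_psi_relation V G F \<phi> (\<psi> a) i \<beta> \<kappa> v)"
    and span: "cspan {field_product \<phi> xs (\<psi> a n l v) | xs a n l v. (\<forall>(i, n, k)\<in>set xs. i \<in> idx F) \<and> a \<in> I} = UNIV"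
  shows "cspan {field_product \<phi> xs ((D ^^ k) (\<psi> a (-1) 0 (vac V))) | xs k a.
           (\<forall>(i, n, l)\<in>set xs. i \<in> idx F \<and> n - falpha F i \<in> \<int> \<and> l \<le> fK F i) \<and> a \<in> I} = UNIV"
proof -
  let ?S = "{field_product \<phi> xs ((D ^^ k) (\<psi> a (-1) 0 (vac V))) | xs k a.
           (\<forall>(i, n, l)\<in>set xs. i \<in> idx F \<and> n - falpha F i \<in> \<int> \<and> l \<le> fK F i) \<and> a \<in> I}"
  define T where "T = cspan ?S"
  have T: "csubspace T" unfolding T_def by (rule complex_vector.subspace_span)
  have \<phi>T: "\<phi> i n k x \<in> T" if i: "i \<in> idx F" and x: "x \<in> T" for i n k x
  proof (rule clinear_span_image[OF \<phi>[OF i] x[unfolded T_def] T])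
    fix y assume "y \<in> ?S"
    then obtain xs k' a where y: "y = field_product \<phi> xs ((D ^^ k') (\<psi> a (-1) 0 (vac V)))"
      "\<forall>(i, n, l)\<in>set xs. i \<in> idx F \<and> n - falpha F i \<in> \<int> \<and> l \<le> fK F i" "a \<in> I"
      by blast
    show "\<phi> i n k y \<in> T"
    \<comment> \<open>The restrictions on \<open>n\<close> and \<open>k\<close> in the products
      exclude nothing: by \<open>supp\<close> a nonzero value satisfies them.\<close>
    proof (cases "\<phi> i n k y = 0")
      case False
      have "\<phi> i n k y = field_product \<phi> ((i, n, k) # xs) ((D ^^ k') (\<psi> a (-1) 0 (vac V)))"
        by (simp add: y(1))
      moreover have "\<forall>(i, n, l)\<in>set ((i, n, k) # xs). i \<in> idx F \<and> n - falpha F i \<in> \<int> \<and> l \<le> fK F i"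
        using y(2) i supp[OF i False] by simp
      ultimately have "\<phi> i n k y \<in> ?S" using y(3) by blast
      then show ?thesis unfolding T_def by (rule complex_vector.span_base)
    qed (simp add: complex_vector.subspace_0[OF T])
  qed
  have DT: "(D ^^ k) (\<psi> a (-1) 0 (vac V)) \<in> T" if "a \<in> I" for a k
  proof -
    have "(D ^^ k) (\<psi> a (-1) 0 (vac V)) \<in> ?S"
      using that by (intro CollectI exI[of _ "[]"] exI[of _ k] exI[of _ a]) simp
    then show ?thesis unfolding T_def by (rule complex_vector.span_base)
  qed
  have psi_vac: "\<psi> a n k (vac V) \<in> T" if a: "a \<in> I" for a n k
  proof (cases "\<psi> a n k (vac V) = 0")
    case False
    then obtain m :: nat where m: "k = 0" "n = - of_nat m - 1" using vac[OF a] by blast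
    \<comment> \<open>The expansion of \<open>e^{xL(-1)}\<close>: each application of
      \<open>D\<close> to the coefficient at \<open>- m - 1\<close> yields the next one times
      \<open>m + 1\<close>.\<close>
    have "(D ^^ m) (\<psi> a (-1) 0 (vac V)) = fact m *\<^sub>C \<psi> a (- of_nat m - 1) 0 (vac V)" for m
    proof (induction m)
      case 0
      show ?case by (simp add: scaleC_one)
    next
      case (Suc m)
      have z: "\<psi> a n (Suc 0) (vac V) = 0" for n
        using vac[OF a, of n "Suc 0"] by auto
      have "D (\<psi> a (- of_nat m - 1) 0 (vac V)) = (of_nat (Suc m) :: complex) *\<^sub>C \<psi> a (- of_nat (Suc m) - 1) 0 (vac V)"
        by (simp add: D\<psi>[OF a] ddx_def z algebra_simps)
      then show ?case
        by (simp add: Suc.IH clinear_scale[OF D] scaleC_scaleC algebra_simps)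
    qed
    then have "fact m *\<^sub>C \<psi> a n k (vac V) \<in> T" using DT[OF a, of m] m by simp
    from complex_vector.subspace_scale[OF T this, of "1 / fact m"] show ?thesis
      by (simp add: scaleC_scaleC scaleC_one)
  qed (simp add: complex_vector.subspace_0[OF T])
  have mono: "\<forall>n q. \<psi> a n q (foldr (\<lambda>(i, m). vY V (phi F i) m) xs (vac V)) \<in> T"
    if "\<forall>(i, m)\<in>set xs. i \<in> idx F" "a \<in> I" for xs a
    using that(1)
  proof (induction xs)
    case Nil
    show ?case by (simp add: psi_vac that)
  next
    case (Cons x xs)
    obtain i m where x: "x = (i, m)" by (cases x)
    let ?v = "foldr (\<lambda>(i, m). vY V (phi F i) m) xs (vac V)"
    have IH: "\<And>n q. \<psi> a n q ?v \<in> T" using Cons by auto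
    have "\<exists>\<beta> \<kappa>. \<kappa> \<noteq> 0 \<and> (\<forall>m p n q. \<exists>S0. \<forall>S\<ge>S0.
      phi_psi_left F \<phi> i \<beta> S (\<lambda>n q. \<psi> a n q ?v) m p n q = \<kappa> *\<^sub>C phi_psi_right V G F i \<beta> S (\<psi> a) ?v m p n q)"
      if "i \<in> idx F" for i
      using rel[OF that \<open>a \<in> I\<close>] unfolding phi_psi_relation_def by blast
    then have "\<psi> a n q (vY V (phi F i) m ?v) \<in> T" for n q
      using Cons.prems x by (intro psi_vY_mem[OF V A gen T \<phi>T \<psi>[OF \<open>a \<in> I\<close>] _ IH]) auto
    then show ?case by (simp add: x)
  qed
  have psi: "\<psi> a n q v \<in> T" if "a \<in> I" for a n q v
  proof -
    have "v \<in> cspan {foldr (\<lambda>(i, m). vY V (phi F i) m) xs (vac V) | xs. \<forall>(i, m)\<in>set xs. i \<in> idx F}"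
      using generating_fieldsD(1)[OF gen] by simp
    then show ?thesis
      by (rule clinear_span_image[OF \<psi>[OF that] _ T]) (use mono[OF _ that] in blast)
  qed
  have "field_product \<phi> xs (\<psi> a n l v) \<in> T" if "\<forall>(i, n, k)\<in>set xs. i \<in> idx F" "a \<in> I" for xs a n l v
    using that(1)
    by (induction xs) (auto simp: psi that(2) intro: \<phi>T)
  then have "cspan {field_product \<phi> xs (\<psi> a n l v) | xs a n l v. (\<forall>(i, n, k)\<in>set xs. i \<in> idx F) \<and> a \<in> I} \<subseteq> T"
    by (intro complex_vector.span_minimal[OF _ T]) blast
  then show ?thesis unfolding span T_def by blast
qed

section \<open>Spanning for twisted field data\<close>

lemma g_exponentsI:
  assumes "\<alpha> \<in> strip" "y \<in> gspace G \<alpha>" "y \<noteq> 0"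
  shows "\<alpha> \<in> g_exponents G"
proof -
  obtain z where "z \<noteq> 0" "gop G z = e2pi \<alpha> *\<^sub>C z"
    using gen_eigenspace_eigenvector[OF assms(2)[unfolded gspace_def] assms(3)] .
  then show ?thesis using assms(1) by (auto simp: g_exponents_def)
qed

text \<open>Truncation of the \<open>\<psi>\<close> fields, and their description in the quotient,
  are available only on spaces \<open>V^[\<alpha>]\<close> with \<open>\<alpha>\<close> an actual
  exponent, hence the passage from \<open>strip\<close> to \<open>g_exponents\<close>.\<close>

lemma gspace_exponents_span:
  assumes A: "g_action G"
  shows "x \<in> cspan (\<Union>\<alpha>\<in>g_exponents G. gspace G \<alpha>)"
proof -
  have "(\<Union>\<alpha>\<in>strip. gspace G \<alpha>) \<subseteq> insert 0 (\<Union>\<alpha>\<in>g_exponents G. gspace G \<alpha>)"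
  proof
    fix y assume "y \<in> (\<Union>\<alpha>\<in>strip. gspace G \<alpha>)"
    then obtain \<alpha> where \<alpha>: "\<alpha> \<in> strip" "y \<in> gspace G \<alpha>" by blast
    show "y \<in> insert 0 (\<Union>\<alpha>\<in>g_exponents G. gspace G \<alpha>)"
    proof (cases "y = 0")
      case False
      then show ?thesis using g_exponentsI[OF \<alpha>] \<alpha>(2) by blast
    qed simp
  qed
  then have "cspan (\<Union>\<alpha>\<in>strip. gspace G \<alpha>) \<subseteq> cspan (insert 0 (\<Union>\<alpha>\<in>g_exponents G. gspace G \<alpha>))"
    by (rule complex_vector.span_mono)
  also have "\<dots> = cspan (\<Union>\<alpha>\<in>g_exponents G. gspace G \<alpha>)"
    by (rule complex_vector.span_insert_0)
  finally show ?thesis using graded_span_UNIV[OF g_actionD(4)[OF A]] by blast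
qed

lemma clinear_zero: "clinear (\<lambda>x. 0)"
  by (rule clinearI) simp_all

lemma clinear_at_idx:
  assumes "\<And>j. i = Some j \<Longrightarrow> clinear (f j n k)"
  shows "clinear (at_idx f i n k)"
  using assms by (cases i) (simp_all add: at_idx_def[abs_def] clinear_zero)

lemma at_idx_Some [simp]: "at_idx f (Some i) = f i"
  and at_idx_None [simp]: "at_idx f None n k x = 0"
  by (simp_all add: at_idx_def fun_eq_iff)

lemma nidx_pow_Some_idx:
  assumes "generating_fields V G F" "g_action G" "i \<in> idx F" "nidx_pow F r i = Some j"
  shows "j \<in> idx F"
  using nidx_pow_cases[OF assms(1-3), of r] assms(4) by simp

text \<open>The hypothesis \<open>ad\<close> makes the iterated commutators the fields along the
  chain \<open>nidx_pow F r i\<close>, which ends after \<open>fK F i\<close> steps. It will be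
  applied on \<open>W\<close> and on the free space.\<close>

lemma phi_psi_left_eq:
  assumes A: "g_action G" and gen: "generating_fields V G F"
    and N: "clinear N" "locally_nilpotent N"
    and \<phi>: "\<And>j n k. j \<in> idx F \<Longrightarrow> clinear (\<phi> j n k)"
    and ad: "\<And>j n k x. j \<in> idx F \<Longrightarrow> N (\<phi> j n k x) - \<phi> j n k (N x) = at_idx \<phi> (nidx F j) n k x"
    and i: "i \<in> idx F" and \<Psi>: "\<And>s. S \<le> s \<Longrightarrow> \<Psi> (n + of_nat s) q = 0"
  shows "twisted_product_left \<beta> N (\<phi> i) \<Psi> m p n q = phi_psi_left F \<phi> i \<beta> S \<Psi> m p n q"
proof -
  define \<Phi> where "\<Phi> r = at_idx \<phi> (nidx_pow F r i)" for r
  have 1: "clinear (\<Phi> r m p)" for r m p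
    unfolding \<Phi>_def by (rule clinear_at_idx) (use \<phi> nidx_pow_Some_idx[OF gen A i] in blast)
  have 2: "N (\<Phi> r m p x) - \<Phi> r m p (N x) = \<Phi> (Suc r) m p x" for r m p x
    using ad nidx_pow_Some_idx[OF gen A i, of r]
    by (cases "nidx_pow F r i") (simp_all add: \<Phi>_def clinear_0[OF N(1)])
  have 3: "\<Phi> r m p x = 0" if "r > fK F i" for r m p x
    by (simp add: \<Phi>_def nidx_pow_eq_None[OF gen A i that])
  have "twisted_product_left \<beta> N (\<Phi> 0) \<Psi> m p n q = phi_psi_left F \<phi> i \<beta> S \<Psi> m p n q"
    unfolding phi_psi_left_def \<Phi>_def[symmetric]
    by (rule twisted_product_left_eq[where N = N and \<Phi> = \<Phi> and K = "fK F i" and \<Psi> = \<Psi> and n = n and q = q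
          and S = S, OF N 1 2 3 \<Psi>])
  then show ?thesis by (simp add: \<Phi>_def)
qed

lemma clinear_vfield:
  assumes V: "vertex_superalgebra V"
  shows "clinear (vfield V u n k)"
proof -
  have "clinear (vY V u m)" for m using vertex_superalgebraD(3)[OF V] by blast
  then show ?thesis by (cases "n \<in> \<int> \<and> k = 0") (auto simp: vfield_def[abs_def] clinear_zero)
qed

lemma vfield_eventually_0:
  assumes V: "vertex_superalgebra V"
  shows "\<exists>S. \<forall>s\<ge>S. vfield V u (m + of_nat s) p x = 0"
proof -
  obtain N where N: "\<And>n. n \<ge> N \<Longrightarrow> vY V u n x = 0"
    using vertex_superalgebraD(4)[OF V] by blast
  have "vfield V u (m + of_nat s) p x = 0" if "s \<ge> nat (N - \<lfloor>Re m\<rfloor>)" for s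
  proof -
    have "\<lfloor>Re (m + of_nat s)\<rfloor> = \<lfloor>Re m\<rfloor> + int s" by simp
    then have "N \<le> \<lfloor>Re (m + of_nat s)\<rfloor>" using that by linarith
    then show ?thesis by (simp only: vfield_def N if_cancel)
  qed
  then show ?thesis by blast
qed

text \<open>On \<open>V\<close> the derivation property of \<open>\<N>\<^sub>g\<close> turns the
  \<open>r\<close>-fold commutator with the field of \<open>u\<close> into the field of
  \<open>\<N>\<^sub>g^r u\<close>.\<close>

lemma phi_psi_right_eq:
  assumes V: "vertex_superalgebra V" and A: "vsa_automorphism V G" and gen: "generating_fields V G F"
    and \<psi>: "\<And>n q. clinear (\<psi> n q)" and i: "i \<in> idx F"
  obtains S0 where "\<And>S. S0 \<le> S \<Longrightarrow>
    twisted_product_right \<beta> (gN G) (vfield V (phi F i)) \<psi> v m p n q = phi_psi_right V G F i \<beta> S \<psi> v m p n q"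
proof -
  note g = vsa_automorphismD(1)[OF A]
  note N = g_actionD(3,5)[OF g]
  have Y1: "clinear (\<lambda>u. vY V u m v)" for m v using vertex_superalgebraD(3)[OF V] by blast
  define \<Phi> where "\<Phi> r = vfield V ((gN G ^^ r) (phi F i))" for r
  have 1: "clinear (\<Phi> r m p)" for r m p
    unfolding \<Phi>_def by (rule clinear_vfield[OF V])
  have 2: "gN G (\<Phi> r m p x) - \<Phi> r m p (gN G x) = \<Phi> (Suc r) m p x" for r m p x
    by (simp add: \<Phi>_def vfield_def gN_vY[OF V A] clinear_0[OF N(1)])
  have 3: "\<Phi> r m p x = 0" if "r > fK F i" for r m p x
  proof -
    have "(gN G ^^ r) (phi F i) = 0"
      by (rule funpow_zero_mono[OF N(1) generating_fieldsD(6)[OF gen i]]) (use that in simp)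
    then show ?thesis by (simp add: \<Phi>_def vfield_def clinear_0[OF Y1])
  qed
  have 4: "\<exists>S. \<forall>s\<ge>S. \<Phi> 0 (m + of_nat s) p x = 0" for x
    unfolding \<Phi>_def by (rule vfield_eventually_0[OF V])
  show ?thesis
  proof (rule twisted_product_right_eq[where N = "gN G" and \<Phi> = \<Phi> and K = "fK F i" and \<Psi> = \<psi> and m = m
          and p = p and \<beta> = \<beta> and v = v and n = n and q = q, OF N 1 \<psi> 2 3 4])
    fix S0
    assume *: "\<And>S. S0 \<le> S \<Longrightarrow> twisted_product_right \<beta> (gN G) (\<Phi> 0) \<psi> v m p n q =
    (\<Sum>s<S. \<Sum>r\<le>fK F i. \<Sum>l\<le>min r q.
      (exp (of_real pi * \<i> * \<beta>) * of_nat (r choose l) *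
        fps_nth (one_minus_powr \<beta> * (fps_const (of_real pi * \<i>) + log_one_minus) ^ (r - l)) s / fact r) *\<^sub>C
        \<psi> (n + \<beta> - of_nat s) (q - l) (\<Phi> r (m + of_nat s) p v))"
    show ?thesis
    proof (rule that)
      fix S assume "S0 \<le> S"
      from *[OF this] show "twisted_product_right \<beta> (gN G) (vfield V (phi F i)) \<psi> v m p n q =
          phi_psi_right V G F i \<beta> S \<psi> v m p n q"
        unfolding phi_psi_right_def \<Phi>_def by simp
    qed
  qed
qed

lemma koszul_nonzero [simp]: "koszul s t \<noteq> 0"
  by (simp add: koszul_def)

lemma lower_bounded_spaceD:
  assumes "lower_bounded_space W"
  shows "graded (UNIV \<times> UNIV \<times> strip) (\<lambda>(n, s, \<alpha>). wgr W n s \<alpha>)"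
    and "\<exists>B. \<forall>n. Re n < B \<longrightarrow> wwt W n = {0}"
    and "g_action (wG W)" and "\<And>\<alpha>. \<alpha> \<in> strip \<Longrightarrow> wgwt W \<alpha> = gspace (wG W) \<alpha>"
    and "clinear (wL0 W)" and "clinear (wLm1 W)" and "\<And>n. wwt W n = gen_eigenspace (wL0 W) n"
  using assms unfolding lower_bounded_space_def by blast+

lemma g_propertyD:
  assumes "g_property V G F W E"
  shows "\<forall>i\<in>idx F. \<forall>n k w. phiW E i n k w =
       (\<Sum>j\<le>k. ((-1) ^ j / (fact j * fact (k - j))) *\<^sub>C
          (gN (wG W) ^^ j) (phiW E i n 0 ((gN (wG W) ^^ (k - j)) w)))"
    and "\<forall>i\<in>idx F. \<forall>n k w. gN (wG W) (phiW E i n k w) - phiW E i n k (gN (wG W) w) =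
       at_idx (phiW E) (nidx F i) n k w"
  using assms unfolding g_property_def by - (elim conjE, assumption)+

text \<open>The bound is given for \<open>v\<close> in one \<open>V^[\<alpha>]\<close>; a general
  \<open>v\<close> is a finite combination of such vectors.\<close>

lemma twisted_field_data_psi_bounded:
  assumes A: "g_action G" and wf: "fields_wellformed V G F W E" and a: "a \<in> aidx E"
  shows "\<exists>B. \<forall>n k. psiW E a n k v \<noteq> 0 \<longrightarrow> Re n \<le> B"
proof -
  note \<psi> = wf[unfolded fields_wellformed_def, THEN conjunct2, rule_format, OF a]
  have l: "clinear (psiW E a n k)" for n k using \<psi> by blast
  show ?thesis
    using gspace_exponents_span[OF A, of v]
  proof (induction rule: complex_vector.span_induct_alt)
    case base
    show ?case by (simp add: clinear_0[OF l])
  next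
    case (step c x y)
    obtain B1 where B1: "\<And>n k. psiW E a n k x \<noteq> 0 \<Longrightarrow> Re n \<le> B1"
      using step(1) \<psi> unfolding log_laurent_def by blast
    obtain B2 where B2: "\<And>n k. psiW E a n k y \<noteq> 0 \<Longrightarrow> Re n \<le> B2"
      using step(2) by blast
    have "Re n \<le> max B1 B2" if "psiW E a n k (c *\<^sub>C x + y) \<noteq> 0" for n k
      using B1[of n k] B2[of n k] that by (force simp: clinear_add[OF l] clinear_scale[OF l])
    then show ?case by blast
  qed
qed

lemma twisted_field_data_relation:
  assumes V: "vertex_superalgebra V" and A: "vsa_automorphism V G" and gen: "generating_fields V G F"
    and data: "twisted_field_data V G F W E" and i: "i \<in> idx F" and a: "a \<in> aidx E"
  shows "\<exists>\<beta> \<kappa>. \<kappa> \<noteq> 0 \<and> (\<forall>v. phi_psi_relation V G F (phiW E) (psiW E a) i \<beta> \<kappa> v)"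
proof -
  note d = data[unfolded twisted_field_data_def]
  have wf: "fields_wellformed V G F W E" and gp: "g_property V G F W E"
    and lb: "lower_bounded_space W" and loc: "phi_psi_locality V G F W E" using d by blast+
  note g = vsa_automorphismD(1)[OF A]
  note N = g_actionD(3,5)[OF lower_bounded_spaceD(3)[OF lb]]
  have \<phi>: "clinear (phiW E j n k)" if "j \<in> idx F" for j n k
    using wf that unfolding fields_wellformed_def by blast
  have \<psi>: "clinear (psiW E a n k)" for n k
    using wf a unfolding fields_wellformed_def by blast
  have ad: "gN (wG W) (phiW E j n k x) - phiW E j n k (gN (wG W) x) = at_idx (phiW E) (nidx F j) n k x"
    if "j \<in> idx F" for j n k x
    using g_propertyD(2)[OF gp] that by blast
  obtain M :: nat where M: "\<And>v m p n q. twisted_product_left (falpha F i + of_nat M) (gN (wG W)) (phiW E i)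
      (\<lambda>n q. psiW E a n q v) m p n q =
    koszul (ffer F i) (psifer E a) *\<^sub>C
      twisted_product_right (falpha F i + of_nat M) (gN G) (vfield V (phi F i)) (psiW E a) v m p n q"
    using loc i a unfolding phi_psi_locality_def by blast
  have "phi_psi_relation V G F (phiW E) (psiW E a) i (falpha F i + of_nat M) (koszul (ffer F i) (psifer E a)) v" for v
    unfolding phi_psi_relation_def
  proof (intro allI)
    fix m p n q
    obtain B where B: "\<And>n k. psiW E a n k v \<noteq> 0 \<Longrightarrow> Re n \<le> B"
      using twisted_field_data_psi_bounded[OF g wf a] by blast
    have tr: "psiW E a (n + of_nat s) q v = 0" if "nat \<lceil>B - Re n\<rceil> + 1 \<le> s" for s
    proof (rule ccontr)
      assume "psiW E a (n + of_nat s) q v \<noteq> 0"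
      then have "Re n + real s \<le> B" using B by force
      with that show False by linarith
    qed
    obtain S0 where S0: "\<And>S. S0 \<le> S \<Longrightarrow>
      twisted_product_right (falpha F i + of_nat M) (gN G) (vfield V (phi F i)) (psiW E a) v m p n q =
      phi_psi_right V G F i (falpha F i + of_nat M) S (psiW E a) v m p n q"
      using phi_psi_right_eq[where \<psi> = "psiW E a", OF V A gen \<psi> i] by blast
    show "\<exists>S0. \<forall>S\<ge>S0. phi_psi_left F (phiW E) i (falpha F i + of_nat M) S (\<lambda>n q. psiW E a n q v) m p n q =
        koszul (ffer F i) (psifer E a) *\<^sub>C phi_psi_right V G F i (falpha F i + of_nat M) S (psiW E a) v m p n q"
    proof (intro exI allI impI)
      fix S assume S: "max S0 (nat \<lceil>B - Re n\<rceil> + 1) \<le> S"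
      have "phi_psi_left F (phiW E) i (falpha F i + of_nat M) S (\<lambda>n q. psiW E a n q v) m p n q =
        twisted_product_left (falpha F i + of_nat M) (gN (wG W)) (phiW E i) (\<lambda>n q. psiW E a n q v) m p n q"
        by (rule phi_psi_left_eq[where N = "gN (wG W)" and \<phi> = "phiW E" and n = n and q = q and
            \<Psi> = "\<lambda>n q. psiW E a n q v", OF g gen N \<phi> ad i tr, symmetric]) (use S in auto)
      then show "phi_psi_left F (phiW E) i (falpha F i + of_nat M) S (\<lambda>n q. psiW E a n q v) m p n q =
        koszul (ffer F i) (psifer E a) *\<^sub>C phi_psi_right V G F i (falpha F i + of_nat M) S (psiW E a) v m p n q"
        using S by (simp add: M S0)
    qed
  qed
  then show ?thesis by (intro exI[of _ "falpha F i + of_nat M"] exI[of _ "koszul (ffer F i) (psifer E a)"]) simp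
qed

text \<open>By Property 5 the coefficient of \<open>(log x)^k\<close> is \<open>(-1)^k / k!\<close>
  times the \<open>k\<close>-fold commutator of \<open>\<N>\<^sub>g\<close> with the constant term.
  This commutator is a coefficient of the field with index \<open>nidx_pow F k i\<close>, which is
  absent for \<open>k > fK F i\<close>.\<close>

lemma twisted_field_data_phi_support:
  assumes A: "g_action G" and gen: "generating_fields V G F"
    and data: "twisted_field_data V G F W E" and i: "i \<in> idx F" and nz: "phiW E i n k w \<noteq> 0"
  shows "n - falpha F i \<in> \<int> \<and> k \<le> fK F i"
proof
  note d = data[unfolded twisted_field_data_def]
  have wf: "fields_wellformed V G F W E" and gp: "g_property V G F W E"
    and lb: "lower_bounded_space W" using d by blast+
  note N = g_actionD(3)[OF lower_bounded_spaceD(3)[OF lb]]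
  show "n - falpha F i \<in> \<int>"
    using wf i nz unfolding fields_wellformed_def log_laurent_def by blast
  define \<Phi> where "\<Phi> r x = at_idx (phiW E) (nidx_pow F r i) n 0 x" for r x
  have ad: "gN (wG W) (\<Phi> r x) - \<Phi> r (gN (wG W) x) = \<Phi> (Suc r) x" for r x
  proof (cases "nidx_pow F r i")
    case (Some j)
    then have "j \<in> idx F" by (rule nidx_pow_Some_idx[OF gen A i])
    then have "gN (wG W) (phiW E j n 0 x) - phiW E j n 0 (gN (wG W) x) = at_idx (phiW E) (nidx F j) n 0 x"
      using g_propertyD(2)[OF gp] by blast
    then show ?thesis by (simp add: \<Phi>_def Some)
  qed (simp add: \<Phi>_def clinear_0[OF N])
  have "phiW E i n k w = (\<Sum>j\<le>k. ((-1) ^ j / (fact j * fact (k - j))) *\<^sub>C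
          (gN (wG W) ^^ j) (\<Phi> 0 ((gN (wG W) ^^ (k - j)) w)))"
    unfolding \<Phi>_def nidx_pow_0 at_idx_Some by (rule g_propertyD(1)[OF gp, rule_format, OF i])
  \<comment> \<open>Reversing the sum matches Property 5 with the formula for iterated commutators,
    up to the sign \<open>(-1) ^ k\<close>.\<close>
  also have "\<dots> = (\<Sum>j\<le>k. ((-1) ^ (k - j) / (fact (k - j) * fact j)) *\<^sub>C
          (gN (wG W) ^^ (k - j)) (\<Phi> 0 ((gN (wG W) ^^ j) w)))"
    unfolding atMost_atLeast0 by (subst sum.atLeastAtMost_rev) (rule sum.cong[OF refl], simp)
  also have "\<dots> = (-1) ^ k *\<^sub>C (\<Sum>j\<le>k. ((-1) ^ j / (fact (k - j) * fact j)) *\<^sub>C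
          (gN (wG W) ^^ (k - j)) (\<Phi> 0 ((gN (wG W) ^^ j) w)))"
    unfolding complex_vector.scale_sum_right scaleC_scaleC
  proof (rule sum.cong[OF refl])
    fix j assume "j \<in> {..k}"
    then obtain d where d: "k = j + d" using le_Suc_ex by auto
    have "(-1 :: complex) ^ j * (-1) ^ j = 1" by (simp flip: power_mult_distrib)
    then have "(-1 :: complex) ^ k * (-1) ^ j = (-1) ^ (k - j)"
      by (simp add: d power_add)
    then show "((-1) ^ (k - j) / (fact (k - j) * fact j)) *\<^sub>C (gN (wG W) ^^ (k - j)) (\<Phi> 0 ((gN (wG W) ^^ j) w)) =
      ((-1) ^ k * ((-1) ^ j / (fact (k - j) * fact j))) *\<^sub>C (gN (wG W) ^^ (k - j)) (\<Phi> 0 ((gN (wG W) ^^ j) w))"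
      by simp
  qed
  also have "\<dots> = (-1) ^ k *\<^sub>C ((1 / fact k) *\<^sub>C \<Phi> k w)"
    by (subst iterated_commutator[where \<Phi> = \<Phi>, OF N ad]) (rule refl)
  finally have "\<Phi> k w \<noteq> 0" using nz by auto
  then show "k \<le> fK F i"
    unfolding \<Phi>_def using nidx_pow_eq_None[OF gen A i, of k] by (metis at_idx_None leI)
qed

lemma twisted_field_data_span:
  assumes V: "vertex_superalgebra V" and A: "vsa_automorphism V G" and gen: "generating_fields V G F"
    and data: "twisted_field_data V G F W E"
  shows "cspan {field_product (phiW E) xs ((wLm1 W ^^ k) (psiW E a (-1) 0 (vac V))) | xs k a.
           (\<forall>(i, n, l)\<in>set xs. i \<in> idx F \<and> n - falpha F i \<in> \<int> \<and> l \<le> fK F i) \<and> a \<in> aidx E} = UNIV"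
proof -
  note d = data[unfolded twisted_field_data_def]
  have wf: "fields_wellformed V G F W E" and Lm: "Lm1_property V F W E" and cr: "creation_property V W E"
    and lb: "lower_bounded_space W" and sp: "spanning_property F E" using d by blast+
  note g = vsa_automorphismD(1)[OF A]
  have \<psi>: "clinear (psiW E a n k)" if "a \<in> aidx E" for a n k
    using wf that unfolding fields_wellformed_def by blast
  show ?thesis
  proof (rule cspan_field_products_eq_UNIV[OF V g gen])
    fix i n k assume "i \<in> idx F"
    then show "clinear (phiW E i n k)" using wf unfolding fields_wellformed_def by blast
  next
    fix a n k assume a: "a \<in> aidx E"
    have "wLm1 W (psiW E a n k (vac V)) - psiW E a n k (vLm1 V (vac V)) = ddx (\<lambda>n k. psiW E a n k (vac V)) n k"
      using Lm a unfolding Lm1_property_def by blast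
    then show "wLm1 W (psiW E a n k (vac V)) = ddx (\<lambda>n k. psiW E a n k (vac V)) n k"
      by (simp add: vsa_Lm1_vac[OF V] clinear_0[OF \<psi>[OF a]])
    show "psiW E a n k (vac V) \<noteq> 0 \<Longrightarrow> k = 0 \<and> (\<exists>m::nat. n = - of_nat m - 1)"
      using cr a unfolding creation_property_def by blast
  next
    show "cspan {field_product (phiW E) xs (psiW E a n l v) | xs a n l v.
        (\<forall>(i, n, k)\<in>set xs. i \<in> idx F) \<and> a \<in> aidx E} = UNIV"
      using sp unfolding spanning_property_def .
  qed (use \<psi> lower_bounded_spaceD(6)[OF lb] twisted_field_data_phi_support[OF g gen data]
      twisted_field_data_relation[OF V A gen data] in blast)+
qed

section \<open>The free space of symbols\<close>

lemma lookup_scaleC [simp]: "Poly_Mapping.lookup (c *\<^sub>C x) k = c *\<^sub>C Poly_Mapping.lookup x k"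
  by (simp add: scaleC_poly_mapping_def Poly_Mapping.map.rep_eq when_def)

lemma scaleC_complex [simp]: "(c::complex) *\<^sub>C z = c * z"
  by (simp add: scaleC_complex_def)

lemma lin_ext_superset:
  assumes "finite A" "Poly_Mapping.keys x \<subseteq> A"
  shows "lin_ext f x = (\<Sum>b\<in>A. Poly_Mapping.lookup x b *\<^sub>C f b)"
  unfolding lin_ext_def
  by (rule sum.mono_neutral_left) (use assms in \<open>auto simp: in_keys_iff\<close>)

lemma clinear_lin_ext:
  fixes f :: "('v, 'm) symbol \<Rightarrow> ('v, 'm) free_space"
  shows "clinear (lin_ext f)"
proof (rule clinearI)
  fix x y :: "('v, 'm) free_space"
  let ?A = "Poly_Mapping.keys x \<union> Poly_Mapping.keys y"
  have "lin_ext f (x + y) = (\<Sum>b\<in>?A. Poly_Mapping.lookup (x + y) b *\<^sub>C f b)"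
    by (rule lin_ext_superset) (simp_all add: Poly_Mapping.keys_add)
  also have "\<dots> = (\<Sum>b\<in>?A. Poly_Mapping.lookup x b *\<^sub>C f b) + (\<Sum>b\<in>?A. Poly_Mapping.lookup y b *\<^sub>C f b)"
    by (simp add: lookup_add scaleC_add_left sum.distrib)
  also have "\<dots> = lin_ext f x + lin_ext f y"
    by (simp add: lin_ext_superset[of ?A])
  finally show "lin_ext f (x + y) = lin_ext f x + lin_ext f y" .
next
  fix c and x :: "('v, 'm) free_space"
  have "lin_ext f (c *\<^sub>C x) = (\<Sum>b\<in>Poly_Mapping.keys x. Poly_Mapping.lookup (c *\<^sub>C x) b *\<^sub>C f b)"
    by (rule lin_ext_superset) (auto simp: in_keys_iff)
  then show "lin_ext f (c *\<^sub>C x) = c *\<^sub>C lin_ext f x"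
    by (simp add: lin_ext_def complex_vector.scale_sum_right scaleC_scaleC)
qed

lemma lin_ext_sym [simp]: "lin_ext f (sym b) = f b"
  by (simp add: lin_ext_def sym_def scaleC_one)

lemma free_space_span: "x \<in> cspan (range sym)"
proof -
  have "x = (\<Sum>b\<in>Poly_Mapping.keys x. Poly_Mapping.lookup x b *\<^sub>C sym b)"
  proof (rule poly_mapping_eqI)
    fix k
    have "Poly_Mapping.lookup (\<Sum>b\<in>Poly_Mapping.keys x. Poly_Mapping.lookup x b *\<^sub>C sym b) k =
      (\<Sum>b\<in>Poly_Mapping.keys x. Poly_Mapping.lookup x b * (1 when b = k))"
      by (simp add: lookup_sum sym_def lookup_single)
    also have "\<dots> = (\<Sum>b\<in>Poly_Mapping.keys x. if b = k then Poly_Mapping.lookup x b else 0)"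
      by (rule sum.cong) (auto simp: when_def)
    also have "\<dots> = Poly_Mapping.lookup x k"
      by (simp add: in_keys_iff)
    finally show "Poly_Mapping.lookup x k =
      Poly_Mapping.lookup (\<Sum>b\<in>Poly_Mapping.keys x. Poly_Mapping.lookup x b *\<^sub>C sym b) k" ..
  qed
  moreover have "(\<Sum>b\<in>Poly_Mapping.keys x. Poly_Mapping.lookup x b *\<^sub>C sym b) \<in> cspan (range sym)"
    by (intro complex_vector.span_sum complex_vector.span_scale complex_vector.span_base) simp
  ultimately show ?thesis by simp
qed

lemma free_space_eqI:
  assumes f: "clinear f" and g: "clinear g" and eq: "\<And>ws m n v. f (sym (ws, m, n, v)) = g (sym (ws, m, n, v))"
  shows "f x = g x"
proof -
  have "clinear (\<lambda>x. f x - g x)"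
    by (auto intro!: clinearI simp: clinear_add[OF f] clinear_add[OF g] clinear_scale[OF f] clinear_scale[OF g]
        complex_vector.scale_right_diff_distrib)
  then have "f x - g x \<in> {0}"
    by (rule clinear_span_image[OF _ free_space_span]) (auto simp: complex_vector.subspace_def eq)
  then show ?thesis by simp
qed

lemma clinear_lmul: "clinear (lmul y)"
  unfolding lmul_def by (rule clinear_lin_ext)

lemma lmul_sym [simp]: "lmul y (sym (ws, m, n, v)) = sym (y # ws, m, n, v)"
  by (simp add: lmul_def)

lemma clinear_N_hat: "clinear (N_hat G M)"
  unfolding N_hat_def by (rule clinear_lin_ext)

lemma clinear_phi_hat: "clinear (phi_hat G F i n k)"
  by (cases "n - falpha F i \<in> \<int> \<and> (gN G ^^ k) (phi F i) \<noteq> 0")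
    (auto simp: phi_hat_def[abs_def] clinear_lmul clinear_zero)

text \<open>The derivation rule for the first letter, exact in the free space. The case distinction
  follows the convention that symbols with a zero entry are replaced by 0.\<close>

lemma N_hat_lmul:
  "N_hat G M (lmul (Fld u n) x) - lmul (Fld u n) (N_hat G M x) =
    (if gN G u = 0 then 0 else lmul (Fld (gN G u) n) x)"
proof -
  note lN = clinear_N_hat[of G M] and lm = clinear_lmul
  show ?thesis
  proof (rule free_space_eqI[where f = "\<lambda>x. N_hat G M (lmul (Fld u n) x) - lmul (Fld u n) (N_hat G M x)"
        and g = "\<lambda>x. if gN G u = 0 then 0 else lmul (Fld (gN G u) n) x"])
    fix ws m k v
    have "N_hat G M (lmul (Fld u n) (sym (ws, m, k, v))) =
      (if gN G u = 0 then 0 else sym (Fld (gN G u) n # ws, m, k, v)) +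
      (\<Sum>j<length ws. case ws ! j of
        Fld u' r \<Rightarrow> if gN G u' = 0 then 0 else sym (Fld u n # ws[j := Fld (gN G u') r], m, k, v)
      | _ \<Rightarrow> 0) +
      (if gN (mG M) m = 0 then 0 else sym (Fld u n # ws, gN (mG M) m, k, v)) +
      (if gN G v = 0 then 0 else sym (Fld u n # ws, m, k, gN G v))"
      by (simp add: N_hat_def sum.lessThan_Suc_shift del: sum.lessThan_Suc)
        (intro sum.cong refl, auto simp: list_update_code split: letter.split)
    moreover have "lmul (Fld u n) (N_hat G M (sym (ws, m, k, v))) =
      (\<Sum>j<length ws. case ws ! j of
        Fld u' r \<Rightarrow> if gN G u' = 0 then 0 else sym (Fld u n # ws[j := Fld (gN G u') r], m, k, v)
      | _ \<Rightarrow> 0) +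
      (if gN (mG M) m = 0 then 0 else sym (Fld u n # ws, gN (mG M) m, k, v)) +
      (if gN G v = 0 then 0 else sym (Fld u n # ws, m, k, gN G v))"
      by (simp add: N_hat_def clinear_add[OF lm] clinear_sum[OF lm] clinear_0[OF lm]
          if_distrib[of "lmul _"] cong: if_cong)
        (intro sum.cong refl, auto simp: clinear_0[OF lm] split: letter.split)
    ultimately show "N_hat G M (lmul (Fld u n) (sym (ws, m, k, v))) - lmul (Fld u n) (N_hat G M (sym (ws, m, k, v))) =
      (if gN G u = 0 then 0 else lmul (Fld (gN G u) n) (sym (ws, m, k, v)))"
      by simp
  next
    show "clinear (\<lambda>x. N_hat G M (lmul (Fld u n) x) - lmul (Fld u n) (N_hat G M x))"
      by (rule clinearI) (simp_all add: clinear_add[OF lN] clinear_add[OF lm] clinear_scale[OF lN]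
          clinear_scale[OF lm] complex_vector.scale_right_diff_distrib)
    show "clinear (\<lambda>x. if gN G u = 0 then 0 else lmul (Fld (gN G u) n) x)"
      by (cases "gN G u = 0") (simp_all add: clinear_zero clinear_lmul)
  qed
qed

lemma gspace_unique:
  assumes A: "g_action G" and "\<alpha> \<in> strip" "\<beta> \<in> strip" "x \<in> gspace G \<alpha>" "x \<in> gspace G \<beta>" "x \<noteq> 0"
  shows "\<alpha> = \<beta>"
proof (rule ccontr)
  note g = g_actionD(4)[OF A]
  assume ne: "\<alpha> \<noteq> \<beta>"
  have "x \<in> cspan (\<Union>k\<in>{\<alpha>}. gspace G k)" "x \<in> cspan (\<Union>k\<in>{\<beta>}. gspace G k)"
    using assms by (auto intro: complex_vector.span_base)
  from graded_span_Int[OF g _ _ this] have "x \<in> cspan (\<Union>k\<in>{\<alpha>} \<inter> {\<beta>}. gspace G k)"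
    using assms by simp
  then show False using ne \<open>x \<noteq> 0\<close> by simp
qed

text \<open>\<open>\<N>\<^sub>g\<close> preserves \<open>V^[\<alpha>]\<close>, and a nonzero vector
  lies in only one of these spaces.\<close>

lemma falpha_nidx:
  assumes A: "g_action G" and gen: "generating_fields V G F" and i: "i \<in> idx F" and j: "nidx F i = Some j"
  shows "falpha F j = falpha F i"
proof -
  note d = generating_fieldsD(5)[OF gen i j]
  have "gN G (phi F i) \<in> gspace G (falpha F i)"
    using gop_eq_exp(2)[OF A] generating_fieldsD(3)[OF gen i] by (simp add: g_exponents_def)
  then show ?thesis
    using generating_fieldsD(3)[OF gen i] generating_fieldsD(3)[OF gen, of j] d
    by (intro gspace_unique[OF A, of _ _ "phi F j"]) (auto simp: g_exponents_def)
qed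

text \<open>The commutator formula of Property 5 is an identity in the free space, before any
  relation is imposed. The cases arise because \<open>phi_hat\<close> is set to zero when
  \<open>\<N>\<^sub>g^k\<close> kills the vector, which can happen for
  \<open>\<N>\<^sub>g(i)\<close> one step earlier than for \<open>i\<close>.\<close>

lemma N_hat_phi_hat:
  fixes x :: "('v::complex_vector, 'm::complex_vector) free_space"
  assumes A: "g_action G" and gen: "generating_fields V G F" and i: "i \<in> idx F"
  shows "N_hat G M (phi_hat G F i n k x) - phi_hat G F i n k (N_hat G M x) =
    at_idx (phi_hat G F) (nidx F i) n k x"
proof -
  note N = g_actionD(3)[OF A]
  note Nk = clinear_funpow[OF N]
  define c :: complex where "c = (-1) ^ k / fact k"
  have c: "c \<noteq> 0" by (simp add: c_def)
  have shift: "gN G (c *\<^sub>C (gN G ^^ k) (phi F i)) = c *\<^sub>C (gN G ^^ k) (gN G (phi F i))"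
    by (simp add: clinear_scale[OF N] funpow_swap1)
  show ?thesis
  proof (cases "n - falpha F i \<in> \<int> \<and> (gN G ^^ k) (phi F i) \<noteq> 0")
    case True
    then have e: "N_hat G M (phi_hat G F i n k x) - phi_hat G F i n k (N_hat G M x) =
      (if (gN G ^^ k) (gN G (phi F i)) = 0 then 0 else lmul (Fld (c *\<^sub>C (gN G ^^ k) (gN G (phi F i))) n) x)"
      using c by (simp add: phi_hat_def c_def[symmetric] N_hat_lmul shift)
    show ?thesis
    proof (cases "nidx F i")
      case None
      then show ?thesis using generating_fieldsD(4)[OF gen i] by (simp add: e clinear_0[OF Nk])
    next
      case (Some j)
      note j = generating_fieldsD(5)[OF gen i Some]
      show ?thesis using True j falpha_nidx[OF A gen i Some] unfolding e by (simp add: Some phi_hat_def c_def)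
    qed
  next
    case False
    then have "phi_hat G F i n k y = 0" for y :: "('v, 'm) free_space"
      by (auto simp: phi_hat_def)
    then have l: "N_hat G M (phi_hat G F i n k x) - phi_hat G F i n k (N_hat G M x) = 0"
      by (simp add: clinear_0[OF clinear_N_hat])
    show ?thesis
    proof (cases "nidx F i")
      case (Some j)
      note j = generating_fieldsD(5)[OF gen i Some]
      have "(gN G ^^ k) (phi F j) = gN G ((gN G ^^ k) (phi F i))"
        using j by (metis funpow_swap1)
      then have "phi_hat G F j n k x = 0"
        using False falpha_nidx[OF A gen i Some] by (auto simp: phi_hat_def clinear_0[OF N])
      then show ?thesis by (simp add: l Some)
    qed (simp add: l)
  qed
qed

definition nilpotency_degree :: "('a::complex_vector \<Rightarrow> 'a) \<Rightarrow> 'a \<Rightarrow> nat"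
  where "nilpotency_degree N x = (LEAST k. (N ^^ k) x = 0)"

lemma nilpotency_degree_less:
  assumes N: "locally_nilpotent N" and "N x \<noteq> 0" "clinear N"
  shows "nilpotency_degree N (N x) < nilpotency_degree N x"
proof -
  have "\<exists>k. (N ^^ k) x = 0" using N by (auto simp: locally_nilpotent_def)
  then have k: "(N ^^ nilpotency_degree N x) x = 0"
    unfolding nilpotency_degree_def by (rule LeastI_ex)
  have "nilpotency_degree N x \<noteq> 0"
    using k assms(2) clinear_0[OF assms(3)] by (metis funpow_0)
  then obtain k' where k': "nilpotency_degree N x = Suc k'" by (metis nat.exhaust)
  with k have "(N ^^ k') (N x) = 0" by (simp add: funpow_swap1)
  then have "nilpotency_degree N (N x) \<le> k'"
    unfolding nilpotency_degree_def by (rule Least_le)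
  then show ?thesis by (simp add: k')
qed

text \<open>Every symbol occurring in \<open>N_hat\<close> of a symbol has one entry replaced by its
  nonzero image under a locally nilpotent operator, so the total nilpotency degree
  \<open>\<mu>\<close> of the entries drops.\<close>

lemma locally_nilpotent_N_hat:
  fixes G :: "'v::complex_vector g_act" and M :: "('a, 'm::complex_vector) mdata"
  assumes A: "g_action G" and M: "g_action (mG M)"
  shows "locally_nilpotent (N_hat G M)"
proof -
  let ?N = "N_hat G M"
  note lN = clinear_funpow[OF clinear_N_hat[of G M]]
  define Z where "Z = {x. \<exists>k. (?N ^^ k) x = 0}"
  have Z: "csubspace Z"
    using subspace_gen_eigenspace[OF clinear_N_hat[of G M], of 0] by (simp add: Z_def gen_eigenspace_def)
  have step: "x \<in> Z" if "?N x \<in> Z" for x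
    using gen_eigenspace_step[of ?N x 0] that by (simp add: Z_def gen_eigenspace_def)
  define ld where "ld y = (case y of Fld u (r::complex) \<Rightarrow> nilpotency_degree (gN G) u | _ \<Rightarrow> 0)" for y
  define \<mu> where "\<mu> b = (case b of (ws, m, n::complex, v) \<Rightarrow> sum_list (map ld ws) +
      nilpotency_degree (gN (mG M)) m + nilpotency_degree (gN G) v)" for b
  have "sym b \<in> Z" for b
  proof (induction "\<mu> b" arbitrary: b rule: less_induct)
    case less
    obtain ws m n v where b: "b = (ws, m, n, v)" by (cases b) auto
    have 1: "(case ws ! j of
        Fld u r \<Rightarrow> if gN G u = 0 then 0 else sym (ws[j := Fld (gN G u) r], m, n, v) | _ \<Rightarrow> 0) \<in> Z"
      if j: "j < length ws" for j
    proof (cases "ws ! j")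
      case (Fld u r)
      show ?thesis
      proof (cases "gN G u = 0")
        case False
        have "ld (Fld (gN G u) r) < ld (ws ! j)"
          using nilpotency_degree_less[OF g_actionD(5)[OF A] False g_actionD(3)[OF A]] by (simp add: ld_def Fld)
        moreover have "ld (ws ! j) \<le> sum_list (map ld ws)"
          using j by (intro member_le_sum_list) auto
        moreover have "sum_list (map ld (ws[j := Fld (gN G u) r])) =
            sum_list (map ld ws) + ld (Fld (gN G u) r) - ld (ws ! j)"
          using j by (simp add: map_update sum_list_update)
        ultimately have "\<mu> (ws[j := Fld (gN G u) r], m, n, v) < \<mu> b"
          by (simp add: \<mu>_def b)
        then show ?thesis using less False by (simp add: Fld)
      qed (simp add: Fld complex_vector.subspace_0[OF Z])
    qed (simp_all add: complex_vector.subspace_0[OF Z])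
    have 2: "(if gN (mG M) m = 0 then 0 else sym (ws, gN (mG M) m, n, v)) \<in> Z"
    proof (cases "gN (mG M) m = 0")
      case False
      from nilpotency_degree_less[OF g_actionD(5)[OF M] False g_actionD(3)[OF M]]
      show ?thesis using less[of "(ws, gN (mG M) m, n, v)"] False by (simp add: \<mu>_def b)
    qed (simp add: complex_vector.subspace_0[OF Z])
    have 3: "(if gN G v = 0 then 0 else sym (ws, m, n, gN G v)) \<in> Z"
    proof (cases "gN G v = 0")
      case False
      from nilpotency_degree_less[OF g_actionD(5)[OF A] False g_actionD(3)[OF A]]
      show ?thesis using less[of "(ws, m, n, gN G v)"] False by (simp add: \<mu>_def b)
    qed (simp add: complex_vector.subspace_0[OF Z])
    have "?N (sym b) \<in> Z"
      unfolding b N_hat_def lin_ext_sym prod.case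
      using 1 2 3 by (intro complex_vector.subspace_add[OF Z] complex_vector.subspace_sum[OF Z]) auto
    then show ?case by (rule step)
  qed
  then have "cspan (range sym) \<subseteq> Z"
    by (intro complex_vector.span_minimal[OF _ Z]) blast
  then have "x \<in> Z" for x using free_space_span[of x] by (rule subsetD)
  then show ?thesis by (simp add: locally_nilpotent_def Z_def)
qed

section \<open>Spanning for the universal construction\<close>

lemma Sum_any_in_subspace:
  assumes X: "csubspace X" and f: "\<And>x. f x \<in> X"
  shows "Sum_any f \<in> X"
  by (simp add: Sum_any.expand_set complex_vector.subspace_sum[OF X] complex_vector.subspace_0[OF X] f)

text \<open>The defining relations of the quotient give Property 7 for homogeneous vectors only;
  linearity extends it. Both finite forms are linear in \<open>v\<close>, and two thresholds are
  replaced by their maximum.\<close>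

lemma csubspace_phi_psi_relation:
  assumes V: "vertex_superalgebra V" and A: "g_action G" and gen: "generating_fields V G F"
    and \<phi>: "\<And>j n k. j \<in> idx F \<Longrightarrow> clinear (\<phi> j n k)" and \<psi>: "\<And>n k. clinear (\<psi> n k)"
    and i: "i \<in> idx F"
  shows "csubspace {v. phi_psi_relation V G F \<phi> \<psi> i \<beta> \<kappa> v}"
proof -
  have at: "clinear (at_idx \<phi> (nidx_pow F r i) n k)" for r n k
    by (rule clinear_at_idx) (use \<phi> nidx_pow_Some_idx[OF gen A i] in blast)
  have lin: "clinear (\<lambda>v. phi_psi_left F \<phi> i \<beta> S (\<lambda>n q. \<psi> n q v) m p n q - \<kappa> *\<^sub>C phi_psi_right V G F i \<beta> S \<psi> v m p n q)"
    for S m p n q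
    unfolding phi_psi_left_def phi_psi_right_def
    by (rule clinearI)
      (simp_all add: clinear_add[OF at] clinear_add[OF \<psi>] clinear_add[OF clinear_vfield[OF V]] clinear_scale[OF at]
        clinear_scale[OF \<psi>] clinear_scale[OF clinear_vfield[OF V]] scaleC_add_right sum.distrib scaleC_scaleC
        complex_vector.scale_sum_right complex_vector.scale_right_diff_distrib mult.commute mult.left_commute)
  define D where "D S m p n q v = phi_psi_left F \<phi> i \<beta> S (\<lambda>n q. \<psi> n q v) m p n q -
      \<kappa> *\<^sub>C phi_psi_right V G F i \<beta> S \<psi> v m p n q" for S m p n q v
  have lin: "clinear (D S m p n q)" for S m p n q
    using lin unfolding D_def[abs_def] .
  have eq: "{v. phi_psi_relation V G F \<phi> \<psi> i \<beta> \<kappa> v} = {v. \<forall>m p n q. \<exists>S0. \<forall>S\<ge>S0. D S m p n q v = 0}"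
    by (simp add: phi_psi_relation_def D_def)
  show ?thesis
    unfolding eq complex_vector.subspace_def mem_Collect_eq
  proof (intro conjI ballI allI)
    fix x y m p n q
    assume "x \<in> {v. \<forall>m p n q. \<exists>S0. \<forall>S\<ge>S0. D S m p n q v = 0}" "y \<in> {v. \<forall>m p n q. \<exists>S0. \<forall>S\<ge>S0. D S m p n q v = 0}"
    then obtain S1 S2 where "\<forall>S\<ge>S1. D S m p n q x = 0" "\<forall>S\<ge>S2. D S m p n q y = 0" by blast
    then have "\<forall>S\<ge>max S1 S2. D S m p n q (x + y) = 0"
      by (simp add: clinear_add[OF lin])
    then show "\<exists>S0. \<forall>S\<ge>S0. D S m p n q (x + y) = 0" by blast
  next
    fix c x m p n q
    assume "x \<in> {v. \<forall>m p n q. \<exists>S0. \<forall>S\<ge>S0. D S m p n q v = 0}"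
    then obtain S1 where "\<forall>S\<ge>S1. D S m p n q x = 0" by blast
    then have "\<forall>S\<ge>S1. D S m p n q (c *\<^sub>C x) = 0" by (simp add: clinear_scale[OF lin])
    then show "\<exists>S0. \<forall>S\<ge>S0. D S m p n q (c *\<^sub>C x) = 0" by blast
  qed (simp add: clinear_0[OF lin])
qed

section \<open>The quotient, its induced operators and its defining relations\<close>

locale Mhat_projection =
  fixes V :: "'v::complex_vector vsa" and G :: "'v g_act" and F :: "('i, 'v) gen_fields"
    and M :: "('a, 'm::complex_vector) mdata" and W :: "'w::complex_vector gspace_data"
    and E :: "('i, 'a, 'v, 'w) twisted_fields" and \<pi> :: "('v, 'm) free_space \<Rightarrow> 'w"
  assumes V: "vertex_superalgebra V" and A: "vsa_automorphism V G" and gen: "generating_fields V G F"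
    and M: "inducing_space M"
    and \<pi>: "clinear \<pi>" and surj: "\<pi> ` pre_space G F = UNIV"
    and ker: "\<forall>x\<in>pre_space G F. \<pi> x = 0 \<longleftrightarrow> x \<in> Mhat_relations V G F M"
    and ops: "\<forall>x\<in>pre_space G F.
         wL0 W (\<pi> x) = \<pi> (lmul UL0 x) \<and> wLm1 W (\<pi> x) = \<pi> (lmul ULm1 x) \<and>
         gop (wG W) (\<pi> x) = \<pi> (g_hat G M x) \<and> gN (wG W) (\<pi> x) = \<pi> (N_hat G M x) \<and>
         (\<forall>i\<in>idx F. \<forall>n k. phiW E i n k (\<pi> x) = \<pi> (phi_hat G F i n k x))"
    and aidx: "aidx E = midx M"
    and psi: "\<forall>a\<in>midx M. \<forall>n k. clinear (psiW E a n k) \<and>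
         (\<forall>\<alpha>\<in>g_exponents G. \<forall>v\<in>gspace G \<alpha>. psiW E a n k v = \<pi> (psi_hat G M a n k v))"
begin

lemmas g = vsa_automorphismD(1)[OF A]
lemmas N = g_actionD(3)[OF g]

lemma inducing_spaceD:
  shows "g_action (mG M)" "clinear (mL0 M)" "\<exists>LS. semisimple_nilpotent_parts (mL0 M) LS (mL0N M)"
    "cindependent (mw M ` midx M)" "cspan (mw M ` midx M) = UNIV"
    "\<forall>a\<in>midx M. mw M a \<in> gen_eigenspace (mL0 M) (mwt M a) \<and> mw M a \<in> mfer M (mwfer M a) \<and>
       (\<exists>\<alpha>\<in>strip. mw M a \<in> gspace (mG M) \<alpha>) \<and>
       (case mnidx M a of
          None \<Rightarrow> mL0N M (mw M a) = 0
        | Some b \<Rightarrow> b \<in> midx M \<and> mL0N M (mw M a) = mw M b)"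
  using M unfolding inducing_space_def by - (elim conjE, assumption)+

lemma subspace_pre: "csubspace (pre_space G F)"
  unfolding pre_space_def by (rule complex_vector.subspace_span)

lemma pre_cases: obtains x where "x \<in> pre_space G F" "w = \<pi> x"
proof -
  have "w \<in> \<pi> ` pre_space G F" unfolding surj by (rule UNIV_I)
  then show ?thesis using that by (rule imageE) simp
qed

text \<open>The kernel of \<open>\<pi>\<close> is prescribed on \<open>pre_space\<close> alone, so
  each relation used has to be shown to lie there; hence the closure lemmas for
  \<open>pre_space\<close> below.\<close>

lemma relation_imp_0:
  assumes "x \<in> linearity_relations G F \<union> U_relations V G F \<union> vacuum_relations V G M \<union>
     low_weight_relations V G F M \<union> phi_psi_relations V G F M \<union> L_psi_relations V G M"
    and "x \<in> pre_space G F"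
  shows "\<pi> x = 0"
proof -
  have "x \<in> Mhat_relations V G F M"
    unfolding Mhat_relations_def using assms(1) by (rule U_submodule.base)
  then show ?thesis using bspec[OF ker assms(2)] by simp
qed

lemma operator_clinear:
  assumes t: "clinear t" and T: "\<And>x. x \<in> pre_space G F \<Longrightarrow> T (\<pi> x) = \<pi> (t x)"
  shows "clinear T"
proof (rule clinearI)
  fix v w
  obtain x where x: "x \<in> pre_space G F" "v = \<pi> x" by (rule pre_cases)
  obtain y where y: "y \<in> pre_space G F" "w = \<pi> y" by (rule pre_cases)
  note xy = x y
  have "x + y \<in> pre_space G F" using xy by (intro complex_vector.subspace_add[OF subspace_pre])
  from T[OF this] show "T (v + w) = T v + T w"
    by (simp add: xy T clinear_add[OF t] clinear_add[OF \<pi>])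
next
  fix c v
  obtain x where x: "x \<in> pre_space G F" "v = \<pi> x" by (rule pre_cases)
  have "c *\<^sub>C x \<in> pre_space G F" using x by (intro complex_vector.subspace_scale[OF subspace_pre])
  from T[OF this] show "T (c *\<^sub>C v) = c *\<^sub>C T v"
    by (simp add: x T clinear_scale[OF t] clinear_scale[OF \<pi>])
qed

lemma clinear_wL0: "clinear (wL0 W)"
  by (rule operator_clinear[OF clinear_lmul]) (use ops in blast)

lemma clinear_wLm1: "clinear (wLm1 W)"
  by (rule operator_clinear[OF clinear_lmul]) (use ops in blast)

lemma clinear_phiW: "i \<in> idx F \<Longrightarrow> clinear (phiW E i n k)"
  by (rule operator_clinear[OF clinear_phi_hat]) (use ops in blast)

lemma clinear_psiW: "a \<in> midx M \<Longrightarrow> clinear (psiW E a n k)"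
  using psi by blast

lemma phiW_pi: "i \<in> idx F \<Longrightarrow> x \<in> pre_space G F \<Longrightarrow> phiW E i n k (\<pi> x) = \<pi> (phi_hat G F i n k x)"
  using ops by blast

lemma pre_spaceI: "set ws \<subseteq> letters G F \<Longrightarrow> twist_compatible G n v \<Longrightarrow> sym (ws, m, n, v) \<in> pre_space G F"
  unfolding pre_space_def by (rule complex_vector.span_base) blast

lemma lmul_pre:
  fixes x :: "('v, 'm) free_space"
  assumes "y \<in> letters G F" "x \<in> pre_space G F"
  shows "lmul y x \<in> pre_space G F"
proof (rule clinear_span_image[OF clinear_lmul assms(2)[unfolded pre_space_def] subspace_pre])
  fix z :: "('v, 'm) free_space"
  assume "z \<in> {sym (ws, m, n, v) | ws m n v. set ws \<subseteq> letters G F \<and> twist_compatible G n v}"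
  then obtain ws m n v where z: "z = sym (ws, m, n, v)" "set ws \<subseteq> letters G F" "twist_compatible G n v"
    by blast
  have "set (y # ws) \<subseteq> letters G F" using z(2) assms(1) by simp
  then show "lmul y z \<in> pre_space G F"
    using z(3) unfolding z(1) lmul_sym by (rule pre_spaceI)
qed

lemma subspace_Vhat: "csubspace (Vhat G F n)"
  unfolding Vhat_def by (rule complex_vector.subspace_span)

lemma Vhat_base: "i \<in> idx F \<Longrightarrow> n - falpha F i \<in> \<int> \<Longrightarrow> (gN G ^^ k) (phi F i) \<in> Vhat G F n"
  unfolding Vhat_def by (rule complex_vector.span_base) blast

lemma Fld_letters: "u \<in> Vhat G F n \<Longrightarrow> Fld u n \<in> letters G F"
  unfolding letters_def by blast

lemma UL_letters: "UL0 \<in> letters G F" "ULm1 \<in> letters G F"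
  unfolding letters_def by blast+

lemma phi_hat_pre:
  fixes x :: "('v, 'm) free_space"
  assumes "i \<in> idx F" "x \<in> pre_space G F"
  shows "phi_hat G F i n k x \<in> pre_space G F"
  using assms
  by (auto simp: phi_hat_def complex_vector.subspace_0[OF subspace_pre]
      intro!: lmul_pre Fld_letters complex_vector.subspace_scale[OF subspace_Vhat] Vhat_base)

lemma gspace_funpow:
  assumes "\<alpha> \<in> strip" "v \<in> gspace G \<alpha>"
  shows "(gN G ^^ k) v \<in> gspace G \<alpha>"
  by (induction k) (use assms gop_eq_exp(2)[OF g] in auto)

lemma subspace_gspace: "csubspace (gspace G \<alpha>)"
  unfolding gspace_def by (rule subspace_gen_eigenspace[OF g_actionD(1)[OF g]])

lemma twist_compatible_gN: "twist_compatible G n v \<Longrightarrow> twist_compatible G n (c *\<^sub>C (gN G ^^ k) v)"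
  unfolding twist_compatible_def
  using gspace_funpow complex_vector.subspace_scale[OF subspace_gspace] by (auto simp: g_exponents_def)

lemma psi_hat_pre: "psi_hat G M a n k v \<in> pre_space G F"
  by (auto simp: psi_hat_def complex_vector.subspace_0[OF subspace_pre] intro!: pre_spaceI twist_compatible_gN)

text \<open>\<open>psi_hat\<close> is set to 0 off the compatible vectors, whereas
  \<open>psiW\<close> is extended linearly, so for general \<open>v\<close> the two may differ; the
  former then contributes 0.\<close>

lemma psi_hat_pi_cases:
  assumes "a \<in> midx M"
  shows "\<pi> (psi_hat G M a n k v) = 0 \<or> \<pi> (psi_hat G M a n k v) = psiW E a n k v"
proof (cases "twist_compatible G n v")
  case True
  then show ?thesis using psi assms by (auto simp: twist_compatible_def)
next
  case False
  then have "psi_hat G M a n k v = 0" by (simp add: psi_hat_def)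
  then show ?thesis using clinear_0[OF \<pi>] by simp
qed

lemma psi_hat_pi:
  "a \<in> midx M \<Longrightarrow> \<alpha> \<in> g_exponents G \<Longrightarrow> v \<in> gspace G \<alpha> \<Longrightarrow> \<pi> (psi_hat G M a n k v) = psiW E a n k v"
  using psi by simp

lemma psi_hat_0 [simp]: "psi_hat G M a n k 0 = 0"
  by (simp add: psi_hat_def clinear_0[OF clinear_funpow[OF N]])

lemma vac_exponent:
  assumes "vac V \<noteq> 0"
  shows "0 \<in> g_exponents G" "vac V \<in> gspace G 0"
proof -
  have e: "e2pi 0 = 1" using e2pi_of_int[of 0] by simp
  show "0 \<in> g_exponents G"
    using assms vsa_automorphismD(3)[OF A] by (auto simp: g_exponents_def strip_def e scaleC_one)
  show "vac V \<in> gspace G 0"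
    unfolding gspace_def
    by (rule gen_eigenspaceI[where k = 1]) (simp add: vsa_automorphismD(3)[OF A] e scaleC_one)
qed

lemma psiW_vac:
  assumes a: "a \<in> midx M"
  shows "psiW E a n k (vac V) = \<pi> (psi_hat G M a n k (vac V))"
proof (cases "vac V = 0")
  case True
  then show ?thesis by (simp add: clinear_0[OF \<pi>] clinear_0[OF clinear_psiW[OF a]])
qed (use psi_hat_pi[OF a] vac_exponent in simp)

text \<open>Logarithms are excluded by \<open>gN_vac\<close>, all modes that are not negative
  integers by the vacuum relations.\<close>

lemma psiW_vac_support:
  assumes a: "a \<in> midx M" and nz: "psiW E a n k (vac V) \<noteq> 0"
  shows "k = 0 \<and> (\<exists>m::nat. n = - of_nat m - 1)"
proof -
  have k: "k = 0"
  proof (rule ccontr)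
    assume "k \<noteq> 0"
    then obtain k' where "k = Suc k'" by (metis nat.exhaust)
    then have "(gN G ^^ k) (vac V) = (gN G ^^ k') (gN G (vac V))" by (simp add: funpow_swap1)
    then have "(gN G ^^ k) (vac V) = 0"
      by (simp add: gN_vac[OF A] clinear_0[OF clinear_funpow[OF N]])
    then have "psi_hat G M a n k (vac V) = 0" by (simp add: psi_hat_def)
    then show False using nz by (simp add: psiW_vac[OF a] clinear_0[OF \<pi>])
  qed
  moreover have "\<exists>m::nat. n = - of_nat m - 1"
  proof (rule ccontr)
    assume "\<not> ?thesis"
    then have "psi_hat G M a n 0 (vac V) \<in> vacuum_relations V G M"
      using a unfolding vacuum_relations_def by blast
    then have "\<pi> (psi_hat G M a n 0 (vac V)) = 0"
      by (intro relation_imp_0 psi_hat_pre) blast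
    then show False using nz k by (simp add: psiW_vac[OF a])
  qed
  ultimately show ?thesis ..
qed

lemma ddx_pre: "(\<And>n k. f n k \<in> pre_space G F) \<Longrightarrow> ddx f n k \<in> pre_space G F"
  unfolding ddx_def by (intro complex_vector.subspace_add[OF subspace_pre] complex_vector.subspace_scale[OF subspace_pre])

lemma xddx_pre: "(\<And>n k. f n k \<in> pre_space G F) \<Longrightarrow> xddx f n k \<in> pre_space G F"
  unfolding xddx_def by (intro complex_vector.subspace_add[OF subspace_pre] complex_vector.subspace_scale[OF subspace_pre])

lemma ddx_pi: "\<pi> (ddx f n k) = ddx (\<lambda>n k. \<pi> (f n k)) n k"
  by (simp only: ddx_def clinear_add[OF \<pi>] clinear_scale[OF \<pi>])

lemma xddx_pi: "\<pi> (xddx f n k) = xddx (\<lambda>n k. \<pi> (f n k)) n k"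
  by (simp only: xddx_def clinear_add[OF \<pi>] clinear_scale[OF \<pi>])

lemmas pre_intros = complex_vector.subspace_diff[OF subspace_pre] complex_vector.subspace_scale[OF subspace_pre]
  lmul_pre UL_letters psi_hat_pre phi_hat_pre ddx_pre xddx_pre

lemma Lm1_psi:
  assumes a: "a \<in> midx M" and v: "\<alpha> \<in> g_exponents G" "v \<in> gspace G \<alpha>"
  shows "wLm1 W (psiW E a n k v) = \<pi> (psi_hat G M a n k (vLm1 V v)) + ddx (\<lambda>n k. psiW E a n k v) n k"
proof -
  have "lmul ULm1 (psi_hat G M a n k v) - psi_hat G M a n k (vLm1 V v) - ddx (\<lambda>n k. psi_hat G M a n k v) n k
      \<in> L_psi_relations V G M"
    unfolding L_psi_relations_def using a v by blast
  then have "\<pi> (lmul ULm1 (psi_hat G M a n k v) - psi_hat G M a n k (vLm1 V v) - ddx (\<lambda>n k. psi_hat G M a n k v) n k) = 0"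
    by (intro relation_imp_0 pre_intros) blast
  moreover have "wLm1 W (psiW E a n k v) = \<pi> (lmul ULm1 (psi_hat G M a n k v))"
    using ops psi_hat_pre by (simp add: psi_hat_pi[OF a v, symmetric])
  ultimately show ?thesis
    by (simp add: clinear_diff[OF \<pi>] clinear_add[OF \<pi>] ddx_pi psi_hat_pi[OF a v] algebra_simps)
qed

lemma at_idx_psi_hat_pre: "at_idx (psi_hat G M) b n k v \<in> pre_space G F"
  by (cases b) (simp_all add: psi_hat_pre complex_vector.subspace_0[OF subspace_pre])

lemma L0_psi:
  assumes a: "a \<in> midx M" and v: "\<alpha> \<in> g_exponents G" "v \<in> gspace G \<alpha>"
  shows "wL0 W (psiW E a n k v) = \<pi> (psi_hat G M a n k (vL0 V v)) + xddx (\<lambda>n k. psiW E a n k v) n k +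
    mwt M a *\<^sub>C psiW E a n k v + at_idx (psiW E) (mnidx M a) n k v"
proof -
  let ?x = "lmul UL0 (psi_hat G M a n k v) - psi_hat G M a n k (vL0 V v) - xddx (\<lambda>n k. psi_hat G M a n k v) n k
      - mwt M a *\<^sub>C psi_hat G M a n k v - at_idx (psi_hat G M) (mnidx M a) n k v"
  have "?x \<in> L_psi_relations V G M"
    unfolding L_psi_relations_def using a v by blast
  then have "\<pi> ?x = 0"
    by (intro relation_imp_0 pre_intros at_idx_psi_hat_pre) blast
  moreover have "wL0 W (psiW E a n k v) = \<pi> (lmul UL0 (psi_hat G M a n k v))"
    using ops psi_hat_pre by (simp add: psi_hat_pi[OF a v, symmetric])
  moreover have "\<pi> (at_idx (psi_hat G M) (mnidx M a) n k v) = at_idx (psiW E) (mnidx M a) n k v"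
  proof (cases "mnidx M a")
    case (Some b)
    then have "b \<in> midx M" using inducing_spaceD(6) a by force
    then show ?thesis by (simp add: Some psi_hat_pi[OF _ v])
  qed (simp add: clinear_0[OF \<pi>])
  ultimately show ?thesis
    by (simp add: clinear_diff[OF \<pi>] clinear_add[OF \<pi>] clinear_scale[OF \<pi>] xddx_pi psi_hat_pi[OF a v] algebra_simps)
qed

lemma Lm1_psi_vac:
  assumes a: "a \<in> midx M"
  shows "wLm1 W (psiW E a n k (vac V)) = ddx (\<lambda>n k. psiW E a n k (vac V)) n k"
proof (cases "vac V = 0")
  case True
  then show ?thesis by (simp add: clinear_0[OF clinear_psiW[OF a]] clinear_0[OF clinear_wLm1] ddx_def)
next
  case False
  from Lm1_psi[OF a vac_exponent[OF False]] show ?thesis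
    by (simp add: vsa_Lm1_vac[OF V] clinear_0[OF \<pi>])
qed

lemma semisimple_part_on_gen_eigenspace:
  assumes "x \<in> gen_eigenspace (mL0 M) c"
  shows "mL0N M x = mL0 M x - c *\<^sub>C x" "mL0N M x \<in> gen_eigenspace (mL0 M) c"
proof -
  obtain LS where LS: "semisimple_nilpotent_parts (mL0 M) LS (mL0N M)" using inducing_spaceD(3) ..
  have "mL0 M x = LS x + mL0N M x" "LS x = c *\<^sub>C x"
    using LS assms unfolding semisimple_nilpotent_parts_def by blast+
  then show e: "mL0N M x = mL0 M x - c *\<^sub>C x" by simp
  obtain k where "((\<lambda>y. mL0 M y - c *\<^sub>C y) ^^ k) x = 0" using assms by (auto simp: gen_eigenspace_def)
  then have "((\<lambda>y. mL0 M y - c *\<^sub>C y) ^^ Suc k) x = 0"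
    by (rule funpow_zero_mono[OF clinear_diff_scale[OF inducing_spaceD(2)]]) simp
  then show "mL0N M x \<in> gen_eigenspace (mL0 M) c"
    unfolding e by (intro gen_eigenspaceI[where k = k]) (simp only: funpow_Suc_right o_apply)
qed

text \<open>The generation argument needs generators that are generalized eigenvectors of
  \<open>wL0 W\<close>. On the vacuum, \<open>wL0 W - mwt M a\<close> sends the vector of
  \<open>a\<close> to that of \<open>mnidx M a\<close>; this chain follows \<open>mL0N M\<close> on
  the basis of \<open>M\<close> and therefore stops.\<close>

lemma psi_vac_gen_eigenspace:
  assumes "a \<in> midx M"
  shows "psiW E a (-1) 0 (vac V) \<in> gen_eigenspace (wL0 W) (mwt M a)"
proof (cases "vac V = 0")
  case True
  then show ?thesis
    by (simp add: clinear_0[OF clinear_psiW[OF assms]] gen_eigenspace_0[OF clinear_wL0])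
next
  case False
  note v = vac_exponent[OF False]
  obtain LS where LS: "semisimple_nilpotent_parts (mL0 M) LS (mL0N M)" using inducing_spaceD(3) ..
  then have nil: "locally_nilpotent (mL0N M)" "clinear (mL0N M)" and gr: "graded UNIV (gen_eigenspace (mL0 M))"
    unfolding semisimple_nilpotent_parts_def by blast+
  have L0v: "vL0 V (vac V) = 0"
  proof -
    have "vac V \<in> vwt V 0"
      unfolding vwt_def using vertex_superalgebraD(2)[OF V] by (intro complex_vector.span_base) blast
    then show ?thesis using vertex_superalgebraD(7)[OF V] by (auto dest: spec[of _ 0])
  qed
  have ne: "mw M a \<noteq> 0" if "a \<in> midx M" for a
    using inducing_spaceD(4) that complex_vector.dependent_zero by (metis imageI)
  show ?thesis
    using assms
  proof (induction "nilpotency_degree (mL0N M) (mw M a)" arbitrary: a rule: less_induct)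
    case less
    have z: "psiW E a (-1) (Suc 0) (vac V) = 0"
      using psiW_vac_support[OF less.prems, of "-1" "Suc 0"] by auto
    have e: "wL0 W (psiW E a (-1) 0 (vac V)) - mwt M a *\<^sub>C psiW E a (-1) 0 (vac V) =
        at_idx (psiW E) (mnidx M a) (-1) 0 (vac V)"
      by (simp add: L0_psi[OF less.prems v] L0v clinear_0[OF \<pi>] xddx_def z)
    have "at_idx (psiW E) (mnidx M a) (-1) 0 (vac V) \<in> gen_eigenspace (wL0 W) (mwt M a)"
    proof (cases "mnidx M a")
      case None
      then show ?thesis by (simp add: gen_eigenspace_0[OF clinear_wL0])
    next
      case (Some b)
      then have b: "b \<in> midx M" "mL0N M (mw M a) = mw M b"
        using inducing_spaceD(6) less.prems by force+
      have "nilpotency_degree (mL0N M) (mL0N M (mw M a)) < nilpotency_degree (mL0N M) (mw M a)"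
        by (rule nilpotency_degree_less[OF nil(1) _ nil(2)]) (use ne b in simp)
      then have IH: "psiW E b (-1) 0 (vac V) \<in> gen_eigenspace (wL0 W) (mwt M b)"
        using less.hyps b by simp
      have m: "mw M b \<in> gen_eigenspace (mL0 M) (mwt M a)" "mw M b \<in> gen_eigenspace (mL0 M) (mwt M b)"
        using semisimple_part_on_gen_eigenspace(2)[of "mw M a" "mwt M a"] inducing_spaceD(6) less.prems b by force+
      \<comment> \<open>The basis vector of \<open>b\<close> is nonzero and lies in the generalized
        eigenspaces for both numbers.\<close>
      have "mwt M b = mwt M a"
      proof (rule ccontr)
        assume neq: "mwt M b \<noteq> mwt M a"
        have "mw M b \<in> cspan (\<Union>k\<in>{mwt M a} \<inter> {mwt M b}. gen_eigenspace (mL0 M) k)"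
          by (rule graded_span_Int[OF gr]) (use m in \<open>auto intro: complex_vector.span_base\<close>)
        then show False using neq ne[OF b(1)] by simp
      qed
      then show ?thesis using IH by (simp add: Some)
    qed
    then show ?case unfolding e[symmetric] by (rule gen_eigenspace_step)
  qed
qed

end

section \<open>Products of field coefficients span the quotient\<close>

context Mhat_projection
begin

text \<open>The span in Property 4, still to be proved for the quotient: elements of
  \<open>U\<close> may also contain \<open>UL0\<close>, \<open>ULm1\<close> and arbitrary letters
  from \<open>Vhat\<close>, all of which must be seen to preserve it.\<close>

definition T where
  "T = cspan {field_product (phiW E) xs (psiW E a n l v) | xs a n l v. (\<forall>(i, n, k)\<in>set xs. i \<in> idx F) \<and> a \<in> midx M}"

lemma subspace_T: "csubspace T"
  unfolding T_def by (rule complex_vector.subspace_span)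

lemma psiW_T: "a \<in> midx M \<Longrightarrow> psiW E a n k v \<in> T"
  unfolding T_def by (rule complex_vector.span_base, rule CollectI, intro exI[of _ "[]"]) auto

lemma phiW_T:
  assumes i: "i \<in> idx F" and x: "x \<in> T"
  shows "phiW E i n k x \<in> T"
proof (rule clinear_span_image[OF clinear_phiW[OF i] x[unfolded T_def] subspace_T])
  fix y assume "y \<in> {field_product (phiW E) xs (psiW E a n l v) | xs a n l v. (\<forall>(i, n, k)\<in>set xs. i \<in> idx F) \<and> a \<in> midx M}"
  then obtain xs a m l v where y: "y = field_product (phiW E) xs (psiW E a m l v)"
    "\<forall>(i, n, k)\<in>set xs. i \<in> idx F" "a \<in> midx M" by blast
  have "phiW E i n k y = field_product (phiW E) ((i, n, k) # xs) (psiW E a m l v)"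
    "\<forall>(i, n, k)\<in>set ((i, n, k) # xs). i \<in> idx F" using y i by simp_all
  then show "phiW E i n k y \<in> T"
    unfolding T_def using y(3) by (intro complex_vector.span_base) blast
qed

lemma ddx_T: "(\<And>n k. f n k \<in> T) \<Longrightarrow> ddx f n k \<in> T"
  unfolding ddx_def by (intro complex_vector.subspace_add[OF subspace_T] complex_vector.subspace_scale[OF subspace_T])

lemma xddx_T: "(\<And>n k. f n k \<in> T) \<Longrightarrow> xddx f n k \<in> T"
  unfolding xddx_def by (intro complex_vector.subspace_add[OF subspace_T] complex_vector.subspace_scale[OF subspace_T])

lemmas T_intros = complex_vector.subspace_add[OF subspace_T] complex_vector.subspace_scale[OF subspace_T]
  psiW_T phiW_T ddx_T xddx_T

lemma psi_hat_T: "a \<in> midx M \<Longrightarrow> \<pi> (psi_hat G M a n k v) \<in> T"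
  using psi_hat_pi_cases psiW_T complex_vector.subspace_0[OF subspace_T] by metis

lemma L0_phiW:
  assumes i: "i \<in> idx F"
  shows "wL0 W (phiW E i n k w) = phiW E i n k (wL0 W w) + xddx (\<lambda>n k. phiW E i n k w) n k +
    of_real (fwt F i) *\<^sub>C phiW E i n k w"
proof -
  obtain x where x: "x \<in> pre_space G F" "w = \<pi> x" by (rule pre_cases)
  let ?r = "lmul UL0 (phi_hat G F i n k x) - phi_hat G F i n k (lmul UL0 x) -
       xddx (\<lambda>n k. phi_hat G F i n k x) n k - of_real (fwt F i) *\<^sub>C phi_hat G F i n k x"
  have "?r \<in> U_relations V G F"
    unfolding U_relations_def using i x(1) by blast
  then have "\<pi> ?r = 0"
    by (intro relation_imp_0 pre_intros x i) blast
  moreover have "wL0 W (phiW E i n k w) = \<pi> (lmul UL0 (phi_hat G F i n k x))"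
    using ops phi_hat_pre[OF i x(1)] by (simp add: x phiW_pi[OF i])
  moreover have "phiW E i n k (wL0 W w) = \<pi> (phi_hat G F i n k (lmul UL0 x))"
    using ops lmul_pre[OF UL_letters(1) x(1)] x by (simp add: phiW_pi[OF i])
  ultimately show ?thesis
    by (simp add: clinear_diff[OF \<pi>] clinear_add[OF \<pi>] clinear_scale[OF \<pi>] xddx_pi phiW_pi[OF i] x algebra_simps)
qed

lemma Lm1_phiW:
  assumes i: "i \<in> idx F"
  shows "wLm1 W (phiW E i n k w) = phiW E i n k (wLm1 W w) + ddx (\<lambda>n k. phiW E i n k w) n k"
proof -
  obtain x where x: "x \<in> pre_space G F" "w = \<pi> x" by (rule pre_cases)
  let ?r = "lmul ULm1 (phi_hat G F i n k x) - phi_hat G F i n k (lmul ULm1 x) -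
       ddx (\<lambda>n k. phi_hat G F i n k x) n k"
  have "?r \<in> U_relations V G F"
    unfolding U_relations_def using i x(1) by blast
  then have "\<pi> ?r = 0"
    by (intro relation_imp_0 pre_intros x i) blast
  moreover have "wLm1 W (phiW E i n k w) = \<pi> (lmul ULm1 (phi_hat G F i n k x))"
    using ops phi_hat_pre[OF i x(1)] by (simp add: x phiW_pi[OF i])
  moreover have "phiW E i n k (wLm1 W w) = \<pi> (phi_hat G F i n k (lmul ULm1 x))"
    using ops lmul_pre[OF UL_letters(2) x(1)] x by (simp add: phiW_pi[OF i])
  ultimately show ?thesis
    by (simp add: clinear_diff[OF \<pi>] clinear_add[OF \<pi>] ddx_pi phiW_pi[OF i] x algebra_simps)
qed

text \<open>For \<open>L(0)\<close> and \<open>L(-1)\<close> the hypotheses hold because their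
  commutators with the fields are again coefficients of fields; the operator is moved to the right
  through a word.\<close>

lemma operator_T:
  assumes L: "clinear L"
    and L\<psi>: "\<And>a n k \<alpha> v. a \<in> midx M \<Longrightarrow> \<alpha> \<in> g_exponents G \<Longrightarrow> v \<in> gspace G \<alpha> \<Longrightarrow> L (psiW E a n k v) \<in> T"
    and L\<phi>: "\<And>i n k y. i \<in> idx F \<Longrightarrow> y \<in> T \<Longrightarrow> L y \<in> T \<Longrightarrow> L (phiW E i n k y) \<in> T"
    and x: "x \<in> T"
  shows "L x \<in> T"
proof (rule clinear_span_image[OF L x[unfolded T_def] subspace_T])
  fix y assume "y \<in> {field_product (phiW E) xs (psiW E a n l v) | xs a n l v. (\<forall>(i, n, k)\<in>set xs. i \<in> idx F) \<and> a \<in> midx M}"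
  then obtain xs a m l v where y: "y = field_product (phiW E) xs (psiW E a m l v)"
    "\<forall>(i, n, k)\<in>set xs. i \<in> idx F" "a \<in> midx M" by blast
  have "clinear (\<lambda>v. L (psiW E a m l v))"
    by (rule clinearI) (simp_all add: clinear_add[OF L] clinear_scale[OF L] clinear_add[OF clinear_psiW[OF y(3)]]
        clinear_scale[OF clinear_psiW[OF y(3)]])
  then have base: "L (psiW E a m l v) \<in> T"
    by (rule clinear_span_image[OF _ gspace_exponents_span[OF g] subspace_T]) (use L\<psi>[OF y(3)] in blast)
  have "field_product (phiW E) xs (psiW E a m l v) \<in> T \<and> L (field_product (phiW E) xs (psiW E a m l v)) \<in> T"
    using y(2) by (induction xs) (auto simp: base intro: psiW_T[OF y(3)] phiW_T L\<phi>)
  then show "L y \<in> T" unfolding y(1) ..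
qed

lemma wL0_T:
  assumes "x \<in> T"
  shows "wL0 W x \<in> T"
proof (rule operator_T[OF clinear_wL0 _ _ assms])
  fix a n k \<alpha> v assume *: "a \<in> midx M" "\<alpha> \<in> g_exponents G" "v \<in> gspace G \<alpha>"
  have "at_idx (psiW E) (mnidx M a) n k v \<in> T"
    using inducing_spaceD(6) *(1) psiW_T complex_vector.subspace_0[OF subspace_T]
    by (cases "mnidx M a") force+
  then show "wL0 W (psiW E a n k v) \<in> T"
    unfolding L0_psi[OF *] by (intro T_intros psi_hat_T *)
qed (simp add: L0_phiW T_intros)

lemma wLm1_T:
  assumes "x \<in> T"
  shows "wLm1 W x \<in> T"
proof (rule operator_T[OF clinear_wLm1 _ _ assms])
  fix a n k \<alpha> v assume *: "a \<in> midx M" "\<alpha> \<in> g_exponents G" "v \<in> gspace G \<alpha>"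
  show "wLm1 W (psiW E a n k v) \<in> T"
    unfolding Lm1_psi[OF *] by (intro T_intros psi_hat_T *)
qed (simp add: Lm1_phiW T_intros)

lemma linearity_pi:
  assumes "z \<in> linearity_relations G F" "z \<in> pre_space G F"
  shows "\<pi> z = 0"
  by (rule relation_imp_0[OF _ assms(2)]) (use assms(1) in blast)

lemma lmul_linear_pi:
  assumes u: "u \<in> Vhat G F n" "u' \<in> Vhat G F n" and x: "x \<in> pre_space G F"
  shows "\<pi> (lmul (Fld (a *\<^sub>C u + b *\<^sub>C u') n) x) = a *\<^sub>C \<pi> (lmul (Fld u n) x) + b *\<^sub>C \<pi> (lmul (Fld u' n) x)"
proof -
  let ?r = "lmul (Fld (a *\<^sub>C u + b *\<^sub>C u') n) x - a *\<^sub>C lmul (Fld u n) x - b *\<^sub>C lmul (Fld u' n) x"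
  have "?r \<in> linearity_relations G F"
    unfolding linearity_relations_def using u x by blast
  moreover have "a *\<^sub>C u + b *\<^sub>C u' \<in> Vhat G F n"
    using u by (intro complex_vector.subspace_add[OF subspace_Vhat] complex_vector.subspace_scale[OF subspace_Vhat])
  then have "?r \<in> pre_space G F"
    by (intro pre_intros Fld_letters u x)
  ultimately have "\<pi> ?r = 0" by (rule linearity_pi)
  then show ?thesis by (simp add: clinear_diff[OF \<pi>] clinear_add[OF \<pi>] clinear_scale[OF \<pi>] algebra_simps)
qed

lemma lmul_0_pi:
  assumes "x \<in> pre_space G F"
  shows "\<pi> (lmul (Fld 0 n) x) = 0"
  using lmul_linear_pi[of 0 n 0 x 0 0] assms complex_vector.subspace_0[OF subspace_Vhat] by simp

text \<open>Modulo the linearity relations a letter is a combination of letters with vector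
  \<open>\<N>\<^sub>g^k \<phi>^i\<close>, and each of these is, up to the factor
  \<open>(-1) ^ k / fact k\<close>, the letter in the coefficient of \<open>(log x)^k\<close> of
  \<open>phi_hat\<close>. So the logarithmic coefficients account for all of
  \<open>Vhat\<close>.\<close>

lemma lmul_Fld_T:
  assumes u: "u \<in> Vhat G F n" and x: "x \<in> pre_space G F" "\<pi> x \<in> T"
  shows "\<pi> (lmul (Fld u n) x) \<in> T"
proof -
  let ?X = "{u \<in> Vhat G F n. \<pi> (lmul (Fld u n) x) \<in> T}"
  have sub: "csubspace ?X"
    unfolding complex_vector.subspace_def
  proof (intro conjI ballI allI)
    show "0 \<in> ?X"
      using lmul_0_pi[OF x(1)] complex_vector.subspace_0[OF subspace_T] complex_vector.subspace_0[OF subspace_Vhat] by simp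
    fix u u' assume *: "u \<in> ?X" "u' \<in> ?X"
    show "u + u' \<in> ?X"
      using * lmul_linear_pi[of u n u' x 1 1] x(1) complex_vector.subspace_add[OF subspace_Vhat]
        complex_vector.subspace_add[OF subspace_T] by (simp add: scaleC_one)
  next
    fix c u assume *: "u \<in> ?X"
    show "c *\<^sub>C u \<in> ?X"
      using * lmul_linear_pi[of u n u x c 0] x(1) complex_vector.subspace_scale[OF subspace_Vhat]
        complex_vector.subspace_scale[OF subspace_T] by simp
  qed
  have "{(gN G ^^ k) (phi F i) | k i. i \<in> idx F \<and> n - falpha F i \<in> \<int>} \<subseteq> ?X"
  proof
    fix u assume "u \<in> {(gN G ^^ k) (phi F i) | k i. i \<in> idx F \<and> n - falpha F i \<in> \<int>}"
    then obtain k i where u: "u = (gN G ^^ k) (phi F i)" "i \<in> idx F" "n - falpha F i \<in> \<int>" by blast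
    define c :: complex where "c = (-1) ^ k / fact k"
    have c: "c \<noteq> 0" by (simp add: c_def)
    have uV: "u \<in> Vhat G F n" unfolding u(1) by (rule Vhat_base[OF u(2,3)])
    have "\<pi> (lmul (Fld u n) x) \<in> T"
    proof (cases "u = 0")
      case True
      then show ?thesis using lmul_0_pi[OF x(1)] complex_vector.subspace_0[OF subspace_T] by simp
    next
      case False
      have "phi_hat G F i n k x = lmul (Fld (c *\<^sub>C u) n) x"
        using u False by (simp add: phi_hat_def c_def)
      then have "\<pi> (lmul (Fld (c *\<^sub>C u) n) x) = phiW E i n k (\<pi> x)"
        by (simp add: phiW_pi[OF u(2) x(1)])
      then have "c *\<^sub>C \<pi> (lmul (Fld u n) x) = phiW E i n k (\<pi> x)"
        using lmul_linear_pi[OF uV uV x(1), of c 0] by simp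
      then have "c *\<^sub>C \<pi> (lmul (Fld u n) x) \<in> T" using phiW_T[OF u(2) x(2)] by simp
      from complex_vector.subspace_scale[OF subspace_T this, of "1 / c"] show ?thesis
        using c by (simp add: scaleC_scaleC scaleC_one del: scaleC_complex)
    qed
    then show "u \<in> ?X" using uV by blast
  qed
  then have "Vhat G F n \<subseteq> ?X"
    unfolding Vhat_def by (rule complex_vector.span_minimal) (use sub in \<open>simp add: Vhat_def\<close>)
  then show ?thesis using u by blast
qed

lemma sym_Nil_T:
  assumes tc: "twist_compatible G n v"
  shows "\<pi> (sym ([], m, n, v)) \<in> T"
proof -
  have pre: "sym ([], m, n, v) \<in> pre_space G F" if "twist_compatible G n v" for m :: 'm and v
    by (rule pre_spaceI) (use that in simp_all)
  have lin: "\<pi> (sym ([], a *\<^sub>C m + b *\<^sub>C m', n, v)) = a *\<^sub>C \<pi> (sym ([], m, n, v)) + b *\<^sub>C \<pi> (sym ([], m', n, v))"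
    for a b m m'
  proof -
    have "\<pi> (sym ([], a *\<^sub>C m + b *\<^sub>C m', n, v) - a *\<^sub>C sym ([], m, n, v) - b *\<^sub>C sym ([], m', n, v)) = 0"
    proof (rule linearity_pi)
      show "sym ([], a *\<^sub>C m + b *\<^sub>C m', n, v) - a *\<^sub>C sym ([], m, n, v) - b *\<^sub>C sym ([], m', n, v)
          \<in> linearity_relations G F"
        unfolding linearity_relations_def using tc by blast
    qed (intro pre_intros pre tc)
    then show ?thesis by (simp add: clinear_diff[OF \<pi>] clinear_add[OF \<pi>] clinear_scale[OF \<pi>] algebra_simps)
  qed
  have "clinear (\<lambda>m. \<pi> (sym ([], m, n, v)))"
    by (rule clinearI) (use lin[of 1 _ 1] lin[of _ _ 0 0] in \<open>simp_all add: scaleC_one\<close>)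
  then show ?thesis
  proof (rule clinear_span_image[OF _ _ subspace_T])
    show "m \<in> cspan (mw M ` midx M)" by (simp add: inducing_spaceD(5))
    fix y assume "y \<in> mw M ` midx M"
    then obtain a where a: "a \<in> midx M" "y = mw M a" by blast
    show "\<pi> (sym ([], y, n, v)) \<in> T"
    \<comment> \<open>\<open>psi_hat\<close> replaces a symbol with zero vector by 0, so here the
      symbol itself is shown to vanish by a linearity relation.\<close>
    proof (cases "v = 0")
      case True
      have tc0: "twist_compatible G n 0" using tc True by simp
      have "sym ([], y, n, 0 *\<^sub>C 0 + 0 *\<^sub>C 0) - 0 *\<^sub>C sym ([], y, n, 0) - 0 *\<^sub>C sym ([], y, n, 0)
          \<in> linearity_relations G F"
        unfolding linearity_relations_def using tc0 by blast
      then have "\<pi> (sym ([], y, n, 0)) = 0"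
        using linearity_pi[of "sym ([], y, n, 0)"] pre[OF tc0] by simp
      then show ?thesis using True complex_vector.subspace_0[OF subspace_T] by simp
    next
      case False
      then have "sym ([], y, n, v) = psi_hat G M a n 0 v"
        using tc by (simp add: psi_hat_def a(2) scaleC_one)
      then show ?thesis using psi_hat_T[OF a(1)] by simp
    qed
  qed
qed

lemma T_eq_UNIV: "T = UNIV"
proof -
  have gen: "\<pi> (sym (ws, m, n, v)) \<in> T" if "set ws \<subseteq> letters G F" "twist_compatible G n v" for ws m n v
    using that(1)
  proof (induction ws)
    case Nil
    show ?case by (rule sym_Nil_T[OF that(2)])
  next
    case (Cons y ws)
    have pre: "sym (ws, m, n, v) \<in> pre_space G F" using Cons.prems that(2) by (intro pre_spaceI) simp_all
    have IH: "\<pi> (sym (ws, m, n, v)) \<in> T" using Cons by simp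
    have "y \<in> letters G F" using Cons.prems by simp
    then consider "y = UL0" | "y = ULm1" | u r where "y = Fld u r" "u \<in> Vhat G F r"
      unfolding letters_def by blast
    then have "\<pi> (lmul y (sym (ws, m, n, v))) \<in> T"
    proof cases
      case 1
      then show ?thesis using wL0_T[OF IH] ops pre by simp
    next
      case 2
      then show ?thesis using wLm1_T[OF IH] ops pre by simp
    next
      case 3
      then show ?thesis using lmul_Fld_T[OF _ pre IH] by simp
    qed
    then show ?case by simp
  qed
  have "\<pi> x \<in> T" if "x \<in> pre_space G F" for x
    by (rule clinear_span_image[OF \<pi> that[unfolded pre_space_def] subspace_T]) (use gen in blast)
  then have "w \<in> T" for w by (metis pre_cases)
  then show ?thesis by blast
qed

end

text \<open>The automorphism preserves each \<open>vgr V h s\<close>, so its generalized eigenspaces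
  are spanned by their intersections with these.\<close>

lemma homogeneous_span:
  assumes V: "vertex_superalgebra V" and A: "vsa_automorphism V G"
  shows "v \<in> cspan {v. \<exists>h s. \<exists>\<alpha>\<in>g_exponents G. 2 * h \<in> \<int> \<and> v \<in> vgr V h s \<and> v \<in> gspace G \<alpha>}"
    (is "_ \<in> cspan ?H")
proof -
  note g = vsa_automorphismD(1)[OF A]
  have "(\<Union>\<alpha>\<in>g_exponents G. gspace G \<alpha>) \<subseteq> cspan ?H"
  proof
    fix x assume "x \<in> (\<Union>\<alpha>\<in>g_exponents G. gspace G \<alpha>)"
    then obtain \<alpha> where \<alpha>: "\<alpha> \<in> g_exponents G" "x \<in> gen_eigenspace (gop G) (e2pi \<alpha>)"
      unfolding gspace_def by blast
    have st: "gop G x \<in> (case k of (n, s) \<Rightarrow> vgr V n s)"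
      if "k \<in> {n. 2 * n \<in> \<int>} \<times> UNIV" "x \<in> (case k of (n, s) \<Rightarrow> vgr V n s)" for k x
      using that vsa_automorphismD(2)[OF A] by auto
    have "x \<in> cspan (\<Union>k\<in>{n. 2 * n \<in> \<int>} \<times> UNIV. (case k of (n, s) \<Rightarrow> vgr V n s) \<inter> gen_eigenspace (gop G) (e2pi \<alpha>))"
      by (rule graded_gen_eigenspace_span[OF vertex_superalgebraD(1)[OF V] g_actionD(1)[OF g] st \<alpha>(2)])
    also have "\<dots> \<subseteq> cspan ?H"
      by (rule complex_vector.span_mono) (use \<alpha>(1) in \<open>auto simp: gspace_def\<close>)
    finally show "x \<in> cspan ?H" .
  qed
  then have "cspan (\<Union>\<alpha>\<in>g_exponents G. gspace G \<alpha>) \<subseteq> cspan ?H"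
    by (rule complex_vector.span_minimal) (rule complex_vector.subspace_span)
  then show ?thesis using gspace_exponents_span[OF g] by blast
qed

section \<open>Property 7 in the quotient\<close>

context Mhat_projection
begin

lemma psiW_low_weight:
  assumes a: "a \<in> midx M" and h: "2 * h \<in> \<int>" "v \<in> vgr V h s" and v: "\<alpha> \<in> g_exponents G" "v \<in> gspace G \<alpha>"
    and low: "Re (mwt M a - n - 1 + of_real h) < mB M"
  shows "psiW E a n k v = 0"
proof -
  have "psi_hat G M a n k v = field_product (phi_hat G F) []
      ((lmul UL0 ^^ 0) ((lmul ULm1 ^^ 0) (psi_hat G M a n k v)))"
    by simp
  moreover have "Re (sum_list (map (\<lambda>(i, n, k). of_real (fwt F i) - n - 1) []) + of_nat 0 + mwt M a - n - 1
             + of_real h) < mB M"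
    using low by simp
  moreover have "\<forall>(i, n, k)\<in>set []. i \<in> idx F" by simp
  ultimately have "psi_hat G M a n k v \<in> low_weight_relations V G F M"
    unfolding low_weight_relations_def mem_Collect_eq using a h v by (intro exI conjI) assumption+
  then have "\<pi> (psi_hat G M a n k v) = 0"
    by (intro relation_imp_0 psi_hat_pre) blast
  then show ?thesis using psi_hat_pi[OF a v] by simp
qed

lemma psi_hat_pi_strip:
  assumes a: "a \<in> midx M" and "\<gamma> \<in> strip" "y \<in> gspace G \<gamma>"
  shows "\<pi> (psi_hat G M a n k y) = psiW E a n k y"
proof (cases "y = 0")
  case True
  then show ?thesis by (simp add: clinear_0[OF \<pi>] clinear_0[OF clinear_psiW[OF a]])
next
  case False
  then show ?thesis using psi_hat_pi[OF a g_exponentsI] assms by blast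
qed

lemma at_idx_phi_hat:
  assumes i: "i \<in> idx F" and x: "x \<in> pre_space G F"
  shows "at_idx (phi_hat G F) (nidx_pow F r i) n k x \<in> pre_space G F"
    and "\<pi> (at_idx (phi_hat G F) (nidx_pow F r i) n k x) = at_idx (phiW E) (nidx_pow F r i) n k (\<pi> x)"
proof -
  have "at_idx (phi_hat G F) (nidx_pow F r i) n k x \<in> pre_space G F \<and>
    \<pi> (at_idx (phi_hat G F) (nidx_pow F r i) n k x) = at_idx (phiW E) (nidx_pow F r i) n k (\<pi> x)"
  proof (cases "nidx_pow F r i")
    case (Some j)
    then have "j \<in> idx F" by (rule nidx_pow_Some_idx[OF gen g i])
    then show ?thesis using x by (simp add: Some phi_hat_pre phiW_pi)
  qed (simp add: clinear_0[OF \<pi>] complex_vector.subspace_0[OF subspace_pre])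
  then show "at_idx (phi_hat G F) (nidx_pow F r i) n k x \<in> pre_space G F"
    and "\<pi> (at_idx (phi_hat G F) (nidx_pow F r i) n k x) = at_idx (phiW E) (nidx_pow F r i) n k (\<pi> x)"
    by blast+
qed

lemma phi_psi_left_pi:
  assumes i: "i \<in> idx F" and \<Psi>: "\<And>n q. \<Psi> n q \<in> pre_space G F"
  shows "phi_psi_left F (phi_hat G F) i \<beta> S \<Psi> m p n q \<in> pre_space G F"
    and "\<pi> (phi_psi_left F (phi_hat G F) i \<beta> S \<Psi> m p n q) =
      phi_psi_left F (phiW E) i \<beta> S (\<lambda>n q. \<pi> (\<Psi> n q)) m p n q"
proof -
  show "phi_psi_left F (phi_hat G F) i \<beta> S \<Psi> m p n q \<in> pre_space G F"
    unfolding phi_psi_left_def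
    by (intro complex_vector.subspace_sum[OF subspace_pre] complex_vector.subspace_scale[OF subspace_pre]
        at_idx_phi_hat(1)[OF i] \<Psi>)
  show "\<pi> (phi_psi_left F (phi_hat G F) i \<beta> S \<Psi> m p n q) =
      phi_psi_left F (phiW E) i \<beta> S (\<lambda>n q. \<pi> (\<Psi> n q)) m p n q"
    unfolding phi_psi_left_def clinear_sum[OF \<pi>] clinear_scale[OF \<pi>]
    by (simp only: at_idx_phi_hat(2)[OF i \<Psi>])
qed

text \<open>The vectors to which \<open>psi_hat\<close> is applied all lie in one generalized
  eigenspace of \<open>g\<close>, that of \<open>\<gamma>\<close>, where the image of
  \<open>psi_hat\<close> under \<open>\<pi>\<close> is \<open>psiW\<close>.\<close>

lemma twisted_product_right_pi:
  assumes i: "i \<in> idx F" and a: "a \<in> midx M" and v: "\<alpha> \<in> g_exponents G" "v \<in> gspace G \<alpha>"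
  shows "twisted_product_right \<beta> (gN G) (vfield V (phi F i)) (psi_hat G M a) v m p n q \<in> pre_space G F"
    and "\<pi> (twisted_product_right \<beta> (gN G) (vfield V (phi F i)) (psi_hat G M a) v m p n q) =
      twisted_product_right \<beta> (gN G) (vfield V (phi F i)) (psiW E a) v m p n q"
proof -
  show "twisted_product_right \<beta> (gN G) (vfield V (phi F i)) (psi_hat G M a) v m p n q \<in> pre_space G F"
    unfolding twisted_product_right_def mult_minus_x2_plus_x1_def case_prod_unfold
    by (intro Sum_any_in_subspace[OF subspace_pre] complex_vector.subspace_sum[OF subspace_pre]
        complex_vector.subspace_scale[OF subspace_pre] psi_hat_pre)
  have "e2pi (falpha F i) * e2pi \<alpha> \<noteq> 0" by simp
  then obtain \<gamma> where \<gamma>: "\<gamma> \<in> strip" "e2pi \<gamma> = e2pi (falpha F i) * e2pi \<alpha>" by (rule strip_representative)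
  have "vfield V (phi F i) m p ((gN G ^^ k) v) \<in> gspace G \<gamma>" for m p k
  proof -
    have "(gN G ^^ k) v \<in> gspace G \<alpha>" using gspace_funpow v by (simp add: g_exponents_def)
    then have "vY V (phi F i) l ((gN G ^^ k) v) \<in> gspace G \<gamma>" for l
      using generating_fieldsD(3)[OF gen i] unfolding gspace_def \<gamma>(2) by (intro gspace_vY[OF V A]) simp_all
    then show ?thesis by (simp add: vfield_def complex_vector.subspace_0[OF subspace_gspace])
  qed
  then have "(gN G ^^ j) (vfield V (phi F i) m p ((gN G ^^ k) v)) \<in> gspace G \<gamma>" for j m p k
    using gspace_funpow[OF \<gamma>(1)] by blast
  then have e: "\<pi> (psi_hat G M a n q ((gN G ^^ j) (vfield V (phi F i) m p ((gN G ^^ k) v)))) =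
      psiW E a n q ((gN G ^^ j) (vfield V (phi F i) m p ((gN G ^^ k) v)))" for n q j m p k
    by (rule psi_hat_pi_strip[OF a \<gamma>(1)])
  have "\<pi> (twisted_product_right \<beta> (gN G) (vfield V (phi F i)) (psi_hat G M a) v m p n q) =
      twisted_product_right \<beta> (gN G) (vfield V (phi F i)) (\<lambda>n q x. \<pi> (psi_hat G M a n q x)) v m p n q"
    by (rule twisted_product_right_image[where \<Psi> = "psi_hat G M a", OF g_actionD(3,5)[OF g] clinear_vfield[OF V] vfield_eventually_0[OF V] psi_hat_0 \<pi>])
  also have "\<dots> = twisted_product_right \<beta> (gN G) (vfield V (phi F i)) (psiW E a) v m p n q"
    unfolding twisted_product_right_def mult_minus_x2_plus_x1_def by (simp only: e)
  finally show "\<pi> (twisted_product_right \<beta> (gN G) (vfield V (phi F i)) (psi_hat G M a) v m p n q) =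
      twisted_product_right \<beta> (gN G) (vfield V (phi F i)) (psiW E a) v m p n q" .
qed

text \<open>The cut series \<open>\<Psi>\<close> is the one in the defining relation. Being
  truncated already in the free space, it allows the regrouping there; under \<open>\<pi>\<close> it
  becomes the full series, as the omitted terms are zero by the low weight relations.\<close>

lemma relation_homogeneous:
  assumes i: "i \<in> idx F" and a: "a \<in> midx M" and h: "2 * h \<in> \<int>" "v \<in> vgr V h s"
    and v: "\<alpha> \<in> g_exponents G" "v \<in> gspace G \<alpha>"
  shows "phi_psi_relation V G F (phiW E) (psiW E a) i (falpha F i + of_nat (M_phi_psi F M i a))
    (koszul (ffer F i) (mwfer M a)) v"
  unfolding phi_psi_relation_def
proof (intro allI)
  fix m p n q
  define \<beta> where "\<beta> = falpha F i + of_nat (M_phi_psi F M i a)"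
  define \<kappa> where "\<kappa> = koszul (ffer F i) (mwfer M a)"
  define \<Psi> where "\<Psi> n k = (if Re (mwt M a - n - 1 + of_real h) < mB M then 0 else psi_hat G M a n k v)" for n k
  have pre: "\<Psi> n k \<in> pre_space G F" for n k
    by (simp add: \<Psi>_def psi_hat_pre complex_vector.subspace_0[OF subspace_pre])
  have pi: "\<pi> (\<Psi> n k) = psiW E a n k v" for n k
    using psiW_low_weight[OF a h v] psi_hat_pi[OF a v] by (simp add: \<Psi>_def clinear_0[OF \<pi>])
  \<comment> \<open>For \<open>s\<close> at least this large the coefficient at \<open>n + s\<close>
    has weight below \<open>mB M\<close>.\<close>
  define S1 where "S1 = nat \<lceil>Re (mwt M a - n - 1 + of_real h) - mB M\<rceil> + 1"
  have tr: "\<Psi> (n + of_nat s) q = 0" if "S1 \<le> s" for s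
  proof -
    have "Re (mwt M a - (n + of_nat s) - 1 + of_real h) < mB M" using that by (simp add: S1_def) linarith
    then show ?thesis by (simp add: \<Psi>_def)
  qed
  let ?L = "twisted_product_left \<beta> (N_hat G M) (phi_hat G F i) \<Psi> m p n q"
  let ?R = "twisted_product_right \<beta> (gN G) (vfield V (phi F i)) (psi_hat G M a) v m p n q"
  have L: "?L = phi_psi_left F (phi_hat G F) i \<beta> S \<Psi> m p n q" if "S1 \<le> S" for S
    by (rule phi_psi_left_eq[where N = "N_hat G M" and \<phi> = "phi_hat G F" and \<Psi> = \<Psi> and n = n and q = q,
          OF g gen clinear_N_hat locally_nilpotent_N_hat[OF g inducing_spaceD(1)] clinear_phi_hat
          N_hat_phi_hat[OF g gen] i tr]) (use that in auto)
  have "?L - \<kappa> *\<^sub>C ?R \<in> phi_psi_relations V G F M"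
    unfolding phi_psi_relations_def \<Psi>_def \<beta>_def \<kappa>_def using i a h v by blast
  moreover have "?L - \<kappa> *\<^sub>C ?R \<in> pre_space G F"
    unfolding L[OF order.refl]
    by (intro complex_vector.subspace_diff[OF subspace_pre] complex_vector.subspace_scale[OF subspace_pre]
        phi_psi_left_pi(1)[OF i pre] twisted_product_right_pi(1)[OF i a v])
  ultimately have "\<pi> (?L - \<kappa> *\<^sub>C ?R) = 0"
    by (intro relation_imp_0) blast
  then have eq: "\<pi> ?L = \<kappa> *\<^sub>C twisted_product_right \<beta> (gN G) (vfield V (phi F i)) (psiW E a) v m p n q"
    by (simp add: clinear_diff[OF \<pi>] clinear_scale[OF \<pi>] twisted_product_right_pi(2)[OF i a v])
  obtain S0 where S0: "\<And>S. S0 \<le> S \<Longrightarrow>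
      twisted_product_right \<beta> (gN G) (vfield V (phi F i)) (psiW E a) v m p n q =
      phi_psi_right V G F i \<beta> S (psiW E a) v m p n q"
    using phi_psi_right_eq[where \<psi> = "psiW E a", OF V A gen clinear_psiW[OF a] i] by blast
  have "phi_psi_left F (phiW E) i \<beta> S (\<lambda>n q. psiW E a n q v) m p n q =
      \<kappa> *\<^sub>C phi_psi_right V G F i \<beta> S (psiW E a) v m p n q" if "max S0 S1 \<le> S" for S
  proof -
    have "phi_psi_left F (phiW E) i \<beta> S (\<lambda>n q. psiW E a n q v) m p n q =
        \<pi> (phi_psi_left F (phi_hat G F) i \<beta> S \<Psi> m p n q)"
      by (simp add: phi_psi_left_pi(2)[OF i pre] pi)
    also have "\<dots> = \<pi> ?L" using that L[of S] by simp
    finally show ?thesis using that by (simp add: eq S0)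
  qed
  then show "\<exists>S0. \<forall>S\<ge>S0. phi_psi_left F (phiW E) i (falpha F i + of_nat (M_phi_psi F M i a)) S (\<lambda>n q. psiW E a n q v) m p n q =
      koszul (ffer F i) (mwfer M a) *\<^sub>C
      phi_psi_right V G F i (falpha F i + of_nat (M_phi_psi F M i a)) S (psiW E a) v m p n q"
    unfolding \<beta>_def \<kappa>_def by blast
qed

lemma relation:
  assumes i: "i \<in> idx F" and a: "a \<in> midx M"
  shows "\<exists>\<beta> \<kappa>. \<kappa> \<noteq> 0 \<and> (\<forall>v. phi_psi_relation V G F (phiW E) (psiW E a) i \<beta> \<kappa> v)"
proof (intro exI conjI allI)
  fix v
  let ?X = "{v. phi_psi_relation V G F (phiW E) (psiW E a) i (falpha F i + of_nat (M_phi_psi F M i a))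
    (koszul (ffer F i) (mwfer M a)) v}"
  have "csubspace ?X"
    by (rule csubspace_phi_psi_relation[OF V g gen clinear_phiW clinear_psiW[OF a] i])
  then have "cspan {v. \<exists>h s. \<exists>\<alpha>\<in>g_exponents G. 2 * h \<in> \<int> \<and> v \<in> vgr V h s \<and> v \<in> gspace G \<alpha>} \<subseteq> ?X"
    by (intro complex_vector.span_minimal) (use relation_homogeneous[OF i a] in blast)
  then show "phi_psi_relation V G F (phiW E) (psiW E a) i (falpha F i + of_nat (M_phi_psi F M i a))
    (koszul (ffer F i) (mwfer M a)) v"
    using homogeneous_span[OF V A, of v] by blast
qed simp

lemma phiW_support:
  assumes i: "i \<in> idx F" and nz: "phiW E i n k w \<noteq> 0"
  shows "n - falpha F i \<in> \<int> \<and> k \<le> fK F i"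
proof -
  obtain x where x: "x \<in> pre_space G F" "w = \<pi> x" by (rule pre_cases)
  have "phi_hat G F i n k x \<noteq> 0"
    using nz x clinear_0[OF \<pi>] by (auto simp: phiW_pi[OF i])
  then have *: "n - falpha F i \<in> \<int>" "(gN G ^^ k) (phi F i) \<noteq> 0"
    by (auto simp: phi_hat_def split: if_splits)
  then have "k \<le> fK F i"
    using funpow_zero_mono[OF N generating_fieldsD(6)[OF gen i], of k] by force
  with * show ?thesis by blast
qed

lemma field_products_span:
  "cspan {field_product (phiW E) xs ((wLm1 W ^^ k) (psiW E a (-1) 0 (vac V))) | xs k a.
           (\<forall>(i, n, l)\<in>set xs. i \<in> idx F \<and> n - falpha F i \<in> \<int> \<and> l \<le> fK F i) \<and> a \<in> aidx E} = UNIV"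
  unfolding aidx
  by (rule cspan_field_products_eq_UNIV[OF V g gen clinear_phiW phiW_support clinear_psiW clinear_wLm1
        psiW_vac_support Lm1_psi_vac relation T_eq_UNIV[unfolded T_def]])

end

lemma is_MhatE:
  assumes "vertex_superalgebra V" "vsa_automorphism V G" "generating_fields V G F"
    and "inducing_space M" "is_Mhat V G F M W E"
  obtains \<pi> where "Mhat_projection V G F M W E \<pi>"
  using assms unfolding is_Mhat_def by (elim exE conjE) (rule that, rule Mhat_projection.intro, assumption+)

section \<open>Generation by twisted vertex operators\<close>

text \<open>Expanding \<open>(p + 1)^k\<close> turns the hypothesis into a polynomial in
  \<open>p\<close> whose coefficient \<open>c j\<close> is \<open>(\<nu> - 1) *\<^sub>C x j\<close>
  plus multiples of higher \<open>x k\<close>. Descending induction gives \<open>x k\<close> from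
  \<open>c k\<close> if \<open>\<nu> \<noteq> 1\<close>. If \<open>\<nu> = 1\<close> the first term
  is lost and \<open>c (k - 1)\<close>, which begins with \<open>k *\<^sub>C x k\<close>, takes its
  place; this leaves out \<open>k = 0\<close>.\<close>

lemma difference_coeffs_in_subspace:
  fixes x :: "nat \<Rightarrow> 'a::complex_vector"
  assumes X: "csubspace X"
    and diff: "\<And>p::nat. \<nu> *\<^sub>C (\<Sum>k\<le>K. of_nat (Suc p) ^ k *\<^sub>C x k) - (\<Sum>k\<le>K. of_nat p ^ k *\<^sub>C x k) \<in> X"
    and k: "k \<le> K" "\<nu> \<noteq> 1 \<or> k \<noteq> 0"
  shows "x k \<in> X"
proof -
  define c where "c j = \<nu> *\<^sub>C (\<Sum>k\<le>K. of_nat (k choose j) *\<^sub>C x k) - x j" for j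
  have "(\<Sum>j\<le>K. of_nat p ^ j *\<^sub>C c j) \<in> X" for p :: nat
  proof -
    have pw: "(of_nat (Suc p) :: complex) ^ k = (\<Sum>j\<le>K. of_nat p ^ j * of_nat (k choose j))" if "k \<le> K" for k
    proof -
      have "(of_nat (Suc p) :: complex) ^ k = (of_nat p + 1) ^ k" by (simp add: add.commute)
      also have "\<dots> = (\<Sum>j\<le>k. of_nat p ^ j * of_nat (k choose j))"
        unfolding binomial_ring by (rule sum.cong) simp_all
      also have "\<dots> = (\<Sum>j\<le>K. of_nat p ^ j * of_nat (k choose j))"
        by (rule sum.mono_neutral_left) (use that in auto)
      finally show ?thesis .
    qed
    have "(\<Sum>k\<le>K. of_nat (Suc p) ^ k *\<^sub>C x k) = (\<Sum>k\<le>K. \<Sum>j\<le>K. (of_nat p ^ j * of_nat (k choose j)) *\<^sub>C x k)"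
      by (rule sum.cong[OF refl]) (simp only: pw atMost_iff complex_vector.scale_sum_left)
    also have "\<dots> = (\<Sum>j\<le>K. of_nat p ^ j *\<^sub>C (\<Sum>k\<le>K. of_nat (k choose j) *\<^sub>C x k))"
      by (subst sum.swap) (simp only: complex_vector.scale_sum_right scaleC_scaleC)
    finally have "(\<Sum>j\<le>K. of_nat p ^ j *\<^sub>C c j) =
      \<nu> *\<^sub>C (\<Sum>k\<le>K. of_nat (Suc p) ^ k *\<^sub>C x k) - (\<Sum>k\<le>K. of_nat p ^ k *\<^sub>C x k)"
      by (simp add: c_def complex_vector.scale_right_diff_distrib sum_subtractf complex_vector.scale_sum_right
          scaleC_scaleC mult.left_commute)
    then show ?thesis using diff by simp
  qed
  then have c: "c j \<in> X" if "j \<le> K" for j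
    using poly_coeffs_in_subspace[OF X _ that] by blast
  show ?thesis
    using k
  proof (induction "K - k" arbitrary: k rule: less_induct)
    case less
    have IH: "x k' \<in> X" if "k < k'" "k' \<le> K" for k'
      using less.hyps[of k'] that less.prems by auto
    show ?case
    proof (cases "\<nu> = 1")
      case False
      have "(\<Sum>k'\<le>K. of_nat (k' choose k) *\<^sub>C x k') = x k + (\<Sum>k'\<in>{..K} - {k}. of_nat (k' choose k) *\<^sub>C x k')"
        using less.prems by (subst sum.remove[of _ k]) (simp_all add: scaleC_one)
      then have e: "c k = (\<nu> - 1) *\<^sub>C x k + \<nu> *\<^sub>C (\<Sum>k'\<in>{..K} - {k}. of_nat (k' choose k) *\<^sub>C x k')"
        by (simp add: c_def scaleC_add_right complex_vector.scale_left_diff_distrib scaleC_one)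
      have "of_nat (k' choose k) *\<^sub>C x k' \<in> X" if "k' \<in> {..K} - {k}" for k'
      proof (cases "k' < k")
        case True
        then show ?thesis by (simp add: binomial_eq_0 complex_vector.subspace_0[OF X])
      next
        case False
        then show ?thesis using that by (intro complex_vector.subspace_scale[OF X] IH) auto
      qed
      then have s: "\<nu> *\<^sub>C (\<Sum>k'\<in>{..K} - {k}. of_nat (k' choose k) *\<^sub>C x k') \<in> X"
        by (rule complex_vector.subspace_scale[OF X complex_vector.subspace_sum[OF X]])
      have "(\<nu> - 1) *\<^sub>C x k \<in> X"
        by (rule sum_in_subspace_cancel[OF X _ s]) (use c[OF less.prems(1)] e in simp)
      from complex_vector.subspace_scale[OF X this, of "1 / (\<nu> - 1)"] show ?thesis
        using False by (simp add: scaleC_scaleC scaleC_one)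
    next
      case True
      then obtain k0 where k0: "k = Suc k0" using less.prems by (metis nat.exhaust)
      have "(\<Sum>k'\<le>K. of_nat (k' choose k0) *\<^sub>C x k') =
          x k0 + (of_nat (Suc k0) *\<^sub>C x k + (\<Sum>k'\<in>{..K} - {k0} - {k}. of_nat (k' choose k0) *\<^sub>C x k'))"
        using less.prems k0 by (subst sum.remove[of _ k0], simp, simp, subst sum.remove[of _ k]) (simp_all add: scaleC_one)
      then have e: "c k0 = of_nat (Suc k0) *\<^sub>C x k + (\<Sum>k'\<in>{..K} - {k0} - {k}. of_nat (k' choose k0) *\<^sub>C x k')"
        by (simp add: c_def True scaleC_one)
      have "of_nat (k' choose k0) *\<^sub>C x k' \<in> X" if "k' \<in> {..K} - {k0} - {k}" for k'
      proof (cases "k' < k0")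
        case True
        then show ?thesis by (simp add: binomial_eq_0 complex_vector.subspace_0[OF X])
      next
        case False
        then show ?thesis using that k0 by (intro complex_vector.subspace_scale[OF X] IH) auto
      qed
      then have s: "(\<Sum>k'\<in>{..K} - {k0} - {k}. of_nat (k' choose k0) *\<^sub>C x k') \<in> X"
        by (rule complex_vector.subspace_sum[OF X])
      have "of_nat (Suc k0) *\<^sub>C x k \<in> X"
        by (rule sum_in_subspace_cancel[OF X _ s]) (use c[of k0] less.prems k0 e in simp)
      from complex_vector.subspace_scale[OF X this, of "1 / of_nat (Suc k0)"] show ?thesis
        by (simp add: scaleC_scaleC scaleC_one del: of_nat_Suc)
    qed
  qed
qed

text \<open>Convergence at \<open>9/10\<close> bounds the radius of convergence from below, and the
  sum vanishes on a real set with limit point \<open>7/10\<close> inside the disc, so the identity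
  theorem applies. Both numbers are just interior points of the interval.\<close>

lemma powser_zero_on_interval:
  fixes a :: "nat \<Rightarrow> complex"
  assumes "\<And>x::real. 1/2 < x \<Longrightarrow> x < 1 \<Longrightarrow> (\<lambda>j. a j * of_real x ^ j) sums 0"
  shows "a j = 0"
proof -
  define A where "A = Abs_fps a"
  let ?B = "ball 0 (9/10) :: complex set"
  have "summable (\<lambda>j. a j * (of_real (9/10)) ^ j)"
    using assms[of "9/10"] by (intro sums_summable) simp
  then have "conv_radius a \<ge> norm (of_real (9/10) :: complex)"
    by (rule conv_radius_geI)
  then have rad: "fps_conv_radius A \<ge> ereal (9/10)"
    unfolding fps_conv_radius_def A_def by (simp add: norm_of_real del: of_real_divide of_real_numeral)
  have hol: "eval_fps A holomorphic_on ?B"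
  proof (rule holomorphic_on_eval_fps)
    show "?B \<subseteq> eball 0 (fps_conv_radius A)" by (rule ball_eball_mono[OF rad])
  qed
  have zero: "eval_fps A z = 0" if "z \<in> of_real ` {1/2<..<9/10}" for z
  proof -
    from that obtain x :: real where x: "z = of_real x" "x \<in> {1/2<..<9/10}" by (rule imageE)
    have "(\<lambda>j. a j * z ^ j) sums 0" using assms[of x] x by simp
    then show ?thesis unfolding eval_fps_def A_def by (simp add: sums_unique[symmetric])
  qed
  have lim: "(of_real (7/10) :: complex) islimpt of_real ` {1/2<..<9/10::real}"
    unfolding islimpt_approachable
  proof (intro allI impI)
    fix e :: real assume "e > 0"
    define d where "d = min (e / 2) (1 / 10)"
    have "dist (of_real (7/10 + d) :: complex) (of_real (7/10)) = \<bar>7/10 + d - 7/10\<bar>"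
      by (simp only: dist_of_real dist_real_def)
    also have "\<dots> < e" using \<open>e > 0\<close> by (simp add: d_def min_def)
    finally have "dist (of_real (7/10 + d) :: complex) (of_real (7/10)) < e" .
    moreover have "(of_real (7/10 + d) :: complex) \<noteq> of_real (7/10)"
      using \<open>e > 0\<close> by (simp only: of_real_eq_iff) (simp add: d_def min_def)
    moreover have "7/10 + d \<in> {1/2<..<9/10}" using \<open>e > 0\<close> by (auto simp: d_def min_def)
    ultimately show "\<exists>x'\<in>of_real ` {1/2<..<9/10::real}. x' \<noteq> (of_real (7/10) :: complex) \<and> dist x' (of_real (7/10)) < e"
      by blast
  qed
  have "eval_fps A z = 0" if "z \<in> ?B" for z
    by (rule analytic_continuation[OF hol _ _ _ _ lim zero that]) (auto simp: norm_of_real simp del: of_real_divide of_real_numeral)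
  then have "eventually (\<lambda>z. eval_fps A z = eval_fps 0 z) (nhds 0)"
    by (intro eventually_nhds_in_open[of ?B, THEN eventually_mono]) (auto simp: eval_fps_0)
  then have "A = 0"
    using rad by (intro eval_fps_eqD) (auto intro: less_le_trans[of 0 "ereal (9/10)"])
  then show ?thesis by (metis A_def fps_nth_Abs_fps fps_zero_nth)
qed

section \<open>Weights and logarithms of twisted vertex operators\<close>

lemma twisted_moduleD:
  assumes "twisted_module V G W Y"
  shows "lower_bounded_space W"
    and "\<forall>w. wL0 W (wLm1 W w) - wLm1 W (wL0 W w) = wLm1 W w"
    and "\<forall>v w n k. clinear (Y v n k) \<and> clinear (\<lambda>u. Y u n k w)"
    and "\<forall>v w. \<exists>K. \<forall>n k. k > K \<longrightarrow> Y v n k w = 0"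
    and "\<forall>n k w. Y (vac V) n k w = (if n = -1 \<and> k = 0 then w else 0)"
    and "\<forall>v n k w. gop (wG W) (Y v n k w) = Y (gop G v) n k (gop (wG W) w)"
    and "\<forall>v n k w. wL0 W (Y v n k w) - Y v n k (wL0 W w) = xddx (\<lambda>n k. Y v n k w) n k + Y (vL0 V v) n k w"
    and "\<forall>p z v n w. z \<noteq> 0 \<longrightarrow> vo_branch Y (p + 1) (gop G v) z n w = vo_branch Y p v z n w"
    and "duality V W Y"
  using assms unfolding twisted_module_def by - (elim conjE, assumption)+

locale twisted_module_operators =
  fixes V :: "'v::complex_vector vsa" and G :: "'v g_act"
    and W :: "'w::complex_vector gspace_data" and Y :: "('v, 'w) twisted_vo"
  assumes V: "vertex_superalgebra V" and A: "vsa_automorphism V G" and tm: "twisted_module V G W Y"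
begin

lemmas g = vsa_automorphismD(1)[OF A]
lemmas N = g_actionD(3,5)[OF g]
lemmas lb = twisted_moduleD(1)[OF tm]
lemmas L0 = lower_bounded_spaceD(5)[OF lb]

lemma Y2: "clinear (Y v n k)" and Y1: "clinear (\<lambda>u. Y u n k w)"
  using twisted_moduleD(3)[OF tm] by blast+

lemma Y_log_bound: obtains K where "\<And>n k. k > K \<Longrightarrow> Y v n k w = 0"
  using twisted_moduleD(4)[OF tm] by blast

text \<open>By the commutator with \<open>wL0 W\<close>, the operator
  \<open>wL0 W - (c + h - n - 1)\<close> sends the coefficient at \<open>k\<close> to one with
  \<open>w\<close> of lower order plus a multiple of the one at \<open>k + 1\<close>. Hence an
  induction on the order of \<open>w\<close> and, inside it, a descending one on \<open>k\<close>
  from the bound on logarithms.\<close>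

lemma Y_weight:
  assumes v: "vL0 V v = h *\<^sub>C v" and w: "w \<in> gen_eigenspace (wL0 W) c"
  shows "Y v n k w \<in> gen_eigenspace (wL0 W) (c + h - n - 1)"
proof -
  let ?D = "\<lambda>y. wL0 W y - c *\<^sub>C y" and ?E = "gen_eigenspace (wL0 W) (c + h - n - 1)"
  note E = subspace_gen_eigenspace[OF L0, of "c + h - n - 1"]
  have "\<forall>k. Y v n k w \<in> ?E" if "(?D ^^ i) w = 0" for i w
    using that
  proof (induction i arbitrary: w)
    case 0
    then show ?case by (simp add: clinear_0[OF Y2] complex_vector.subspace_0[OF E])
  next
    case (Suc i)
    then have "(?D ^^ i) (?D w) = 0" by (simp only: funpow_Suc_right o_apply)
    then have IH: "Y v n k (?D w) \<in> ?E" for k using Suc.IH by blast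
    obtain K where K: "\<And>n k. k > K \<Longrightarrow> Y v n k w = 0" using Y_log_bound by blast
    have "Y v n k w \<in> ?E" for k
    proof (induction "Suc K - k" arbitrary: k rule: less_induct)
      case less
      show ?case
      proof (cases "k > K")
        case False
        then have IH2: "Y v n (Suc k) w \<in> ?E" using less[of "Suc k"] by simp
        have "wL0 W (Y v n k w) = Y v n k (wL0 W w) + xddx (\<lambda>n k. Y v n k w) n k + Y (h *\<^sub>C v) n k w"
          using twisted_moduleD(7)[OF tm] by (simp add: algebra_simps flip: v)
        also have "\<dots> = Y v n k (?D w) + c *\<^sub>C Y v n k w + xddx (\<lambda>n k. Y v n k w) n k + h *\<^sub>C Y v n k w"
          by (simp add: clinear_diff[OF Y2] clinear_scale[OF Y2] clinear_scale[OF Y1])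
        finally have "wL0 W (Y v n k w) - (c + h - n - 1) *\<^sub>C Y v n k w =
            Y v n k (?D w) + of_nat (Suc k) *\<^sub>C Y v n (Suc k) w"
          by (simp add: xddx_def scaleC_add_left complex_vector.scale_left_diff_distrib
              complex_vector.scale_minus_left)
        then have "wL0 W (Y v n k w) - (c + h - n - 1) *\<^sub>C Y v n k w \<in> ?E"
          using complex_vector.subspace_add[OF E IH complex_vector.subspace_scale[OF E IH2]] by simp
        then show ?thesis by (rule gen_eigenspace_step)
      qed (simp add: K complex_vector.subspace_0[OF E])
    qed
    then show ?case by blast
  qed
  then show ?thesis using w by (auto simp: gen_eigenspace_def)
qed

lemma lp_1: "lp p 1 = 2 * of_real pi * \<i> * of_int p"
  using Arg2pi_of_real[of 1] by (simp add: lp_def)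

text \<open>At \<open>z = 1\<close> the branch \<open>p\<close> substitutes \<open>2\<pi>ip\<close>
  for the logarithm, so equivariance becomes an identity between polynomials in
  \<open>p\<close>.\<close>

lemma equivariance_at_1:
  assumes K: "\<And>n k. k > K \<Longrightarrow> Y v n k w = 0" "\<And>n k. k > K \<Longrightarrow> Y (gop G v) n k w = 0"
  shows "e2pi (- n) *\<^sub>C (\<Sum>k\<le>K. of_nat (Suc p) ^ k *\<^sub>C ((2 * of_real pi * \<i>) ^ k *\<^sub>C Y (gop G v) n k w)) =
    (\<Sum>k\<le>K. of_nat p ^ k *\<^sub>C ((2 * of_real pi * \<i>) ^ k *\<^sub>C Y v n k w))"
proof -
  have br: "vo_branch Y (int p) v 1 n w = e2pi ((- n - 1) * of_nat p) *\<^sub>C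
      (\<Sum>k\<le>K. of_nat p ^ k *\<^sub>C ((2 * of_real pi * \<i>) ^ k *\<^sub>C Y v n k w))"
    if "\<And>n k. k > K \<Longrightarrow> Y v n k w = 0" for p v
  proof -
    have "vo_branch Y (int p) v 1 n w = (\<Sum>k\<le>K. (exp ((- n - 1) * lp (int p) 1) * lp (int p) 1 ^ k) *\<^sub>C Y v n k w)"
      unfolding vo_branch_def branch_def
      by (rule Sum_any.expand_superset) (use that in \<open>auto simp: not_less[symmetric]\<close>)
    also have "exp ((- n - 1) * lp (int p) 1) = e2pi ((- n - 1) * of_nat p)"
      by (simp add: lp_1 e2pi_def mult_ac)
    finally show ?thesis
      by (simp add: lp_1 complex_vector.scale_sum_right scaleC_scaleC power_mult_distrib mult_ac)
  qed
  have "vo_branch Y (int (Suc p)) (gop G v) 1 n w = vo_branch Y (int p) v 1 n w"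
    using twisted_moduleD(8)[OF tm] by (simp add: add.commute[of 1])
  then have "e2pi ((- n - 1) * of_nat (Suc p)) *\<^sub>C
      (\<Sum>k\<le>K. of_nat (Suc p) ^ k *\<^sub>C ((2 * of_real pi * \<i>) ^ k *\<^sub>C Y (gop G v) n k w)) =
    e2pi ((- n - 1) * of_nat p) *\<^sub>C
      (\<Sum>k\<le>K. of_nat p ^ k *\<^sub>C ((2 * of_real pi * \<i>) ^ k *\<^sub>C Y v n k w))"
    by (simp only: br[OF K(1)] br[OF K(2)])
  moreover have "e2pi ((- n - 1) * of_nat (Suc p)) = e2pi ((- n - 1) * of_nat p) * e2pi (- n)"
  proof -
    have "e2pi (- 1) = 1" using e2pi_of_int[of "-1"] by simp
    then have "e2pi (- n) = e2pi (- n - 1)" using e2pi_add[of "- n" "- 1"] by simp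
    then show ?thesis by (simp add: distrib_left e2pi_add mult.commute)
  qed
  ultimately have "e2pi ((- n - 1) * of_nat p) *\<^sub>C (e2pi (- n) *\<^sub>C
      (\<Sum>k\<le>K. of_nat (Suc p) ^ k *\<^sub>C ((2 * of_real pi * \<i>) ^ k *\<^sub>C Y (gop G v) n k w))) =
    e2pi ((- n - 1) * of_nat p) *\<^sub>C
      (\<Sum>k\<le>K. of_nat p ^ k *\<^sub>C ((2 * of_real pi * \<i>) ^ k *\<^sub>C Y v n k w))"
    by (simp only: scaleC_scaleC)
  then show ?thesis by (simp only: complex_vector.scale_cancel_left e2pi_nonzero) simp
qed

text \<open>
  By equivariance, \<open>Y(v, x)\<close> as a polynomial in \<open>log x\<close> changes under \<open>log x \<mapsto> log x + 2\<pi>i\<close> by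
  coefficients of the \<open>Y(\<N>\<^sub>g\<^sup>j v, x)\<close> with \<open>j \<ge> 1\<close>.
\<close>
lemma log_coeffs_in_subspace:
  assumes X: "csubspace X" and L: "clinear L" and v: "\<alpha> \<in> strip" "v \<in> gspace G \<alpha>"
    and higher: "\<And>j k. L (Y ((gN G ^^ Suc j) v) n k w) \<in> X"
    and k: "n - \<alpha> \<notin> \<int> \<or> k \<noteq> 0"
  shows "L (Y v n k w) \<in> X"
proof -
  let ?c = "2 * of_real pi * \<i>"
  obtain K1 where K1: "\<And>n k. k > K1 \<Longrightarrow> Y v n k w = 0" using Y_log_bound by blast
  obtain K2 where K2: "\<And>n k. k > K2 \<Longrightarrow> Y (gop G v) n k w = 0" using Y_log_bound by blast
  define K where "K = max k (max K1 K2)"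
  \<comment> \<open>Measures the compatibility of the exponent \<open>n\<close> with the eigenvalue
    of \<open>v\<close>; it is 1 exactly when \<open>n - \<alpha>\<close> is an integer.\<close>
  define \<nu> where "\<nu> = e2pi (\<alpha> - n)"
  obtain J where "(gN G ^^ J) v = 0" using N(2) by (rule locally_nilpotentE)
  then have J: "(gN G ^^ Suc J) v = 0" by (rule funpow_zero_mono[OF N(1)]) simp
  \<comment> \<open>\<open>gop G v\<close> equals \<open>e2pi \<alpha>\<close> times
    \<open>v + r\<close>, and \<open>higher\<close> puts all contributions of \<open>r\<close> into
    \<open>X\<close>.\<close>
  define r where "r = (\<Sum>j<J. (?c ^ Suc j / fact (Suc j)) *\<^sub>C (gN G ^^ Suc j) v)"
  have "exp_nilpotent ?c (gN G) v = v + r"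
    unfolding exp_nilpotent_eq[OF N(1) J] r_def by (simp only: sum.lessThan_Suc_shift) (simp add: scaleC_one)
  then have gv: "gop G v = e2pi \<alpha> *\<^sub>C (v + r)"
    using gop_eq_exp(1)[OF g v] by simp
  have r: "L (Y r n k w) \<in> X" for k
    unfolding r_def clinear_sum[OF Y1] clinear_scale[OF Y1] clinear_sum[OF L] clinear_scale[OF L]
    by (intro complex_vector.subspace_sum[OF X] complex_vector.subspace_scale[OF X] higher)
  have "\<nu> *\<^sub>C (\<Sum>k\<le>K. of_nat (Suc p) ^ k *\<^sub>C (?c ^ k *\<^sub>C L (Y v n k w))) -
      (\<Sum>k\<le>K. of_nat p ^ k *\<^sub>C (?c ^ k *\<^sub>C L (Y v n k w))) \<in> X" for p :: nat
  proof -
    have "e2pi (- n) *\<^sub>C (\<Sum>k\<le>K. of_nat (Suc p) ^ k *\<^sub>C (?c ^ k *\<^sub>C Y (gop G v) n k w)) =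
      (\<Sum>k\<le>K. of_nat p ^ k *\<^sub>C (?c ^ k *\<^sub>C Y v n k w))"
      by (rule equivariance_at_1) (use K1 K2 in \<open>auto simp: K_def\<close>)
    then have "L (e2pi (- n) *\<^sub>C (\<Sum>k\<le>K. of_nat (Suc p) ^ k *\<^sub>C (?c ^ k *\<^sub>C Y (gop G v) n k w))) =
      L (\<Sum>k\<le>K. of_nat p ^ k *\<^sub>C (?c ^ k *\<^sub>C Y v n k w))"
      by simp
    then have "e2pi (- n) *\<^sub>C (\<Sum>k\<le>K. of_nat (Suc p) ^ k *\<^sub>C (?c ^ k *\<^sub>C L (Y (gop G v) n k w))) =
      (\<Sum>k\<le>K. of_nat p ^ k *\<^sub>C (?c ^ k *\<^sub>C L (Y v n k w)))"
      by (simp only: clinear_scale[OF L] clinear_sum[OF L])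
    moreover have "e2pi (- n) *\<^sub>C (\<Sum>k\<le>K. of_nat (Suc p) ^ k *\<^sub>C (?c ^ k *\<^sub>C L (Y (gop G v) n k w))) =
      \<nu> *\<^sub>C (\<Sum>k\<le>K. of_nat (Suc p) ^ k *\<^sub>C (?c ^ k *\<^sub>C L (Y v n k w))) +
      \<nu> *\<^sub>C (\<Sum>k\<le>K. of_nat (Suc p) ^ k *\<^sub>C (?c ^ k *\<^sub>C L (Y r n k w)))"
    proof -
      have "L (Y (gop G v) n k w) = e2pi \<alpha> *\<^sub>C (L (Y v n k w) + L (Y r n k w))" for k
        unfolding gv by (simp add: clinear_scale[OF Y1] clinear_scale[OF L] clinear_add[OF Y1] clinear_add[OF L])
      moreover have "\<nu> = e2pi (- n) * e2pi \<alpha>" by (simp add: \<nu>_def e2pi_add[symmetric])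
      ultimately show ?thesis
        by (simp add: complex_vector.scale_sum_right scaleC_scaleC scaleC_add_right sum.distrib[symmetric] mult_ac)
    qed
    ultimately have "\<nu> *\<^sub>C (\<Sum>k\<le>K. of_nat (Suc p) ^ k *\<^sub>C (?c ^ k *\<^sub>C L (Y v n k w))) -
      (\<Sum>k\<le>K. of_nat p ^ k *\<^sub>C (?c ^ k *\<^sub>C L (Y v n k w))) =
      - (\<nu> *\<^sub>C (\<Sum>k\<le>K. of_nat (Suc p) ^ k *\<^sub>C (?c ^ k *\<^sub>C L (Y r n k w))))"
      by (simp add: algebra_simps)
    also have "\<dots> \<in> X"
      by (intro complex_vector.subspace_neg[OF X] complex_vector.subspace_scale[OF X]
          complex_vector.subspace_sum[OF X] r)
    finally show ?thesis .
  qed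
  then have "?c ^ k *\<^sub>C L (Y v n k w) \<in> X"
  proof (rule difference_coeffs_in_subspace[OF X])
    show "\<nu> \<noteq> 1 \<or> k \<noteq> 0"
      using k e2pi_eq_iff[of \<alpha> n] e2pi_add[of "\<alpha> - n" n] Ints_minus[of "\<alpha> - n"] by (auto simp: \<nu>_def)
  qed (simp add: K_def)
  from complex_vector.subspace_scale[OF X this, of "1 / ?c ^ k"] show ?thesis
    by (simp add: scaleC_scaleC scaleC_one)
qed

end

text \<open>Empty for inadmissible \<open>h\<close> or \<open>\<alpha>\<close>, so that membership
  carries the side conditions along.\<close>

definition homogeneous :: "'v::complex_vector vsa \<Rightarrow> 'v g_act \<Rightarrow> real \<Rightarrow> bool \<Rightarrow> complex \<Rightarrow> 'v set"
  where "homogeneous V G h s \<alpha> = (if 2 * h \<in> \<int> \<and> \<alpha> \<in> strip then vgr V h s \<inter> gspace G \<alpha> else {})"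

section \<open>Homogeneous vectors and separating functionals\<close>

context twisted_module_operators
begin

lemma homogeneousD:
  assumes "v \<in> homogeneous V G h s \<alpha>"
  shows "2 * h \<in> \<int>" "\<alpha> \<in> strip" "v \<in> vgr V h s" "v \<in> gspace G \<alpha>" "v \<in> vfer V s" "vL0 V v = of_real h *\<^sub>C v"
proof -
  show *: "2 * h \<in> \<int>" "\<alpha> \<in> strip" "v \<in> vgr V h s" "v \<in> gspace G \<alpha>"
    using assms by (auto simp: homogeneous_def split: if_splits)
  show "v \<in> vfer V s"
    unfolding vfer_def using * by (intro complex_vector.span_base) blast
  have "v \<in> vwt V h"
    unfolding vwt_def using * by (intro complex_vector.span_base) blast
  then show "vL0 V v = of_real h *\<^sub>C v"
    using vertex_superalgebraD(7)[OF V] * by blast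
qed

text \<open>On \<open>V^[\<alpha>]\<close> the unipotent part is a multiple of \<open>g\<close> and
  so preserves \<open>vgr V h s\<close>; hence so does its logarithm.\<close>

lemma homogeneous_gN:
  assumes v: "v \<in> homogeneous V G h s \<alpha>"
  shows "gN G v \<in> homogeneous V G h s \<alpha>"
proof -
  note d = homogeneousD[OF v]
  have e: "homogeneous V G h s \<alpha> = vgr V h s \<inter> gspace G \<alpha>" using d by (simp add: homogeneous_def)
  have gs: "csubspace (gspace G \<alpha>)"
    unfolding gspace_def by (rule subspace_gen_eigenspace[OF g_actionD(1)[OF g]])
  have vg: "csubspace (vgr V h s)"
    using gradedD_subspace[OF vertex_superalgebraD(1)[OF V], of "(h, s)"] d(1) by simp
  have sub: "csubspace (homogeneous V G h s \<alpha>)"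
    unfolding e by (rule complex_vector.subspace_inter[OF vg gs])
  have gst: "gN G x \<in> gspace G \<alpha>" if "x \<in> gspace G \<alpha>" for x
    using gop_eq_exp(2)[OF g d(2) that] .
  have st: "exp_nilpotent (2 * of_real pi * \<i>) (gN G) x \<in> homogeneous V G h s \<alpha>"
    if x: "x \<in> homogeneous V G h s \<alpha>" for x
  proof -
    note dx = homogeneousD[OF x]
    have "(1 / e2pi \<alpha>) *\<^sub>C gop G x = exp_nilpotent (2 * of_real pi * \<i>) (gN G) x"
      by (simp add: gop_eq_exp(1)[OF g dx(2,4)] scaleC_scaleC scaleC_one)
    moreover have "gop G x \<in> vgr V h s"
      using vsa_automorphismD(2)[OF A dx(1), of s] dx(3) by blast
    ultimately have 1: "exp_nilpotent (2 * of_real pi * \<i>) (gN G) x \<in> vgr V h s"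
      using complex_vector.subspace_scale[OF vg] by metis
    obtain K where K: "(gN G ^^ K) x = 0" using N(2) by (rule locally_nilpotentE)
    have "(gN G ^^ k) x \<in> gspace G \<alpha>" for k
      by (induction k) (auto intro: gst dx(4))
    then have "exp_nilpotent (2 * of_real pi * \<i>) (gN G) x \<in> gspace G \<alpha>"
      unfolding exp_nilpotent_eq[OF N(1) K]
      by (intro complex_vector.subspace_sum[OF gs] complex_vector.subspace_scale[OF gs])
    with 1 show ?thesis unfolding e ..
  qed
  show ?thesis
    by (rule exp_nilpotent_stable_imp_stable[OF N sub _ st v]) simp_all
qed

lemma homogeneous_gN_pow: "v \<in> homogeneous V G h s \<alpha> \<Longrightarrow> (gN G ^^ j) v \<in> homogeneous V G h s \<alpha>"
  by (induction j) (auto intro: homogeneous_gN)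

text \<open>The comparison of branches with \<open>X = {0}\<close>: for nonintegral
  \<open>n - \<alpha>\<close> it covers all powers of the logarithm, the zeroth included.\<close>

lemma Y_support:
  assumes v: "\<alpha> \<in> strip" "v \<in> gspace G \<alpha>" and nz: "Y v n k w \<noteq> 0"
  shows "n - \<alpha> \<in> \<int>"
proof (rule ccontr)
  assume n: "n - \<alpha> \<notin> \<int>"
  have X: "csubspace ({0} :: 'w set)" by (simp add: complex_vector.subspace_def)
  have id: "clinear (\<lambda>x::'w. x)" by (rule clinearI) simp_all
  have "\<forall>k. Y v n k w = 0" if "(gN G ^^ d) v = 0" "v \<in> gspace G \<alpha>" for d v
    using that
  proof (induction d arbitrary: v)
    case 0
    then show ?case by (simp add: clinear_0[OF Y1])
  next
    case (Suc d)
    have "Y ((gN G ^^ Suc j) v) n k w = 0" for j k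
    proof -
      have "(gN G ^^ (d + Suc j)) v = 0"
        by (rule funpow_zero_mono[OF N(1) Suc.prems(1)]) simp
      then have "(gN G ^^ d) ((gN G ^^ Suc j) v) = 0" by (simp only: funpow_add o_apply)
      moreover have "(gN G ^^ j) v \<in> gspace G \<alpha>" for j
        by (induction j) (use Suc.prems(2) gop_eq_exp(2)[OF g v(1)] in auto)
      ultimately show ?thesis using Suc.IH by blast
    qed
    then have "Y v n k w \<in> {0}" for k
      using log_coeffs_in_subspace[OF X id v(1) Suc.prems(2)] n by blast
    then show ?case by blast
  qed
  moreover obtain d where "(gN G ^^ d) v = 0" using N(2) by (rule locally_nilpotentE)
  ultimately show False using v(2) nz by blast
qed

lemma Y_gen_eigenspace_span:
  assumes x: "x \<in> gen_eigenspace (gop G) a"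
    and w: "w \<in> cspan (\<Union>b\<in>L. gen_eigenspace (gop (wG W)) b)"
  shows "Y x n k w \<in> cspan (\<Union>b\<in>L. gen_eigenspace (gop (wG W)) (a * b))"
proof (rule clinear_span_image[OF Y2 w complex_vector.subspace_span])
  fix y assume "y \<in> (\<Union>b\<in>L. gen_eigenspace (gop (wG W)) b)"
  then obtain b where b: "b \<in> L" "y \<in> gen_eigenspace (gop (wG W)) b" by blast
  have "Y x n k y \<in> gen_eigenspace (gop (wG W)) (a * b)"
    by (rule gen_eigenspace_bilinear[where B = "\<lambda>x y. Y x n k y" and ?T1.0 = "gop G",
          OF g_actionD(1)[OF g] g_actionD(1)[OF lower_bounded_spaceD(3)[OF lb]]
          g_actionD(1)[OF lower_bounded_spaceD(3)[OF lb]] Y1 Y2 _ x b(2)])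
      (use twisted_moduleD(6)[OF tm] in simp)
  then show "Y x n k y \<in> cspan (\<Union>b\<in>L. gen_eigenspace (gop (wG W)) (a * b))"
    using b(1) by (intro complex_vector.span_base) blast
qed

text \<open>
  Elements of \<open>X\<close> need not be homogeneous for \<open>g\<close> and the fermion number, which is why only those with finitely many
  \<open>g\<close>-weights, all in \<open>\<Gamma>\<close>, are annihilated.
\<close>
lemma graded_functional:
  assumes X: "csubspace X" and \<Gamma>: "finite \<Gamma>" "\<Gamma> \<subseteq> strip"
    and y: "y \<in> gen_eigenspace (wL0 W) d" "y \<in> cspan (\<Union>\<gamma>\<in>\<Gamma>. gspace (wG W) \<gamma>)" "y \<notin> X"
  obtains f where "f \<in> graded_dual W" "f y = 1"
    and "\<And>x. x \<in> X \<Longrightarrow> x \<in> gen_eigenspace (wL0 W) d \<Longrightarrow> x \<in> cspan (\<Union>\<gamma>\<in>\<Gamma>. gspace (wG W) \<gamma>) \<Longrightarrow> f x = 0"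
    and "\<And>x d'. x \<in> gen_eigenspace (wL0 W) d' \<Longrightarrow> d' \<noteq> d \<Longrightarrow> f x = 0"
proof -
  note gr = lower_bounded_spaceD(1)[OF lb]
  let ?X = "\<lambda>(n, s, \<alpha>). wgr W n s \<alpha>"
  define K where "K = (UNIV :: complex set) \<times> (UNIV :: bool set) \<times> strip"
  \<comment> \<open>The finitely many graded pieces on which the functional may be nonzero.\<close>
  define L where "L = {d} \<times> (UNIV :: bool set) \<times> \<Gamma>"
  define Z1 where "Z1 = cspan (\<Union>k\<in>L. ?X k)"
  define Z2 where "Z2 = cspan (\<Union>k\<in>K - L. ?X k)"
  have LK: "L \<subseteq> K" using \<Gamma>(2) by (auto simp: L_def K_def)
  have gr: "graded K ?X" using gr by (simp add: K_def)
  have Z12: "x = 0" if "x \<in> Z1" "x \<in> Z2" for x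
    using graded_span_Int[OF gr LK, of "K - L" x] that by (simp add: Z1_def Z2_def)
  have wt: "x \<in> cspan (\<Union>k\<in>{n} \<times> UNIV \<times> strip. ?X k)" if "x \<in> gen_eigenspace (wL0 W) n" for x n
  proof -
    have "x \<in> wwt W n" using that by (simp add: lower_bounded_spaceD(7)[OF lb])
    also have "wwt W n \<subseteq> cspan (\<Union>k\<in>{n} \<times> UNIV \<times> strip. ?X k)"
      unfolding wwt_def by (rule complex_vector.span_mono) auto
    finally show ?thesis .
  qed
  have gs: "x \<in> cspan (\<Union>k\<in>UNIV \<times> UNIV \<times> \<Gamma>. ?X k)" if "x \<in> cspan (\<Union>\<gamma>\<in>\<Gamma>. gspace (wG W) \<gamma>)" for x
  proof -
    have "(\<Union>\<gamma>\<in>\<Gamma>. gspace (wG W) \<gamma>) \<subseteq> cspan (\<Union>k\<in>UNIV \<times> UNIV \<times> \<Gamma>. ?X k)"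
    proof
      fix z assume "z \<in> (\<Union>\<gamma>\<in>\<Gamma>. gspace (wG W) \<gamma>)"
      then obtain \<gamma> where \<gamma>: "\<gamma> \<in> \<Gamma>" "z \<in> gspace (wG W) \<gamma>" by blast
      then have "z \<in> wgwt W \<gamma>" using lower_bounded_spaceD(4)[OF lb, of \<gamma>] \<Gamma>(2) by blast
      also have "wgwt W \<gamma> \<subseteq> cspan (\<Union>k\<in>UNIV \<times> UNIV \<times> \<Gamma>. ?X k)"
        unfolding wgwt_def by (rule complex_vector.span_mono) (use \<gamma>(1) in auto)
      finally show "z \<in> cspan (\<Union>k\<in>UNIV \<times> UNIV \<times> \<Gamma>. ?X k)" .
    qed
    then have "cspan (\<Union>\<gamma>\<in>\<Gamma>. gspace (wG W) \<gamma>) \<subseteq> cspan (\<Union>k\<in>UNIV \<times> UNIV \<times> \<Gamma>. ?X k)"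
      by (rule complex_vector.span_minimal) (rule complex_vector.subspace_span)
    then show ?thesis using that by blast
  qed
  have Z1I: "x \<in> Z1" if "x \<in> gen_eigenspace (wL0 W) d" "x \<in> cspan (\<Union>\<gamma>\<in>\<Gamma>. gspace (wG W) \<gamma>)" for x
  proof -
    have "x \<in> cspan (\<Union>k\<in>({d} \<times> UNIV \<times> strip) \<inter> (UNIV \<times> UNIV \<times> \<Gamma>). ?X k)"
      by (rule graded_span_Int[OF gr _ _ wt[OF that(1)] gs[OF that(2)]]) (use \<Gamma>(2) in \<open>auto simp: K_def\<close>)
    moreover have "({d} \<times> UNIV \<times> strip) \<inter> (UNIV \<times> UNIV \<times> \<Gamma>) = L"
      using \<Gamma>(2) by (auto simp: L_def)
    ultimately show ?thesis by (simp only: Z1_def)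
  qed
  have Z2I: "x \<in> Z2" if "x \<in> gen_eigenspace (wL0 W) d'" "d' \<noteq> d" for x d'
  proof -
    have "cspan (\<Union>k\<in>{d'} \<times> UNIV \<times> strip. ?X k) \<subseteq> Z2"
      unfolding Z2_def by (rule complex_vector.span_mono, rule UN_mono) (use that(2) in \<open>auto simp: K_def L_def\<close>)
    then show ?thesis using wt[OF that(1)] by blast
  qed
  have sub: "csubspace Z1" "csubspace Z2" unfolding Z1_def Z2_def by (rule complex_vector.subspace_span)+
  \<comment> \<open>Only \<open>X \<inter> Z1\<close> is divided out together with the remaining
    pieces. Since \<open>X\<close> need not be graded, \<open>y\<close> could lie in
    \<open>X + Z2\<close>, but not in this smaller sum.\<close>
  define Q where "Q = {a + b | a b. a \<in> X \<inter> Z1 \<and> b \<in> Z2}"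
  have Q: "csubspace Q"
    unfolding Q_def by (rule complex_vector.subspace_sums[OF complex_vector.subspace_inter[OF X sub(1)] sub(2)])
  have "y \<notin> Q"
  proof
    assume "y \<in> Q"
    then obtain a b where ab: "y = a + b" "a \<in> X" "a \<in> Z1" "b \<in> Z2" by (auto simp: Q_def)
    have "b = y - a" using ab(1) by simp
    also have "\<dots> \<in> Z1" by (rule complex_vector.subspace_diff[OF sub(1) Z1I[OF y(1,2)] ab(3)])
    finally have "b = 0" using Z12 ab(4) by blast
    then show False using ab y(3) by simp
  qed
  then obtain f :: "'w \<Rightarrow> complex" where f: "clinear f" "\<And>x. x \<in> Q \<Longrightarrow> f x = 0" "f y = 1"
    using functional_separating[OF Q] by blast
  have f1: "f x = 0" if "x \<in> X" "x \<in> Z1" for x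
    by (rule f(2)) (use that complex_vector.subspace_0[OF sub(2)] in \<open>force simp: Q_def\<close>)
  have f2: "f x = 0" if "x \<in> Z2" for x
    by (rule f(2)) (use that complex_vector.subspace_0[OF sub(1)] complex_vector.subspace_0[OF X] in \<open>force simp: Q_def\<close>)
  have "f \<in> graded_dual W"
  proof -
    have "{(n, s, \<alpha>). \<alpha> \<in> strip \<and> (\<exists>w\<in>wgr W n s \<alpha>. f w \<noteq> 0)} \<subseteq> L"
    proof (rule subsetI, rule ccontr)
      fix k assume k: "k \<in> {(n, s, \<alpha>). \<alpha> \<in> strip \<and> (\<exists>w\<in>wgr W n s \<alpha>. f w \<noteq> 0)}" "k \<notin> L"
      then obtain w where w: "w \<in> ?X k" "f w \<noteq> 0" "k \<in> K" by (auto simp: K_def)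
      have "w \<in> Z2" unfolding Z2_def using w k(2) by (intro complex_vector.span_base) blast
      then show False using f2 w(2) by blast
    qed
    then have "finite {(n, s, \<alpha>). \<alpha> \<in> strip \<and> (\<exists>w\<in>wgr W n s \<alpha>. f w \<noteq> 0)}"
      by (rule finite_subset) (simp add: L_def \<Gamma>(1))
    then show ?thesis using f(1) by (simp add: graded_dual_def)
  qed
  then show ?thesis
    by (rule that) (use f(3) f1 f2 Z1I Z2I in blast)+
qed

end

section \<open>Products of two operators by duality\<close>

context twisted_module_operators
begin

lemma functional_vo_branch:
  assumes f: "clinear f" and log: "\<And>k. f (Y x n (Suc k) w) = 0"
  shows "f (vo_branch Y p x z n w) = exp ((- n - 1) * lp p z) * f (Y x n 0 w)"
proof -
  obtain K where K: "\<And>n k. k > K \<Longrightarrow> Y x n k w = 0" using Y_log_bound by blast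
  have fin: "finite {k. (exp ((- n - 1) * lp p z) * lp p z ^ k) *\<^sub>C Y x n k w \<noteq> 0}"
    by (rule finite_subset[of _ "{..K}"]) (use K in \<open>auto simp: not_less[symmetric]\<close>)
  have "f (vo_branch Y p x z n w) = Sum_any (\<lambda>k. (exp ((- n - 1) * lp p z) * lp p z ^ k) *\<^sub>C f (Y x n k w))"
    unfolding vo_branch_def branch_def by (simp only: clinear_Sum_any[OF f fin] clinear_scale[OF f])
  also have "\<dots> = (\<Sum>k\<in>{0}. (exp ((- n - 1) * lp p z) * lp p z ^ k) *\<^sub>C f (Y x n k w))"
  proof (rule Sum_any.expand_superset)
    have "k = 0" if "f (Y x n k w) \<noteq> 0" for k using that log by (cases k) auto
    then show "{k. (exp ((- n - 1) * lp p z) * lp p z ^ k) *\<^sub>C f (Y x n k w) \<noteq> 0} \<subseteq> {0}" by auto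
  qed simp
  finally show ?thesis by simp
qed

lemma vo_branch_at_1: "vo_branch Y 0 x 1 n w = Y x n 0 w"
proof -
  have "vo_branch Y 0 x 1 n w = (\<Sum>k\<in>{0}. (exp ((- n - 1) * lp 0 1) * lp 0 1 ^ k) *\<^sub>C Y x n k w)"
    unfolding vo_branch_def branch_def
    by (rule Sum_any.expand_superset) (auto simp: lp_1)
  then show ?thesis by (simp add: lp_1 scaleC_one)
qed

text \<open>For real \<open>1 = z\<^sub>2 < z\<^sub>1 < 2\<close> the domains of convergence of the product and of the iterate overlap.\<close>
lemma duality_overlap:
  fixes r :: real
  assumes "u \<in> vfer V s" "v \<in> vfer V t" "f \<in> graded_dual W" and r: "1 < r" "r < 2"
  shows "\<exists>F. ((\<lambda>(m, n). f (vo_branch Y 0 u (of_real r) m (vo_branch Y 0 v 1 n w))) has_sum F) UNIV \<and>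
    ((\<lambda>(m, n). (of_real r - 1) powi (- m - 1) * f (vo_branch Y 0 (vY V u m v) 1 n w)) has_sum F) UNIV"
proof -
  note D = twisted_moduleD(9)[OF tm, unfolded duality_def Let_def, rule_format, OF assms(1-3), of w]
  have 1: "cmod (of_real r) > cmod 1 \<and> cmod (1::complex) > 0" using r by simp
  have "cmod (of_real r - 1) = r - 1"
    using r by (metis abs_of_pos diff_gt_0_iff_gt norm_of_real of_real_1 of_real_diff)
  moreover have "Arg2pi (of_real r) = 0" "Arg2pi 1 = 0"
    using r Arg2pi_of_real[of r] Arg2pi_of_real[of 1] by simp_all
  ultimately have 2: "cmod 1 > cmod (of_real r - 1) \<and> cmod (of_real r - 1) > 0 \<and>
      \<bar>Arg2pi (of_real r) - Arg2pi 1\<bar> < pi / 2"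
    using r by simp
  show ?thesis
    using D by (elim exE conjE) (drule spec[of _ 0], drule spec[of _ "of_real r"], drule spec[of _ 1], rule exI,
        rule conjI, rule mp[OF conjunct1 1], assumption,
        rule mp[OF conjunct2[OF conjunct2[OF conjunct2]] 2], assumption)
qed

lemma wwt_lower_bound:
  obtains B where "\<And>x d. x \<in> gen_eigenspace (wL0 W) d \<Longrightarrow> x \<noteq> 0 \<Longrightarrow> B \<le> Re d"
proof -
  obtain B where B: "\<And>n. Re n < B \<Longrightarrow> wwt W n = {0}"
    using lower_bounded_spaceD(2)[OF lb] by blast
  show ?thesis
    by (rule that[of B]) (use B lower_bounded_spaceD(7)[OF lb] leI in blast)
qed

text \<open>The separating functional \<open>f\<close> sees one weight \<open>d\<close> only, so the
  surviving terms of the product have \<open>m + n = m0 + n0\<close>; the lower bound on weights and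
  the support condition on \<open>n\<close> arrange them in a sequence. With
  \<open>r = 1 / x\<close> they form a power series in \<open>x\<close> on \<open>(1/2, 1)\<close>,
  up to a common factor, and the coefficient belonging to \<open>(m0, n0)\<close> is 1.\<close>

lemma product_mem:
  assumes u: "u \<in> homogeneous V G h1 s1 \<alpha>1" and v: "v \<in> homogeneous V G h2 s2 \<alpha>2"
    and w: "w \<in> gen_eigenspace (wL0 W) c" and X: "csubspace X"
    and iterate: "\<And>x n k. Y x n k w \<in> X"
    and logs: "\<And>m n k. Y u m (Suc k) (Y v n 0 w) \<in> X"
  shows "Y u m0 0 (Y v n0 0 w) \<in> X"
proof (rule ccontr)
  assume notX: "Y u m0 0 (Y v n0 0 w) \<notin> X"
  note hu = homogeneousD[OF u] and hv = homogeneousD[OF v]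
  define d where "d = c + h1 + h2 - m0 - n0 - 2"
  have wt1: "Y v n 0 w \<in> gen_eigenspace (wL0 W) (c + h2 - n - 1)" for n
    by (rule Y_weight[OF hv(6) w])
  have wt2: "Y u m k (Y v n 0 w) \<in> gen_eigenspace (wL0 W) (c + h2 - n - 1 + h1 - m - 1)" for m k n
    by (rule Y_weight[OF hu(6) wt1])
  have wt3: "Y (vY V u m v) n k w \<in> gen_eigenspace (wL0 W) (c + of_real (h1 + h2 - m - 1) - n - 1)" for m n k
  proof (rule Y_weight[OF _ w])
    have "vL0 V (vY V u m v) = vY V u m (vL0 V v) + of_int (- m - 1) *\<^sub>C vY V u m v + vY V (vL0 V u) m v"
      using vertex_superalgebraD(10)[OF V] by (simp add: algebra_simps)
    also have "\<dots> = of_real (h1 + h2 - m - 1) *\<^sub>C vY V u m v"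
    proof -
      have 1: "clinear (vY V u m)" and 2: "clinear (\<lambda>u. vY V u m v)" using vertex_superalgebraD(3)[OF V] by blast+
      have "(of_real (h1 + h2 - m - 1) :: complex) = of_real h2 + of_int (- m - 1) + of_real h1" by simp
      then show ?thesis by (simp only: hu(6) hv(6) clinear_scale[OF 1] clinear_scale[OF 2] scaleC_add_left)
    qed
    finally show "vL0 V (vY V u m v) = of_real (h1 + h2 - m - 1) *\<^sub>C vY V u m v" .
  qed
  define \<rho> where "\<rho> = e2pi \<alpha>1 * e2pi \<alpha>2"
  obtain L fw where L: "finite L" "L \<subseteq> strip" "\<And>\<alpha>. \<alpha> \<in> L \<Longrightarrow> fw \<alpha> \<in> gspace (wG W) \<alpha>" "w = (\<Sum>\<alpha>\<in>L. fw \<alpha>)"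
    using graded_decompose[OF g_actionD(4)[OF lower_bounded_spaceD(3)[OF lb]], of w] by blast
  have wL: "w \<in> cspan (\<Union>b\<in>e2pi ` L. gen_eigenspace (gop (wG W)) b)"
    unfolding L(4) by (intro complex_vector.span_sum complex_vector.span_base) (use L(3) in \<open>auto simp: gspace_def\<close>)
  have "\<forall>c. \<exists>\<sigma>. c \<noteq> 0 \<longrightarrow> \<sigma> \<in> strip \<and> e2pi \<sigma> = c" using strip_representative by metis
  then obtain \<sigma> where \<sigma>: "\<And>c. c \<noteq> 0 \<Longrightarrow> \<sigma> c \<in> strip \<and> e2pi (\<sigma> c) = c" by metis
  \<comment> \<open>\<open>w\<close> has finitely many components for \<open>g\<close>; their
    eigenvalues times \<open>\<rho>\<close> are the ones that can occur in the iterate and in the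
    product.\<close>
  define \<Gamma> where "\<Gamma> = (\<lambda>\<alpha>. \<sigma> (\<rho> * e2pi \<alpha>)) ` L"
  have l0: "\<rho> * e2pi \<alpha> \<noteq> 0" for \<alpha> by (simp add: \<rho>_def)
  have \<Gamma>: "finite \<Gamma>" "\<Gamma> \<subseteq> strip" using L(1) \<sigma>[OF l0] by (auto simp: \<Gamma>_def)
  have \<Gamma>eq: "(\<Union>\<gamma>\<in>\<Gamma>. gspace (wG W) \<gamma>) = (\<Union>b\<in>e2pi ` L. gen_eigenspace (gop (wG W)) (\<rho> * b))"
    using \<sigma>[OF l0] by (simp add: \<Gamma>_def gspace_def)
  have g3: "Y (vY V u m v) n k w \<in> cspan (\<Union>\<gamma>\<in>\<Gamma>. gspace (wG W) \<gamma>)" for m n k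
    unfolding \<Gamma>eq \<rho>_def
    by (rule Y_gen_eigenspace_span[OF gspace_vY[OF V A hu(4)[unfolded gspace_def] hv(4)[unfolded gspace_def]] wL])
  have g2: "Y u m k (Y v n l w) \<in> cspan (\<Union>\<gamma>\<in>\<Gamma>. gspace (wG W) \<gamma>)" for m n k l
  proof -
    have "Y v n l w \<in> cspan (\<Union>b\<in>e2pi ` L. gen_eigenspace (gop (wG W)) (e2pi \<alpha>2 * b))"
      by (rule Y_gen_eigenspace_span[OF hv(4)[unfolded gspace_def] wL])
    then have "Y v n l w \<in> cspan (\<Union>b\<in>(\<lambda>b. e2pi \<alpha>2 * b) ` e2pi ` L. gen_eigenspace (gop (wG W)) b)"
      by (simp add: image_image)
    from Y_gen_eigenspace_span[OF hu(4)[unfolded gspace_def] this]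
    show ?thesis unfolding \<Gamma>eq \<rho>_def by (simp add: image_image mult.assoc)
  qed
  have yd: "Y u m0 0 (Y v n0 0 w) \<in> gen_eigenspace (wL0 W) d"
    using wt2[of m0 0 n0] by (simp add: d_def algebra_simps)
  obtain f where f: "f \<in> graded_dual W" "f (Y u m0 0 (Y v n0 0 w)) = 1"
    and fX: "\<And>x. x \<in> X \<Longrightarrow> x \<in> gen_eigenspace (wL0 W) d \<Longrightarrow> x \<in> cspan (\<Union>\<gamma>\<in>\<Gamma>. gspace (wG W) \<gamma>) \<Longrightarrow> f x = 0"
    and fd: "\<And>x d'. x \<in> gen_eigenspace (wL0 W) d' \<Longrightarrow> d' \<noteq> d \<Longrightarrow> f x = 0"
    using graded_functional[OF X \<Gamma> yd g2 notX] by blast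
  have lf: "clinear f" using f(1) by (simp add: graded_dual_def)
  \<comment> \<open>Either the weight is not \<open>d\<close>, or the vector is an element of
    \<open>X\<close> of weight \<open>d\<close> with \<open>g\<close>-weights in
    \<open>\<Gamma>\<close>.\<close>
  have f3: "f (Y (vY V u m v) n k w) = 0" for m n k
    by (cases "c + of_real (h1 + h2 - m - 1) - n - 1 = d")
      (use fX[OF iterate _ g3] fd wt3[of m n k] in auto)
  have f2: "f (Y u m (Suc k) (Y v n 0 w)) = 0" for m n k
    by (cases "c + h2 - n - 1 + h1 - m - 1 = d")
      (use fX[OF logs _ g2] fd wt2[of m "Suc k" n] in auto)
  define a2 where "a2 m n = f (Y u m 0 (Y v n 0 w))" for m n
  have sum0: "((\<lambda>(m, n). exp ((- m - 1) * of_real (ln r)) * a2 m n) has_sum 0) UNIV" if r: "1 < r" "r < 2" for r :: real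
  proof -
    obtain F where F: "((\<lambda>(m, n). f (vo_branch Y 0 u (of_real r) m (vo_branch Y 0 v 1 n w))) has_sum F) UNIV"
      "((\<lambda>(m, n). (of_real r - 1) powi (- m - 1) * f (vo_branch Y 0 (vY V u m v) 1 n w)) has_sum F) UNIV"
      using duality_overlap[OF hu(5) hv(5) f(1) r, of w] by blast
    \<comment> \<open>Every term of the iterate vanishes, so the common sum is zero.\<close>
    have "((\<lambda>(m::int, n::complex). 0) has_sum F) UNIV"
      using F(2) by (simp add: vo_branch_at_1 f3 case_prod_unfold)
    then have F0: "F = 0"
      by (rule has_sum_unique) (simp add: case_prod_unfold)
    have lp: "lp 0 (of_real r) = of_real (ln r)"
      using r Arg2pi_of_real[of r] by (simp add: lp_def)
    have "(\<lambda>(m, n). f (vo_branch Y 0 u (of_real r) m (vo_branch Y 0 v 1 n w))) =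
        (\<lambda>(m, n). exp ((- m - 1) * of_real (ln r)) * a2 m n)"
      by (simp only: vo_branch_at_1 functional_vo_branch[OF lf f2] lp a2_def)
    then show ?thesis using F(1) unfolding F0 by (simp only:)
  qed
  obtain B where B: "\<And>x d. x \<in> gen_eigenspace (wL0 W) d \<Longrightarrow> x \<noteq> 0 \<Longrightarrow> B \<le> Re d"
    using wwt_lower_bound by blast
  have ne0: "Y v n 0 w \<noteq> 0" if "a2 m n \<noteq> 0" for m n
    using that clinear_0[OF Y2] clinear_0[OF lf] by (auto simp: a2_def)
  have supp: "m + n = m0 + n0 \<and> n - \<alpha>2 \<in> \<int> \<and> Re n \<le> Re (c + h2 - 1) - B" if "a2 m n \<noteq> 0" for m n
  proof (intro conjI)
    have "c + h2 - n - 1 + h1 - m - 1 = d"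
      using fd[OF wt2[of m 0 n]] that unfolding a2_def by blast
    then show "m + n = m0 + n0" by (simp add: d_def algebra_simps)
    show "n - \<alpha>2 \<in> \<int>" by (rule Y_support[OF hv(2,4) ne0[OF that]])
    show "Re n \<le> Re (c + h2 - 1) - B" using B[OF wt1 ne0[OF that]] by simp
  qed
  have a0: "a2 m0 n0 = 1" using f(2) by (simp add: a2_def)
  \<comment> \<open>A bound for \<open>n - n0\<close> over the support. The sequence
    \<open>gj\<close> runs through decreasing \<open>n\<close> from there and reaches
    \<open>(m0, n0)\<close> at position \<open>J\<close>.\<close>
  define J where "J = nat \<lceil>Re (c + h2 - 1) - B - Re n0\<rceil>"
  define gj where "gj j = (m0 - of_nat J + of_nat j, n0 + of_nat J - of_nat j :: complex)" for j :: nat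
  have inj: "inj gj" by (rule injI) (simp add: gj_def)
  have range: "x \<in> range gj" if "case x of (m, n) \<Rightarrow> a2 m n \<noteq> 0" for x
  proof -
    obtain m n where x: "x = (m, n)" by (cases x)
    have s: "m + n = m0 + n0" "n - \<alpha>2 \<in> \<int>" "Re n \<le> Re (c + h2 - 1) - B"
      using supp[of m n] that x by auto
    have "n0 - \<alpha>2 \<in> \<int>" using supp[of m0 n0] a0 by simp
    then have "n - \<alpha>2 - (n0 - \<alpha>2) \<in> \<int>" by (rule Ints_diff[OF s(2)])
    then have "n - n0 \<in> \<int>" by simp
    then obtain i where i: "n - n0 = of_int i" by (rule Ints_cases)
    then have n: "n = n0 + of_int i" by (simp add: algebra_simps)
    have "of_int i \<le> Re (c + h2 - 1) - B - Re n0" using s(3) n by simp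
    then have "i \<le> int J" unfolding J_def by linarith
    then obtain j :: nat where "int J - i = int j" by (metis diff_ge_0_iff_ge nonneg_int_cases)
    then have ij: "i = int J - int j" by simp
    have "n = n0 + of_nat J - of_nat j" by (simp add: n ij)
    moreover have "m = m0 + n0 - n" using s(1) by (simp add: algebra_simps)
    ultimately have "x = gj j" by (simp add: x gj_def)
    then show ?thesis by simp
  qed
  define aj where "aj j = (case gj j of (m, n) \<Rightarrow> a2 m n)" for j
  have "(\<lambda>j. aj j * of_real x ^ j) sums 0" if x: "1/2 < x" "x < 1" for x :: real
  proof -
    define r where "r = 1 / x"
    have r: "1 < r" "r < 2" using x by (simp_all add: r_def field_simps)
    have lnr: "ln r = - ln x" using x by (simp add: r_def ln_div)
    let ?h = "\<lambda>(m, n). exp ((- m - 1) * of_real (ln r)) * a2 m n"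
    have "a2 m n = 0" if "(m, n) \<notin> range gj" for m n
      using range[of "(m, n)"] that by auto
    then have "(?h has_sum 0) (range gj)"
      by (intro has_sum_cong_neutral[THEN iffD1, OF _ _ _ sum0[OF r]]) auto
    then have "(?h \<circ> gj has_sum 0) UNIV"
      using has_sum_reindex[OF inj] by blast
    then have "(?h \<circ> gj) sums 0" by (rule has_sum_imp_sums)
    \<comment> \<open>The common power of \<open>r\<close>; what remains of the exponential is
      \<open>x ^ j\<close>.\<close>
    define C where "C = exp ((- m0 + of_nat J - 1) * of_real (ln r))"
    have e: "(?h \<circ> gj) j = C * (aj j * of_real x ^ j)" for j
    proof -
      have "exp ((- (m0 - of_nat J + of_nat j) - 1) * of_real (ln r)) = C * exp (of_nat j * of_real (ln x))"
        by (simp add: C_def lnr exp_add[symmetric] algebra_simps)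
      also have "exp (of_nat j * of_real (ln x) :: complex) = of_real x ^ j"
        using x by (simp add: exp_of_nat_mult exp_of_real)
      finally show ?thesis by (simp add: gj_def aj_def)
    qed
    have "(\<lambda>j. C * (aj j * of_real x ^ j)) sums 0"
      using \<open>(?h \<circ> gj) sums 0\<close> by (simp only: e[abs_def, symmetric] fun_eq_iff)
    then have "(\<lambda>j. (1 / C) * (C * (aj j * of_real x ^ j))) sums ((1 / C) * 0)"
      by (rule sums_mult)
    then show ?thesis by (simp add: C_def)
  qed
  then have "aj J = 0" by (rule powser_zero_on_interval)
  then show False using a0 by (simp add: aj_def gj_def)
qed

text \<open>Induction on the nilpotency order of \<open>u\<close>: comparison of branches gives the
  logarithmic coefficients from those of the \<open>\<N>\<^sub>g\<close>-powers of \<open>u\<close>,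
  and this is what the duality argument asks for before it yields the coefficient without
  logarithm.\<close>

lemma operator_coeff_mem:
  assumes u: "u \<in> homogeneous V G h1 s1 \<alpha>1" and v: "v \<in> homogeneous V G h2 s2 \<alpha>2"
    and w: "w \<in> gen_eigenspace (wL0 W) c" and X: "csubspace X"
    and iterate: "\<And>x n k. Y x n k w \<in> X"
  shows "Y u m k (Y v n 0 w) \<in> X"
proof -
  have id: "clinear (\<lambda>x::'w. x)" by (rule clinearI) simp_all
  have "\<forall>m k n. Y u m k (Y v n 0 w) \<in> X" if "(gN G ^^ d) u = 0" "u \<in> homogeneous V G h1 s1 \<alpha>1" for d u
    using that
  proof (induction d arbitrary: u)
    case 0
    then show ?case by (simp add: clinear_0[OF Y1] complex_vector.subspace_0[OF X])
  next
    case (Suc d)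
    note hu = homogeneousD[OF Suc.prems(2)]
    have "Y ((gN G ^^ Suc j) u) m k (Y v n 0 w) \<in> X" for j m k n
    proof -
      have "(gN G ^^ (d + Suc j)) u = 0"
        by (rule funpow_zero_mono[OF N(1) Suc.prems(1)]) simp
      then have "(gN G ^^ d) ((gN G ^^ Suc j) u) = 0" by (simp only: funpow_add o_apply)
      then show ?thesis using Suc.IH homogeneous_gN_pow[OF Suc.prems(2)] by blast
    qed
    then have logs: "Y u m (Suc k) (Y v n 0 w) \<in> X" for m k n
      using log_coeffs_in_subspace[OF X id hu(2,4)] by blast
    have "Y u m 0 (Y v n 0 w) \<in> X" for m n
      by (rule product_mem[OF Suc.prems(2) v w X iterate logs])
    then have "Y u m k (Y v n 0 w) \<in> X" for m k n using logs by (cases k) auto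
    then show ?case by blast
  qed
  moreover obtain d where "(gN G ^^ d) u = 0" using N(2) by (rule locally_nilpotentE)
  ultimately show ?thesis using u by blast
qed

text \<open>At \<open>z\<^sub>2 = 1\<close> the duality argument sees only \<open>l = 0\<close>; the
  other \<open>l\<close> follow by comparing branches under the linear map
  \<open>Y u m k\<close>.\<close>

lemma operator_mem:
  assumes u: "u \<in> homogeneous V G h1 s1 \<alpha>1" and v: "v \<in> homogeneous V G h2 s2 \<alpha>2"
    and w: "w \<in> gen_eigenspace (wL0 W) c" and X: "csubspace X"
    and iterate: "\<And>x n k. Y x n k w \<in> X"
  shows "Y u m k (Y v n l w) \<in> X"
proof -
  have "\<forall>n l. Y u m k (Y v n l w) \<in> X" if "(gN G ^^ d) v = 0" "v \<in> homogeneous V G h2 s2 \<alpha>2" for d v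
    using that
  proof (induction d arbitrary: v)
    case 0
    then show ?case by (simp add: clinear_0[OF Y1] clinear_0[OF Y2] complex_vector.subspace_0[OF X])
  next
    case (Suc d)
    note hv = homogeneousD[OF Suc.prems(2)]
    have "Y u m k (Y ((gN G ^^ Suc j) v) n l w) \<in> X" for j n l
    proof -
      have "(gN G ^^ (d + Suc j)) v = 0"
        by (rule funpow_zero_mono[OF N(1) Suc.prems(1)]) simp
      then have "(gN G ^^ d) ((gN G ^^ Suc j) v) = 0" by (simp only: funpow_add o_apply)
      then show ?thesis using Suc.IH homogeneous_gN_pow[OF Suc.prems(2)] by blast
    qed
    then have logs: "Y u m k (Y v n (Suc l) w) \<in> X" for n l
      using log_coeffs_in_subspace[OF X Y2 hv(2,4)] by blast
    have "Y u m k (Y v n l w) \<in> X" for n l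
      using logs operator_coeff_mem[OF u Suc.prems(2) w X iterate] by (cases l) auto
    then show ?case by blast
  qed
  moreover obtain d where "(gN G ^^ d) v = 0" using N(2) by (rule locally_nilpotentE)
  ultimately show ?thesis using v by blast
qed

text \<open>The duality argument is applied to the vectors from which \<open>X\<close> is built, so
  each must lie in one generalized weight space: \<open>wL0 W\<close> preserves the weight and
  \<open>wLm1 W\<close> raises it by 1.\<close>

lemma L_power_gen_eigenspace:
  assumes w: "w \<in> gen_eigenspace (wL0 W) c"
  shows "\<exists>d. (wLm1 W ^^ p) ((wL0 W ^^ q) w) \<in> gen_eigenspace (wL0 W) d"
proof -
  have L0_mem: "wL0 W x \<in> gen_eigenspace (wL0 W) c" if x: "x \<in> gen_eigenspace (wL0 W) c" for x c
  proof -
    let ?D = "\<lambda>y. wL0 W y - c *\<^sub>C y"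
    obtain k where "(?D ^^ k) x = 0" using x by (auto simp: gen_eigenspace_def)
    then have "(?D ^^ Suc k) x = 0"
      by (rule funpow_zero_mono[OF clinear_diff_scale[OF L0]]) simp
    then have "(?D ^^ k) (?D x) = 0" by (simp only: funpow_Suc_right o_apply)
    then have "?D x \<in> gen_eigenspace (wL0 W) c" by (rule gen_eigenspaceI)
    then have "?D x + c *\<^sub>C x \<in> gen_eigenspace (wL0 W) c"
      using x by (intro complex_vector.subspace_add[OF subspace_gen_eigenspace[OF L0]]
          complex_vector.subspace_scale[OF subspace_gen_eigenspace[OF L0]])
    then show ?thesis by simp
  qed
  note Lm1 = lower_bounded_spaceD(6)[OF lb]
  have Lm1_mem: "wLm1 W x \<in> gen_eigenspace (wL0 W) (c + 1)" if x: "x \<in> gen_eigenspace (wL0 W) c" for x c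
  proof -
    let ?D = "\<lambda>y. wL0 W y - c *\<^sub>C y" and ?E = "\<lambda>y. wL0 W y - (c + 1) *\<^sub>C y"
    have sw: "?E (wLm1 W y) = wLm1 W (?D y)" for y
    proof -
      have "wL0 W (wLm1 W y) = wLm1 W (wL0 W y) + wLm1 W y"
        using twisted_moduleD(2)[OF tm] by (simp add: algebra_simps)
      then show ?thesis by (simp add: clinear_diff[OF Lm1] clinear_scale[OF Lm1] scaleC_add_left scaleC_one)
    qed
    have "(?E ^^ k) (wLm1 W y) = wLm1 W ((?D ^^ k) y)" for k y
      by (induction k arbitrary: y) (simp_all only: funpow_0 funpow_Suc_right o_apply sw)
    moreover obtain k where "(?D ^^ k) x = 0" using x by (auto simp: gen_eigenspace_def)
    ultimately have "(?E ^^ k) (wLm1 W x) = 0" by (simp add: clinear_0[OF Lm1])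
    then show ?thesis by (rule gen_eigenspaceI)
  qed
  have "(wL0 W ^^ q) w \<in> gen_eigenspace (wL0 W) c"
    by (induction q) (auto simp: w intro: L0_mem)
  then have "(wLm1 W ^^ p) ((wL0 W ^^ q) w) \<in> gen_eigenspace (wL0 W) (c + of_nat p)"
  proof (induction p)
    case (Suc p)
    then show ?case using Lm1_mem[of _ "c + of_nat p"] by (simp add: add_ac)
  qed simp
  then show ?thesis ..
qed

lemma homogeneous_span_UNIV: "v \<in> cspan {v. \<exists>h s \<alpha>. v \<in> homogeneous V G h s \<alpha>}"
proof -
  have "{v. \<exists>h s. \<exists>\<alpha>\<in>g_exponents G. 2 * h \<in> \<int> \<and> v \<in> vgr V h s \<and> v \<in> gspace G \<alpha>} \<subseteq>
      {v. \<exists>h s \<alpha>. v \<in> homogeneous V G h s \<alpha>}"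
  proof
    fix v assume "v \<in> {v. \<exists>h s. \<exists>\<alpha>\<in>g_exponents G. 2 * h \<in> \<int> \<and> v \<in> vgr V h s \<and> v \<in> gspace G \<alpha>}"
    then obtain h s \<alpha> where "\<alpha> \<in> strip" "2 * h \<in> \<int>" "v \<in> vgr V h s" "v \<in> gspace G \<alpha>"
      unfolding g_exponents_def by blast
    then have "v \<in> homogeneous V G h s \<alpha>" by (simp add: homogeneous_def)
    then show "v \<in> {v. \<exists>h s \<alpha>. v \<in> homogeneous V G h s \<alpha>}" by blast
  qed
  then show ?thesis using homogeneous_span[OF V A] complex_vector.span_mono by blast
qed

text \<open>\<open>X\<close> contains every coefficient of \<open>Y\<close> on the vectors
  \<open>w'\<close>, in particular all iterates, which is the hypothesis of
  \<open>operator_mem\<close>; linearity reduces \<open>u\<close> and \<open>v\<close> to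
  homogeneous vectors.\<close>

theorem operators_preserve_generated:
  assumes S: "\<And>w. w \<in> S \<Longrightarrow> \<exists>c. w \<in> gen_eigenspace (wL0 W) c"
  defines "X \<equiv> cspan {Y v n k ((wLm1 W ^^ p) ((wL0 W ^^ q) w)) | v n k p q w. w \<in> S}"
  assumes x: "x \<in> X"
  shows "Y u m k x \<in> X"
proof -
  have X: "csubspace X" unfolding X_def by (rule complex_vector.subspace_span)
  have 1: "Y u m k (Y v n l w') \<in> X"
    if w': "w' = (wLm1 W ^^ p) ((wL0 W ^^ q) w)" "w \<in> S" for u m k v n l w' p q w
  proof -
    have iter: "Y x n k w' \<in> X" for x n k
      unfolding X_def w'(1) by (rule complex_vector.span_base) (use w'(2) in blast)
    obtain c where c: "w' \<in> gen_eigenspace (wL0 W) c"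
      using S[OF w'(2)] L_power_gen_eigenspace w'(1) by blast
    have hom: "Y u m k (Y v n l w') \<in> X" if "u \<in> homogeneous V G h s \<alpha>" for u h s \<alpha>
    proof -
      have "clinear (\<lambda>v. Y u m k (Y v n l w'))"
        by (rule clinearI) (simp_all add: clinear_add[OF Y1] clinear_add[OF Y2] clinear_scale[OF Y1] clinear_scale[OF Y2])
      then show ?thesis
        by (rule clinear_span_image[OF _ homogeneous_span_UNIV X]) (use operator_mem[OF that _ c X iter] in blast)
    qed
    show ?thesis
      by (rule clinear_span_image[OF Y1 homogeneous_span_UNIV X]) (use hom in blast)
  qed
  show ?thesis
    by (rule clinear_span_image[OF Y2 x[unfolded X_def] X]) (use 1 in blast)
qed

text \<open>The span \<open>?X\<close> contains \<open>(wLm1 W ^^ k) w\<close>, as a value of the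
  vacuum operator, and is preserved by the fields in the products, which are coefficients of
  \<open>Y\<close>; so it contains a spanning set.\<close>

theorem generated_by_homogeneous:
  assumes S: "\<And>w. w \<in> S \<Longrightarrow> \<exists>c. w \<in> gen_eigenspace (wL0 W) c"
    and span: "cspan {field_product \<phi> xs ((wLm1 W ^^ k) w) | xs k w. (\<forall>(i, n, l)\<in>set xs. \<phi> i n l = Y (b i) n l) \<and> w \<in> S} = UNIV"
  shows "generated_by W Y S"
proof -
  let ?X = "cspan {Y v n k ((wLm1 W ^^ p) ((wL0 W ^^ q) w)) | v n k p q w. w \<in> S}"
  have X: "csubspace ?X" by (rule complex_vector.subspace_span)
  have base: "(wLm1 W ^^ k) w \<in> ?X" if "w \<in> S" for k w
  proof -
    have "(wLm1 W ^^ k) w = Y (vac V) (-1) 0 ((wLm1 W ^^ k) ((wL0 W ^^ 0) w))"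
      using twisted_moduleD(5)[OF tm] by simp
    then show ?thesis using that by (intro complex_vector.span_base) blast
  qed
  have "field_product \<phi> xs ((wLm1 W ^^ k) w) \<in> ?X"
    if "\<forall>(i, n, l)\<in>set xs. \<phi> i n l = Y (b i) n l" "w \<in> S" for xs k w
    using that(1)
    by (induction xs) (auto simp: base[OF that(2)] intro: operators_preserve_generated[OF S])
  then have "cspan {field_product \<phi> xs ((wLm1 W ^^ k) w) | xs k w. (\<forall>(i, n, l)\<in>set xs. \<phi> i n l = Y (b i) n l) \<and> w \<in> S} \<subseteq> ?X"
    by (intro complex_vector.span_minimal[OF _ X]) blast
  then show ?thesis unfolding span generated_by_def by blast
qed

end

text \<open>Both cases deliver the same two facts: the spanning statement, and that the proposed
  generators are generalized eigenvectors of \<open>wL0 W\<close>. For given data the latter is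
  contained in the creation property, for the quotient it is derived from the relations. Generation
  then follows for any module structure \<open>Y\<close> with the prescribed fields.\<close>

theorem theorem3p3:
  fixes V :: "'v::complex_vector vsa"
    and G :: "'v g_act"
    and F :: "('i, 'v) gen_fields"
    and W :: "'w::complex_vector gspace_data"
    and E :: "('i, 'a, 'v, 'w) twisted_fields"
    and M :: "('a, 'm::complex_vector) mdata"
  assumes "vertex_superalgebra V"
    and "vsa_automorphism V G"
    and "generating_fields V G F"
    and "twisted_field_data V G F W E \<or> (inducing_space M \<and> is_Mhat V G F M W E)"
  shows "cspan {field_product (phiW E) xs ((wLm1 W ^^ k) (psiW E a (-1) 0 (vac V))) | xs k a.
           (\<forall>(i, n, l)\<in>set xs. i \<in> idx F \<and> n - falpha F i \<in> \<int> \<and> l \<le> fK F i) \<and> a \<in> aidx E} = UNIV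
    \<and> (\<forall>Y. twisted_module V G W Y \<and>
           (\<forall>i\<in>idx F. Y (phi F i) = phiW E i) \<and>
           generated_by W Y {psiW E a n k v | a n k v. a \<in> aidx E}
         \<longrightarrow> generated_by W Y {psiW E a (-1) 0 (vac V) | a. a \<in> aidx E})"
proof -
  let ?T = "{field_product (phiW E) xs ((wLm1 W ^^ k) (psiW E a (-1) 0 (vac V))) | xs k a.
           (\<forall>(i, n, l)\<in>set xs. i \<in> idx F \<and> n - falpha F i \<in> \<int> \<and> l \<le> fK F i) \<and> a \<in> aidx E}"
  have *: "cspan ?T = UNIV \<and> (\<forall>a\<in>aidx E. \<exists>c. psiW E a (-1) 0 (vac V) \<in> gen_eigenspace (wL0 W) c)"
    using assms(4)
  proof
    assume data: "twisted_field_data V G F W E"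
    then have lb: "lower_bounded_space W" and cr: "creation_property V W E"
      unfolding twisted_field_data_def by blast+
    have "\<exists>c. psiW E a (-1) 0 (vac V) \<in> gen_eigenspace (wL0 W) c" if a: "a \<in> aidx E" for a
    proof -
      obtain n \<alpha> where "\<alpha> \<in> strip" "psiW E a (-1) 0 (vac V) \<in> wgr W n (psifer E a) \<alpha>"
        using cr[unfolded creation_property_def, THEN bspec, OF a, THEN conjunct2] by blast
      then have "psiW E a (-1) 0 (vac V) \<in> wwt W n"
        unfolding wwt_def by (intro complex_vector.span_base) blast
      then show ?thesis using lower_bounded_spaceD(7)[OF lb] by blast
    qed
    then show ?thesis using twisted_field_data_span[OF assms(1-3) data] by blast
  next
    assume "inducing_space M \<and> is_Mhat V G F M W E"
    then obtain \<pi> where "Mhat_projection V G F M W E \<pi>"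
      using is_MhatE[OF assms(1-3)] by blast
    then interpret Mhat_projection V G F M W E \<pi> .
    show ?thesis using field_products_span psi_vac_gen_eigenspace by (auto simp: aidx)
  qed
  show ?thesis
  proof (intro conjI allI impI)
    show "cspan ?T = UNIV" using * ..
  next
    fix Y assume Y: "twisted_module V G W Y \<and> (\<forall>i\<in>idx F. Y (phi F i) = phiW E i) \<and>
           generated_by W Y {psiW E a n k v | a n k v. a \<in> aidx E}"
    interpret twisted_module_operators V G W Y
      by unfold_locales (use assms(1,2) Y in blast)+
    let ?S = "{psiW E a (-1) 0 (vac V) | a. a \<in> aidx E}"
    have "?T \<subseteq> {field_product (phiW E) xs ((wLm1 W ^^ k) w) | xs k w.
        (\<forall>(i, n, l)\<in>set xs. phiW E i n l = Y (phi F i) n l) \<and> w \<in> ?S}"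
    proof
      fix t assume "t \<in> ?T"
      then obtain xs k a where t: "t = field_product (phiW E) xs ((wLm1 W ^^ k) (psiW E a (-1) 0 (vac V)))"
        "\<forall>(i, n, l)\<in>set xs. i \<in> idx F \<and> n - falpha F i \<in> \<int> \<and> l \<le> fK F i" "a \<in> aidx E"
        by blast
      have "\<forall>(i, n, l)\<in>set xs. phiW E i n l = Y (phi F i) n l" using t(2) Y by auto
      then show "t \<in> {field_product (phiW E) xs ((wLm1 W ^^ k) w) | xs k w.
          (\<forall>(i, n, l)\<in>set xs. phiW E i n l = Y (phi F i) n l) \<and> w \<in> ?S}"
        using t(1,3) by blast
    qed
    then have "cspan {field_product (phiW E) xs ((wLm1 W ^^ k) w) | xs k w.
        (\<forall>(i, n, l)\<in>set xs. phiW E i n l = Y (phi F i) n l) \<and> w \<in> ?S} = UNIV"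
      using * complex_vector.span_mono by blast
    then show "generated_by W Y ?S"
      using * by (intro generated_by_homogeneous) blast+
  qed
qed

end
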